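(* Under the regularity conditions (i)–(iii) below, the asymptotic sampling distribution of $\hat{\boldsymbol{\tau}}-\boldsymbol{\tau}$ under ReFM (threshold $a>0$) is more peaked than that under the CRFE; that is, the weak limit $\boldsymbol{\phi}$ of $\sqrt n(\hat{\boldsymbol{\tau}}-\boldsymbol{\tau})$ under ReFM and the weak limit $\boldsymbol{\psi}$ of $\sqrt n(\hat{\boldsymbol{\tau}}-\boldsymbol{\tau})$ under the CRFE satisfy $P(\boldsymbol{\phi}\in\mathcal{K})\ge P(\boldsymbol{\psi}\in\mathcal{K})$ for every symmetric convex set $\mathcal{K}\subset\mathbb{R}^F$.
   Context: Setup ($2^K$ factorial experiment, finite population). $K\ge1$ two-level factors, $Q=2^K$ treatment combinations $q=1,\dots,Q$; combination $q$ sets factor $k$ at $\iota_k(q)\in\{-1,+1\}$, bijectively onto $\{-1,+1\}^K$. $F=Q-1$ factorial effects, one per nonempty $A\subseteq\{1,\dots,K\}$, enumerated $f=1,\dots,F$, with $g_{fq}=\prod_{k\in A}\iota_k(q)$; $\boldsymbol{b}_q=(g_{1q},\dots,g_{Fq})'$. Units $i=1,\dots,n$ have fixed potential outcomes $Y_i(q)$ and covariates $\boldsymbol{x}_i\in\mathbb{R}^L$; $\bar Y(q),\bar{\boldsymbol{x}}$ means; $\boldsymbol{\tau}=2^{-(K-1)}\sum_q\boldsymbol{b}_q\bar Y(q)$. Finite-population (co)variances with divisor $n-1$: $S_{qk}$ between $Y(q),Y(k)$; $\boldsymbol{S}_{xx}$ of $\boldsymbol{x}$; $\boldsymbol{S}_{q,x}$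 between $Y(q)$ and $\boldsymbol{x}$. CRFE: fixed $n_q\ge1$, $\sum n_q=n$; $\boldsymbol{Z}$ uniform over assignments with $n_q$ units in combination $q$. $\hat{\bar Y}(q),\hat{\bar{\boldsymbol{x}}}(q)$ group-$q$ means of observed outcomes $Y_i(Z_i)$ and covariates; $\hat{\boldsymbol{\tau}}=2^{-(K-1)}\sum_q\boldsymbol{b}_q\hat{\bar Y}(q)$; $\hat{\boldsymbol{\tau}}_x=(\hat{\boldsymbol{\tau}}_{x,1}',\dots,\hat{\boldsymbol{\tau}}_{x,F}')'$, $\hat{\boldsymbol{\tau}}_{x,f}=2^{-(K-1)}\sum_qg_{fq}\hat{\bar{\boldsymbol{x}}}(q)$; $\boldsymbol{V}_{xx}=2^{-2(K-1)}\sum_qn_q^{-1}(\boldsymbol{b}_q\boldsymbol{b}_q')\otimes\boldsymbol{S}_{xx}$. ReFM: accept iff $\hat{\boldsymbol{\tau}}_x'\boldsymbol{V}_{xx}^{-1}\hat{\boldsymbol{\tau}}_x\le a$; distribution under ReFM = CRFE distribution conditional on acceptance. A set $\mathcal{K}$ is symmetric if $\mathcal{K}=-\mathcal{K}$. Regularity conditions, as $n\to\infty$, for all $q\ne k$: (i) $n_q/n$ has a positive limit; (ii) $S_{qq},S_{qk},\boldsymbol{S}_{xx},\boldsymbol{S}_{q,x}$ have limits, $\boldsymbol{S}_{xx}$ and its limit nonsingular; (iii) $\max_i|Y_i(q)-\bar Y(q)|^2/n\to0$, $\max_i\|\boldsymbol{x}_i-\bar{\boldsymbol{x}}\|_2^2/n\to0$.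 *)

theory Defs
  imports "HOL-Probability.Probability"
begin

text \<open>Factorial-effect coefficient g_{fq} = prod_{k in A_f} iota_k(q).
  Treatment combinations are elements of a finite type 'q, factorial effects
  elements of a finite type 'f, covariate coordinates elements of a finite type 'l.
  Factors are indexed 0..K-1.\<close>
definition gcoef :: "('f \<Rightarrow> nat set) \<Rightarrow> ('q \<Rightarrow> nat \<Rightarrow> real) \<Rightarrow> 'f \<Rightarrow> 'q \<Rightarrow> real" where
  "gcoef A \<iota> f q = (\<Prod>k\<in>A f. \<iota> q k)"

definition pmean :: "nat \<Rightarrow> (nat \<Rightarrow> real) \<Rightarrow> real" where
  "pmean n y = (\<Sum>i<n. y i) / real n"

definition pcov :: "nat \<Rightarrow> (nat \<Rightarrow> real) \<Rightarrow> (nat \<Rightarrow> real) \<Rightarrow> real" where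
  "pcov n y z = (\<Sum>i<n. (y i - pmean n y) * (z i - pmean n z)) / (real n - 1)"

definition Sxx :: "nat \<Rightarrow> (nat \<Rightarrow> real^'l) \<Rightarrow> real^'l^'l" where
  "Sxx n X = (\<chi> j l. pcov n (\<lambda>i. X i $ j) (\<lambda>i. X i $ l))"

definition Sqx :: "nat \<Rightarrow> (nat \<Rightarrow> 'q \<Rightarrow> real) \<Rightarrow> (nat \<Rightarrow> real^'l) \<Rightarrow> 'q \<Rightarrow> real^'l" where
  "Sqx n Y X q = (\<chi> l. pcov n (\<lambda>i. Y i q) (\<lambda>i. X i $ l))"

definition assignments :: "nat \<Rightarrow> ('q::finite \<Rightarrow> nat) \<Rightarrow> (nat \<Rightarrow> 'q) set" where
  "assignments n nq = {Z \<in> {..<n} \<rightarrow>\<^sub>E (UNIV::'q set). \<forall>q. card {i. i < n \<and> Z i = q} = nq q}"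

definition grpmean :: "nat \<Rightarrow> ('q \<Rightarrow> nat) \<Rightarrow> (nat \<Rightarrow> 'q) \<Rightarrow> (nat \<Rightarrow> 'v::real_vector) \<Rightarrow> 'q \<Rightarrow> 'v" where
  "grpmean n nq Z v q = (1 / real (nq q)) *\<^sub>R (\<Sum>i\<in>{i. i < n \<and> Z i = q}. v i)"

definition tau :: "nat \<Rightarrow> ('f \<Rightarrow> nat set) \<Rightarrow> ('q::finite \<Rightarrow> nat \<Rightarrow> real) \<Rightarrow> nat \<Rightarrow> (nat \<Rightarrow> 'q \<Rightarrow> real) \<Rightarrow> real^'f" where
  "tau K A \<iota> n Y = (\<chi> f. (1 / 2 ^ (K - 1)) * (\<Sum>q\<in>UNIV. gcoef A \<iota> f q * pmean n (\<lambda>i. Y i q)))"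

text \<open>Observed outcome of unit i is Y i (Z i); in group q this equals Y i q.\<close>
definition tauhat :: "nat \<Rightarrow> ('f \<Rightarrow> nat set) \<Rightarrow> ('q::finite \<Rightarrow> nat \<Rightarrow> real) \<Rightarrow> nat \<Rightarrow> ('q \<Rightarrow> nat)
    \<Rightarrow> (nat \<Rightarrow> 'q \<Rightarrow> real) \<Rightarrow> (nat \<Rightarrow> 'q) \<Rightarrow> real^'f" where
  "tauhat K A \<iota> n nq Y Z = (\<chi> f. (1 / 2 ^ (K - 1)) *
      (\<Sum>q\<in>UNIV. gcoef A \<iota> f q * grpmean n nq Z (\<lambda>i. Y i (Z i)) q))"

definition tauhat_x :: "nat \<Rightarrow> ('f::finite \<Rightarrow> nat set) \<Rightarrow> ('q::finite \<Rightarrow> nat \<Rightarrow> real) \<Rightarrow> nat \<Rightarrow> ('q \<Rightarrow> nat)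
    \<Rightarrow> (nat \<Rightarrow> real^'l::finite) \<Rightarrow> (nat \<Rightarrow> 'q) \<Rightarrow> real^('f \<times> 'l)" where
  "tauhat_x K A \<iota> n nq X Z = (\<chi> p. (1 / 2 ^ (K - 1)) *
      (\<Sum>q\<in>UNIV. gcoef A \<iota> (fst p) q * (grpmean n nq Z X q) $ (snd p)))"

text \<open>V_xx = 2^{-2(K-1)} sum_q n_q^{-1} (b_q b_q') \<otimes> S_xx, indexed by pairs.\<close>
definition Vxx :: "nat \<Rightarrow> ('f::finite \<Rightarrow> nat set) \<Rightarrow> ('q::finite \<Rightarrow> nat \<Rightarrow> real) \<Rightarrow> nat \<Rightarrow> ('q \<Rightarrow> nat)
    \<Rightarrow> (nat \<Rightarrow> real^'l::finite) \<Rightarrow> real^('f \<times> 'l)^('f \<times> 'l)" where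
  "Vxx K A \<iota> n nq X = (\<chi> p p'. (1 / 2 ^ (2 * (K - 1))) *
      (\<Sum>q\<in>UNIV. gcoef A \<iota> (fst p) q * gcoef A \<iota> (fst p') q / real (nq q)) *
      Sxx n X $ (snd p) $ (snd p'))"

definition accepted :: "nat \<Rightarrow> ('f::finite \<Rightarrow> nat set) \<Rightarrow> ('q::finite \<Rightarrow> nat \<Rightarrow> real) \<Rightarrow> nat \<Rightarrow> ('q \<Rightarrow> nat)
    \<Rightarrow> (nat \<Rightarrow> real^'l::finite) \<Rightarrow> real \<Rightarrow> (nat \<Rightarrow> 'q) set" where
  "accepted K A \<iota> n nq X a = {Z \<in> assignments n nq.
      tauhat_x K A \<iota> n nq X Z \<bullet> (matrix_inv (Vxx K A \<iota> n nq X) *v tauhat_x K A \<iota> n nq X Z) \<le> a}"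

text \<open>Sampling distribution (as a Borel measure on R^F) of sqrt n (tauhat - tau) when Z is
  uniform on the finite set S (S = all CRFE assignments, or the accepted ones for ReFM,
  i.e. the CRFE distribution conditioned on acceptance).\<close>
definition samp_dist :: "nat \<Rightarrow> ('f \<Rightarrow> nat set) \<Rightarrow> ('q::finite \<Rightarrow> nat \<Rightarrow> real) \<Rightarrow> nat \<Rightarrow> ('q \<Rightarrow> nat)
    \<Rightarrow> (nat \<Rightarrow> 'q \<Rightarrow> real) \<Rightarrow> (nat \<Rightarrow> 'q) set \<Rightarrow> (real^'f::finite) measure" where
  "samp_dist K A \<iota> n nq Y S = distr (measure_pmf (pmf_of_set S)) borel
      (\<lambda>Z. sqrt (real n) *\<^sub>R (tauhat K A \<iota> n nq Y Z - tau K A \<iota> n Y))"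

definition weak_conv_to :: "(nat \<Rightarrow> 'a::topological_space measure) \<Rightarrow> 'a measure \<Rightarrow> bool" where
  "weak_conv_to M \<mu> \<longleftrightarrow> prob_space \<mu> \<and> sets \<mu> = sets borel \<and>
     (\<forall>h :: 'a \<Rightarrow> real. continuous_on UNIV h \<and> bounded (range h) \<longrightarrow>
        (\<lambda>m. integral\<^sup>L (M m) h) \<longlonglongrightarrow> integral\<^sup>L \<mu> h)"

end

theory Submission
  imports Defs "HOL-Real_Asymp.Real_Asymp"
begin

text \<open>Stack the scaled effect estimates and covariate contrasts into one vector. Swapping the treatments
  of two units gives an exchangeable pair for every linear functional of it, and Stein's identity for this
  pair turns into the differential equation of a Gaussian characteristic function up to a vanishing error;
  so the vector converges weakly to a Gaussian \<open>(u, w)\<close>. Writing \<open>w = L' y\<close> and \<open>u = N' x + P' y\<close> with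
  independent standard Gaussian \<open>x\<close> and \<open>y\<close>, the acceptance criterion becomes \<open>|y|^2 \<le> a\<close> in the limit.
  For a symmetric convex set \<open>C\<close>, Anderson's theorem (from the one-dimensional Prekopa--Leindler inequality)
  says that the conditional probability of \<open>u \<in> C\<close> given \<open>y\<close> decreases along rays, and the average of a radially
  decreasing function over a centred ball is at least its average over the whole space.\<close>

section \<open>Prekopa--Leindler inequality and Anderson's theorem\<close>

lemma vimage_borel_measurable:
  assumes "f \<in> borel_measurable borel" "A \<in> sets borel"
  shows "f -` A \<in> sets borel"
  using measurable_sets[OF assms] by simp

lemma emeasure_lborel_minkowski_bounded:
  fixes A B C :: "real set"
  assumes [measurable]: "A \<in> sets borel" "B \<in> sets borel" "C \<in> sets borel"
    and "A \<noteq> {}" "B \<noteq> {}" and bdd: "bounded A" "bounded B"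
    and sub: "\<And>x y. x \<in> A \<Longrightarrow> y \<in> B \<Longrightarrow> x + y \<in> C"
  shows "emeasure lborel A + emeasure lborel B \<le> emeasure lborel C"
proof (rule ennreal_le_epsilon)
  fix e :: real assume e: "0 < e"
  have bA: "bdd_above A" and bB: "bdd_below B"
    using bdd by (auto intro: bounded_imp_bdd_above bounded_imp_bdd_below)
  obtain a where a: "a \<in> A" "Sup A - e / 2 < a"
    using less_cSup_iff[OF \<open>A \<noteq> {}\<close> bA, of "Sup A - e/2"] e by auto
  obtain b where b: "b \<in> B" "b < Inf B + e / 2"
    using cInf_less_iff[OF \<open>B \<noteq> {}\<close> bB, of "Inf B + e/2"] e by auto
  define A' where "A' = (\<lambda>x. x - b) -` A"
  define B' where "B' = (\<lambda>x. x - a) -` B"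
  have [measurable]: "A' \<in> sets borel" "B' \<in> sets borel"
    unfolding A'_def B'_def by (auto intro!: vimage_borel_measurable simp: assms)
  have shift: "emeasure lborel ((\<lambda>x. x - c) -` D) = emeasure lborel D"
    if [measurable]: "D \<in> sets borel" for c and D :: "real set"
  proof -
    have "emeasure lborel D = emeasure (distr lborel borel ((+) (-c))) D"
      by (simp add: lborel_distr_plus)
    also have "\<dots> = emeasure lborel ((\<lambda>x. x - c) -` D)"
      by (subst emeasure_distr) (auto simp: vimage_def)
    finally show ?thesis by simp
  qed
  have "emeasure lborel A + emeasure lborel B = emeasure lborel A' + emeasure lborel B'"
    unfolding A'_def B'_def by (simp add: shift assms)
  also have "\<dots> = emeasure lborel (A' \<union> B') + emeasure lborel (A' \<inter> B')"
    by (rule emeasure_Un_Int) auto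
  also have "\<dots> \<le> emeasure lborel C + emeasure lborel {a + Inf B .. Sup A + b}"
  proof (rule add_mono; rule emeasure_mono)
    show "A' \<union> B' \<subseteq> C"
      using sub[OF _ b(1)] sub[OF a(1)] by (fastforce simp: A'_def B'_def)
    show "A' \<inter> B' \<subseteq> {a + Inf B .. Sup A + b}"
      using cSup_upper[OF _ bA] cInf_lower[OF _ bB] by (fastforce simp: A'_def B'_def algebra_simps)
  qed auto
  also have "emeasure lborel {a + Inf B .. Sup A + b} \<le> ennreal e"
  proof (cases "a + Inf B \<le> Sup A + b")
    case True
    then show ?thesis using a b by (simp add: ennreal_leI)
  qed auto
  finally show "emeasure lborel A + emeasure lborel B \<le> emeasure lborel C + ennreal e"
    by (simp add: add_left_mono)
qed

lemma emeasure_lborel_scale: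
  fixes A :: "real set"
  assumes [measurable]: "A \<in> sets borel" and "c > 0"
  shows "emeasure lborel ((\<lambda>x. x / c) -` A) = ennreal c * emeasure lborel A"
proof -
  have "emeasure lborel ((\<lambda>x. x / c) -` A) = (\<integral>\<^sup>+x. indicator A (x / c) \<partial>lborel)"
    by (subst nn_integral_indicator[symmetric])
      (auto intro!: vimage_borel_measurable nn_integral_cong split: split_indicator simp: assms)
  also have "\<dots> = ennreal c * (\<integral>\<^sup>+x. indicator A x \<partial>lborel)"
    using \<open>c > 0\<close> by (subst nn_integral_real_affine[where c=c and t=0]) auto
  finally show ?thesis by simp
qed

lemma emeasure_lborel_brunn_minkowski:
  fixes A B C :: "real set"
  assumes [measurable]: "A \<in> sets borel" "B \<in> sets borel" "C \<in> sets borel"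
    and ne: "A \<noteq> {}" "B \<noteq> {}" and bdd: "bounded A" "bounded B" and l: "0 < l" "l < 1"
    and sub: "\<And>x y. x \<in> A \<Longrightarrow> y \<in> B \<Longrightarrow> (1 - l) * x + l * y \<in> C"
  shows "ennreal (1 - l) * emeasure lborel A + ennreal l * emeasure lborel B \<le> emeasure lborel C"
proof -
  have scl: "(\<lambda>x. x / c) -` D = (\<lambda>x. c * x) ` D" if "c > 0" for c :: real and D
    using that by (force simp: image_def field_simps)
  have bd: "bounded ((\<lambda>x. c * x) ` D)" if "bounded D" for c :: real and D
    using bounded_scaling[OF that, of c] by simp
  have "emeasure lborel ((\<lambda>x. x / (1 - l)) -` A) + emeasure lborel ((\<lambda>x. x / l) -` B) \<le> emeasure lborel C"
  proof (rule emeasure_lborel_minkowski_bounded)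
    show "bounded ((\<lambda>x. x / (1 - l)) -` A)" "bounded ((\<lambda>x. x / l) -` B)"
      "(\<lambda>x. x / (1 - l)) -` A \<noteq> {}" "(\<lambda>x. x / l) -` B \<noteq> {}"
      using l ne bdd by (auto simp: scl bd)
    show "x + y \<in> C" if "x \<in> (\<lambda>x. x / (1 - l)) -` A" "y \<in> (\<lambda>x. x / l) -` B" for x y
      using sub[of "x / (1 - l)" "y / l"] that l by auto
  qed (auto intro!: vimage_borel_measurable simp: assms)
  then show ?thesis using l by (simp add: emeasure_lborel_scale)
qed

lemma nn_integral_eq_level_sets:
  fixes f :: "real \<Rightarrow> real"
  assumes [measurable]: "f \<in> borel_measurable borel" and "\<And>x. 0 \<le> f x"
  shows "(\<integral>\<^sup>+x. ennreal (f x) \<partial>lborel) = (\<integral>\<^sup>+s. indicator {0<..} s * emeasure lborel {x. s < f x} \<partial>lborel)"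
proof -
  have "(\<integral>\<^sup>+x. ennreal (f x) \<partial>lborel) = (\<integral>\<^sup>+x. \<integral>\<^sup>+s. indicator {0<..} s * indicator {x. s < f x} x \<partial>lborel \<partial>lborel)"
  proof (rule nn_integral_cong)
    fix x :: real
    have "(\<integral>\<^sup>+s. indicator {0<..} s * indicator {x. s < f x} x \<partial>lborel) = (\<integral>\<^sup>+s. indicator {0<..<f x} s \<partial>lborel)"
      by (rule nn_integral_cong) (auto split: split_indicator)
    also have "\<dots> = ennreal (f x)"
      using assms(2)[of x] by simp
    finally show "ennreal (f x) = (\<integral>\<^sup>+s. indicator {0<..} s * indicator {x. s < f x} x \<partial>lborel)"
      by (rule sym)
  qed
  also have "\<dots> = (\<integral>\<^sup>+s. \<integral>\<^sup>+x. indicator {0<..} s * indicator {x. s < f x} x \<partial>lborel \<partial>lborel)"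
  proof (rule lborel_pair.Fubini')
    show "(\<lambda>(s, x). indicator {0<..} s * indicator {x. s < f x} x :: ennreal) \<in> borel_measurable (lborel \<Otimes>\<^sub>M lborel)"
      unfolding indicator_def by measurable
  qed
  also have "\<dots> = (\<integral>\<^sup>+s. indicator {0<..} s * emeasure lborel {x. s < f x} \<partial>lborel)"
    by (rule nn_integral_cong) (simp add: nn_integral_cmult)
  finally show ?thesis .
qed

lemma prekopa_leindler_normalized:
  fixes f g h :: "real \<Rightarrow> real"
  assumes [measurable]: "f \<in> borel_measurable borel" "g \<in> borel_measurable borel" "h \<in> borel_measurable borel"
    and nn: "\<And>x. 0 \<le> f x" "\<And>x. 0 \<le> g x" "\<And>x. 0 \<le> h x"
    and le1: "\<And>x. f x \<le> 1" "\<And>x. g x \<le> 1"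
    and sup: "\<And>s. s < 1 \<Longrightarrow> \<exists>x. s < f x" "\<And>s. s < 1 \<Longrightarrow> \<exists>x. s < g x"
    and bdd: "\<And>s. s > 0 \<Longrightarrow> bounded {x. s < f x}" "\<And>s. s > 0 \<Longrightarrow> bounded {x. s < g x}"
    and l: "0 < l" "l < 1"
    and le: "\<And>x y. f x powr (1 - l) * g y powr l \<le> h ((1 - l) * x + l * y)"
  shows "ennreal (1 - l) * (\<integral>\<^sup>+x. ennreal (f x) \<partial>lborel) + ennreal l * (\<integral>\<^sup>+x. ennreal (g x) \<partial>lborel)
    \<le> (\<integral>\<^sup>+x. ennreal (h x) \<partial>lborel)"
proof -
  have m: "(\<lambda>s. emeasure lborel {x. s < u x}) \<in> borel_measurable lborel"
    if [measurable]: "u \<in> borel_measurable borel" for u :: "real \<Rightarrow> real"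
  proof -
    have "(\<lambda>s. \<integral>\<^sup>+x. indicator {x. s < u x} x \<partial>lborel) \<in> borel_measurable lborel"
      unfolding indicator_def by measurable
    then show ?thesis by simp
  qed
  have "ennreal (1 - l) * (\<integral>\<^sup>+x. ennreal (f x) \<partial>lborel) + ennreal l * (\<integral>\<^sup>+x. ennreal (g x) \<partial>lborel)
    = (\<integral>\<^sup>+s. ennreal (1 - l) * (indicator {0<..} s * emeasure lborel {x. s < f x})
           + ennreal l * (indicator {0<..} s * emeasure lborel {x. s < g x}) \<partial>lborel)"
    using m by (simp add: nn_integral_eq_level_sets nn nn_integral_cmult nn_integral_add del: mult.assoc)
  also have "\<dots> \<le> (\<integral>\<^sup>+s. indicator {0<..} s * emeasure lborel {x. s < h x} \<partial>lborel)"
  proof (rule nn_integral_mono)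
    fix s :: real
    show "ennreal (1 - l) * (indicator {0<..} s * emeasure lborel {x. s < f x})
           + ennreal l * (indicator {0<..} s * emeasure lborel {x. s < g x})
       \<le> indicator {0<..} s * emeasure lborel {x. s < h x}"
    proof (cases "0 < s \<and> s < 1")
      case True
      have "ennreal (1 - l) * emeasure lborel {x. s < f x} + ennreal l * emeasure lborel {x. s < g x}
        \<le> emeasure lborel {x. s < h x}"
      proof (rule emeasure_lborel_brunn_minkowski)
        show "{x. s < f x} \<noteq> {}" "{x. s < g x} \<noteq> {}" using sup True by auto
        show "bounded {x. s < f x}" "bounded {x. s < g x}" using bdd True by auto
        fix x y assume xy: "x \<in> {x. s < f x}" "y \<in> {x. s < g x}"
        have "s = s powr (1 - l) * s powr l" using True by (simp flip: powr_add)
        also have "\<dots> < f x powr (1 - l) * g y powr l"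
          using True xy l by (intro mult_strict_mono powr_less_mono2) auto
        also have "\<dots> \<le> h ((1 - l) * x + l * y)" by (rule le)
        finally show "(1 - l) * x + l * y \<in> {x. s < h x}" by simp
      qed (use l in auto)
      then show ?thesis using True by simp
    next
      case False
      then consider "s \<le> 0" | "1 \<le> s" by linarith
      then show ?thesis
      proof cases
        case 2
        then have "{x. s < f x} = {}" "{x. s < g x} = {}" using le1 by (auto simp: not_less intro: order_trans)
        then show ?thesis by simp
      qed auto
    qed
  qed
  also have "\<dots> = (\<integral>\<^sup>+x. ennreal (h x) \<partial>lborel)"
    by (simp add: nn_integral_eq_level_sets nn)
  finally show ?thesis .
qed

theorem prekopa_leindler:
  fixes f g h :: "real \<Rightarrow> real"
  assumes int: "integrable lborel f" "integrable lborel g" "integrable lborel h"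
    and nn: "\<And>x. 0 \<le> f x" "\<And>x. 0 \<le> g x" "\<And>x. 0 \<le> h x"
    and ub: "\<And>x. f x \<le> c" "\<And>x. g x \<le> c"
    and bdd: "\<And>s. s > 0 \<Longrightarrow> bounded {x. s < f x}" "\<And>s. s > 0 \<Longrightarrow> bounded {x. s < g x}"
    and l: "0 < l" "l < 1"
    and le: "\<And>x y. f x powr (1 - l) * g y powr l \<le> h ((1 - l) * x + l * y)"
  shows "(\<integral>x. f x \<partial>lborel) powr (1 - l) * (\<integral>x. g x \<partial>lborel) powr l \<le> (\<integral>x. h x \<partial>lborel)"
proof (cases "(\<integral>x. f x \<partial>lborel) = 0 \<or> (\<integral>x. g x \<partial>lborel) = 0")
  case True
  then show ?thesis using nn by (auto intro!: integral_nonneg)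
next
  case False
  have [measurable]: "f \<in> borel_measurable borel" "g \<in> borel_measurable borel" "h \<in> borel_measurable borel"
    using int by auto
  have sup_pos: "0 < (SUP x. u x) \<and> (\<forall>x. u x \<le> (SUP x. u x)) \<and> (\<forall>s<(SUP x. u x). \<exists>x. s < u x)"
    if u: "\<And>x. 0 \<le> u x" "\<And>x. u x \<le> c" "(\<integral>x. u x \<partial>lborel) \<noteq> 0" for u :: "real \<Rightarrow> real"
  proof -
    have b: "bdd_above (range u)" using u(2) by (auto intro: bdd_aboveI[of _ c])
    obtain x where "u x \<noteq> 0" using u(3) by (metis Bochner_Integration.integral_cong integral_zero)
    then have "0 < u x" using u(1)[of x] by simp
    then have "0 < (SUP x. u x)" using cSUP_upper[OF _ b, of x] by simp
    then show ?thesis using cSUP_upper[OF _ b] less_cSUP_iff[OF _ b] by auto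
  qed
  define F where "F = (SUP x. f x)"
  define G where "G = (SUP x. g x)"
  have F: "0 < F" "\<And>x. f x \<le> F" "\<And>s. s < F \<Longrightarrow> \<exists>x. s < f x"
    using sup_pos[of f, OF nn(1) ub(1)] False unfolding F_def by auto
  have G: "0 < G" "\<And>x. g x \<le> G" "\<And>s. s < G \<Longrightarrow> \<exists>x. s < g x"
    using sup_pos[of g, OF nn(2) ub(2)] False unfolding G_def by auto
  define H where "H = F powr (1 - l) * G powr l"
  have H: "0 < H" using F G by (simp add: H_def)
  define If where "If = (\<integral>x. f x \<partial>lborel)"
  define Ig where "Ig = (\<integral>x. g x \<partial>lborel)"
  define Ih where "Ih = (\<integral>x. h x \<partial>lborel)"
  have nnI: "0 \<le> If" "0 \<le> Ig" "0 \<le> Ih" using nn by (auto simp: If_def Ig_def Ih_def)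
  have "ennreal (1 - l) * (\<integral>\<^sup>+x. ennreal (f x / F) \<partial>lborel) + ennreal l * (\<integral>\<^sup>+x. ennreal (g x / G) \<partial>lborel)
      \<le> (\<integral>\<^sup>+x. ennreal (h x / H) \<partial>lborel)"
  proof (rule prekopa_leindler_normalized)
    show "f x / F \<le> 1" "g x / G \<le> 1" for x using F G by auto
    show "\<exists>x. s < f x / F" if "s < 1" for s
      using F(3)[of "s * F"] F(1) that by (auto simp: field_simps)
    show "\<exists>x. s < g x / G" if "s < 1" for s
      using G(3)[of "s * G"] G(1) that by (auto simp: field_simps)
    show "bounded {x. s < f x / F}" if "0 < s" for s
      using bdd(1)[of "s * F"] F(1) that by (auto simp: field_simps)
    show "bounded {x. s < g x / G}" if "0 < s" for s
      using bdd(2)[of "s * G"] G(1) that by (auto simp: field_simps)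
    show "(f x / F) powr (1 - l) * (g y / G) powr l \<le> h ((1 - l) * x + l * y) / H" for x y
      using le[of x y] F(1) G(1) nn H by (simp add: powr_divide H_def field_simps)
  qed (use nn F G H l in auto)
  also have "(\<integral>\<^sup>+x. ennreal (f x / F) \<partial>lborel) = ennreal (If / F)"
    using int nn F by (subst nn_integral_eq_integral) (auto simp: If_def)
  also have "(\<integral>\<^sup>+x. ennreal (g x / G) \<partial>lborel) = ennreal (Ig / G)"
    using int nn G by (subst nn_integral_eq_integral) (auto simp: Ig_def)
  also have "(\<integral>\<^sup>+x. ennreal (h x / H) \<partial>lborel) = ennreal (Ih / H)"
    using int nn H by (subst nn_integral_eq_integral) (auto simp: Ih_def)
  finally have *: "(1 - l) * (If / F) + l * (Ig / G) \<le> Ih / H"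
    using l nnI F G H by (simp flip: ennreal_mult ennreal_plus)
  have "(If / F) powr (1 - l) * (Ig / G) powr l \<le> (1 - l) * (If / F) + l * (Ig / G)"
    using l nnI F G False by (intro Youngs_inequality_0) (auto simp: less_le If_def Ig_def)
  with * have "(If / F) powr (1 - l) * (Ig / G) powr l \<le> Ih / H" by simp
  moreover have "(If / F) powr (1 - l) * (Ig / G) powr l = (If powr (1 - l) * Ig powr l) / H"
    using nnI F G by (simp add: powr_divide H_def)
  ultimately show ?thesis using H by (simp add: If_def Ig_def Ih_def divide_le_cancel)
qed

abbreviation std_normal :: "real measure" where
  "std_normal \<equiv> density lborel std_normal_density"

lemma std_normal_prob: "prob_space std_normal"
  by (rule prob_space_normal_density) simp

lemma std_normal_density_log_concave:
  assumes "0 < l" "l < 1"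
  shows "std_normal_density x powr (1 - l) * std_normal_density y powr l
    \<le> std_normal_density ((1 - l) * x + l * y)"
proof -
  define k where "k = 1 / sqrt (2 * pi)"
  have k: "0 < k" by (simp add: k_def)
  have d: "std_normal_density z = k * exp (- (z\<^sup>2 / 2))" for z
    by (simp add: std_normal_density_def k_def)
  have c: "((1 - l) * x + l * y)\<^sup>2 \<le> (1 - l) * x\<^sup>2 + l * y\<^sup>2"
  proof -
    have "(1 - l) * x\<^sup>2 + l * y\<^sup>2 - ((1 - l) * x + l * y)\<^sup>2 = (1 - l) * l * (x - y)\<^sup>2"
      by (simp add: power2_eq_square algebra_simps)
    moreover have "0 \<le> (1 - l) * l * (x - y)\<^sup>2" using assms by simp
    ultimately show ?thesis by linarith
  qed
  have "std_normal_density x powr (1 - l) * std_normal_density y powr l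
    = (k powr (1 - l) * k powr l) * (exp (- (x\<^sup>2 / 2)) powr (1 - l) * exp (- (y\<^sup>2 / 2)) powr l)"
    using k by (simp add: d powr_mult)
  also have "k powr (1 - l) * k powr l = k" using k by (simp flip: powr_add)
  also have "exp (- (x\<^sup>2 / 2)) powr (1 - l) * exp (- (y\<^sup>2 / 2)) powr l
      = exp (- (((1 - l) * x\<^sup>2 + l * y\<^sup>2) / 2))"
    by (simp add: powr_def mult_exp_exp field_simps)
  also have "k * \<dots> \<le> k * exp (- (((1 - l) * x + l * y)\<^sup>2 / 2))"
    using c k by simp
  finally show ?thesis by (simp add: d)
qed

lemma bounded_std_normal_density_level_set:
  assumes "0 < s"
  shows "bounded {x. s < std_normal_density x}"
proof -
  have "std_normal_density x \<le> 2 / x\<^sup>2" if "x \<noteq> 0" for x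
  proof -
    have "exp (- (x\<^sup>2 / 2)) = 1 / exp (x\<^sup>2 / 2)" by (simp add: exp_minus field_simps)
    also have "\<dots> \<le> 1 / (x\<^sup>2 / 2)"
      using that exp_ge_add_one_self[of "x\<^sup>2 / 2"] by (intro divide_left_mono) (auto simp del: exp_ge_add_one_self)
    also have "\<dots> = 2 / x\<^sup>2" by simp
    finally have e: "exp (- (x\<^sup>2 / 2)) \<le> 2 / x\<^sup>2" .
    have "1 / sqrt (2 * pi) \<le> 1" using pi_gt3 by (simp add: real_le_rsqrt)
    then show ?thesis using e mult_mono[of "1 / sqrt (2 * pi)" 1 "exp (- (x\<^sup>2 / 2))" "2 / x\<^sup>2"]
      by (simp add: std_normal_density_def)
  qed
  then have "\<bar>x\<bar> \<le> sqrt (2 / s)" if "s < std_normal_density x" for x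
  proof (cases "x = 0")
    case False
    then have "s < 2 / x\<^sup>2" using that \<open>\<And>x. x \<noteq> 0 \<Longrightarrow> std_normal_density x \<le> 2 / x\<^sup>2\<close>[of x] by simp
    then have "x\<^sup>2 \<le> 2 / s" using assms False by (simp add: field_simps)
    then show ?thesis by (simp add: real_le_rsqrt)
  qed (use assms in simp)
  then show ?thesis by (auto simp: bounded_iff)
qed

lemma prekopa_leindler_std_normal:
  fixes f g h :: "real \<Rightarrow> real"
  assumes [measurable]: "f \<in> borel_measurable borel" "g \<in> borel_measurable borel" "h \<in> borel_measurable borel"
    and f: "\<And>x. 0 \<le> f x" "\<And>x. f x \<le> 1" and g: "\<And>x. 0 \<le> g x" "\<And>x. g x \<le> 1"
    and h: "\<And>x. 0 \<le> h x" "\<And>x. h x \<le> 1"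
    and l: "0 < l" "l < 1"
    and le: "\<And>x y. f x powr (1 - l) * g y powr l \<le> h ((1 - l) * x + l * y)"
  shows "(\<integral>x. f x \<partial>std_normal) powr (1 - l) * (\<integral>x. g x \<partial>std_normal) powr l \<le> (\<integral>x. h x \<partial>std_normal)"
proof -
  interpret prob_space std_normal by (rule std_normal_prob)
  let ?d = std_normal_density
  have nn: "0 \<le> ?d x" for x by (simp add: normal_density_nonneg)
  have eq: "(\<integral>x. u x \<partial>std_normal) = (\<integral>x. ?d x * u x \<partial>lborel) \<and> integrable lborel (\<lambda>x. ?d x * u x)
      \<and> (\<forall>x. ?d x * u x \<le> 1) \<and> (\<forall>s>0. bounded {x. s < ?d x * u x}) \<and> (\<forall>x. 0 \<le> ?d x * u x)"
    if [measurable]: "u \<in> borel_measurable borel" and u: "\<And>x. 0 \<le> u x" "\<And>x. u x \<le> 1" for u :: "real \<Rightarrow> real"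
  proof -
    have "integrable std_normal u"
      by (rule integrable_const_bound[where B=1]) (use u in auto)
    then have i: "integrable lborel (\<lambda>x. ?d x * u x)"
      by (subst (asm) integrable_density) (auto simp: nn)
    have le: "?d x * u x \<le> ?d x" for x using mult_left_mono[OF u(2) nn, of x x] by simp
    have "?d x \<le> 1" for x
    proof -
      have "1 / sqrt (2 * pi) \<le> 1" using pi_gt3 by (simp add: real_le_rsqrt)
      then show ?thesis using mult_mono[of "1 / sqrt (2 * pi)" 1 "exp (- (x\<^sup>2 / 2))" 1]
        by (simp add: std_normal_density_def)
    qed
    then have "\<forall>x. ?d x * u x \<le> 1" using le order_trans by blast
    moreover have "bounded {x. s < ?d x * u x}" if "s > 0" for s
      by (rule bounded_subset[OF bounded_std_normal_density_level_set[OF that]]) (use le in \<open>auto intro: less_le_trans\<close>)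
    ultimately show ?thesis using i u nn
      by (simp add: integral_density)
  qed
  note f' = eq[of f, OF _ f] and g' = eq[of g, OF _ g] and h' = eq[of h, OF _ h]
  have "(\<integral>x. ?d x * f x \<partial>lborel) powr (1 - l) * (\<integral>x. ?d x * g x \<partial>lborel) powr l \<le> (\<integral>x. ?d x * h x \<partial>lborel)"
  proof (rule prekopa_leindler[where c=1])
    fix x y
    have "(?d x * f x) powr (1 - l) * (?d y * g y) powr l
       = (?d x powr (1 - l) * ?d y powr l) * (f x powr (1 - l) * g y powr l)"
      using nn f g by (simp add: powr_mult)
    also have "\<dots> \<le> ?d ((1 - l) * x + l * y) * h ((1 - l) * x + l * y)"
      using le std_normal_density_log_concave[OF l] nn by (intro mult_mono) auto
    finally show "(?d x * f x) powr (1 - l) * (?d y * g y) powr l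
      \<le> ?d ((1 - l) * x + l * y) * h ((1 - l) * x + l * y)" .
  qed (use f' g' h' l in auto)
  then show ?thesis using f' g' h' by simp
qed

lemma log_concave_marginal:
  fixes F :: "'v::real_vector \<Rightarrow> ('i \<Rightarrow> real) \<Rightarrow> real"
  assumes "finite I" and l: "0 < l" "l < 1"
    and "\<And>v. F v \<in> borel_measurable (Pi\<^sub>M I (\<lambda>_. std_normal))"
    and "\<And>v x. 0 \<le> F v x" "\<And>v x. F v x \<le> 1"
    and "\<And>v w x y. x \<in> extensional I \<Longrightarrow> y \<in> extensional I \<Longrightarrow> F v x powr (1 - l) * F w y powr l
        \<le> F ((1 - l) *\<^sub>R v + l *\<^sub>R w) (\<lambda>k. (1 - l) * x k + l * y k)"
  shows "(\<integral>x. F v x \<partial>Pi\<^sub>M I (\<lambda>_. std_normal)) powr (1 - l) * (\<integral>x. F w x \<partial>Pi\<^sub>M I (\<lambda>_. std_normal)) powr l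
    \<le> (\<integral>x. F ((1 - l) *\<^sub>R v + l *\<^sub>R w) x \<partial>Pi\<^sub>M I (\<lambda>_. std_normal))"
  using assms(1,4-)
proof (induction I arbitrary: F v w rule: finite_induct)
  case empty
  show ?case using empty(4)[of "\<lambda>_. undefined" "\<lambda>_. undefined" v w]
    by (simp add: PiM_empty lebesgue_integral_count_space_finite flip: distrib_right)
next
  case (insert i J)
  note [measurable] = insert.prems(1)
  interpret N: prob_space std_normal by (rule std_normal_prob)
  interpret P: product_prob_space "\<lambda>_::'i. std_normal" by unfold_locales
  interpret PJ: prob_space "Pi\<^sub>M J (\<lambda>_::'i. std_normal)" by (rule prob_space_PiM) unfold_locales
  interpret PI: prob_space "Pi\<^sub>M (insert i J) (\<lambda>_::'i. std_normal)" by (rule prob_space_PiM) unfold_locales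
  define G where "G v x = (\<integral>y. F v (x(i := y)) \<partial>std_normal)" for v x
  have mF: "(\<lambda>(x, y). F v (x(i := y))) \<in> borel_measurable (Pi\<^sub>M J (\<lambda>_. std_normal) \<Otimes>\<^sub>M std_normal)" for v
    by measurable
  have mF1: "(\<lambda>y. F v (x(i := y))) \<in> borel_measurable borel" if "x \<in> space (Pi\<^sub>M J (\<lambda>_. std_normal))" for v x
    using measurable_Pair2[OF mF that] by simp
  have int: "(\<integral>x. F v x \<partial>Pi\<^sub>M (insert i J) (\<lambda>_. std_normal)) = (\<integral>x. G v x \<partial>Pi\<^sub>M J (\<lambda>_. std_normal))" for v
    unfolding G_def
    by (rule P.product_integral_insert[OF insert.hyps])
      (rule PI.integrable_const_bound[where B=1], use insert.prems in auto)
  show ?case unfolding int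
  proof (rule insert.IH)
    show "G v \<in> borel_measurable (Pi\<^sub>M J (\<lambda>_. std_normal))" for v
      unfolding G_def by (rule N.borel_measurable_lebesgue_integral) (rule mF)
    show "0 \<le> G v x" for v x unfolding G_def by (rule Bochner_Integration.integral_nonneg) (rule insert.prems)
    show "G v x \<le> 1" for v x
      unfolding G_def using insert.prems(3)
      by (cases "integrable std_normal (\<lambda>y. F v (x(i := y)))")
        (auto intro!: N.integral_le_const simp: not_integrable_integral_eq)
    show "G v x powr (1 - l) * G w y powr l \<le> G ((1 - l) *\<^sub>R v + l *\<^sub>R w) (\<lambda>k. (1 - l) * x k + l * y k)"
      if xy: "x \<in> extensional J" "y \<in> extensional J" for v w x y
      unfolding G_def
    proof (rule prekopa_leindler_std_normal[OF _ _ _ _ _ _ _ _ _ l])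
      have ext: "x(i := s) \<in> extensional (insert i J)" "y(i := s) \<in> extensional (insert i J)" for s
        using xy by (auto simp: extensional_def)
      fix s t
      have eq: "(\<lambda>k. (1 - l) * (x(i := s)) k + l * (y(i := t)) k) = (\<lambda>k. (1 - l) * x k + l * y k)(i := (1 - l) * s + l * t)"
        by (simp add: fun_eq_iff)
      show "F v (x(i := s)) powr (1 - l) * F w (y(i := t)) powr l
        \<le> F ((1 - l) *\<^sub>R v + l *\<^sub>R w) ((\<lambda>k. (1 - l) * x k + l * y k)(i := (1 - l) * s + l * t))"
        using insert.prems(4)[OF ext(1)[of s] ext(2)[of t], of v w] unfolding eq .
    next
      have "(\<lambda>k. (1 - l) * x k + l * y k) \<in> extensional J"
        using xy by (auto simp: extensional_def simp flip: distrib_right)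
      then show "(\<lambda>s. F ((1 - l) *\<^sub>R v + l *\<^sub>R w) ((\<lambda>k. (1 - l) * x k + l * y k)(i := s))) \<in> borel_measurable borel"
        by (intro mF1) (auto simp: space_PiM PiE_def)
      show "(\<lambda>s. F v (x(i := s))) \<in> borel_measurable borel" "(\<lambda>s. F w (y(i := s))) \<in> borel_measurable borel"
        using xy by (auto intro!: mF1 simp: space_PiM PiE_def)
    qed (rule insert.prems)+
  qed
qed

definition gauss :: "'a::euclidean_space measure" where
  "gauss = distr (Pi\<^sub>M Basis (\<lambda>_. std_normal)) borel (\<lambda>f. \<Sum>b\<in>Basis. f b *\<^sub>R b)"

lemma coords_measurable [measurable]:
  "(\<lambda>f. \<Sum>b\<in>(Basis :: 'a::euclidean_space set). f b *\<^sub>R b) \<in> borel_measurable (Pi\<^sub>M Basis (\<lambda>_. std_normal))"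
  by measurable

lemma sets_gauss [simp, measurable_cong]: "sets gauss = sets borel"
  by (simp add: gauss_def)

lemma space_gauss [simp]: "space gauss = UNIV"
  by (simp add: gauss_def)

lemma gauss_prob: "prob_space (gauss :: 'a::euclidean_space measure)"
proof -
  interpret N: prob_space std_normal by (rule std_normal_prob)
  interpret P: prob_space "Pi\<^sub>M Basis (\<lambda>_::'a. std_normal)" by (rule prob_space_PiM) unfold_locales
  show ?thesis unfolding gauss_def by (rule P.prob_space_distr) measurable
qed

lemma borel_measurable_linear:
  fixes N :: "'u::euclidean_space \<Rightarrow> 'v::euclidean_space"
  assumes "linear N" "f \<in> borel_measurable M"
  shows "(\<lambda>x. N (f x)) \<in> borel_measurable M"
  using borel_measurable_continuous_onI[OF linear_continuous_on, of N] assms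
  by (auto simp: linear_conv_bounded_linear)

lemma anderson_gauss_log_concave:
  fixes N :: "'u::euclidean_space \<Rightarrow> 'v::euclidean_space"
  assumes "linear N" and [measurable]: "C \<in> sets borel" and "convex C" and l: "0 < l" "l < 1"
  shows "measure gauss {x. N x + v \<in> C} powr (1 - l) * measure gauss {x. N x + w \<in> C} powr l
    \<le> measure gauss {x. N x + ((1 - l) *\<^sub>R v + l *\<^sub>R w) \<in> C}"
proof -
  note [measurable] = borel_measurable_linear[OF \<open>linear N\<close>]
  let ?s = "\<lambda>f::'u \<Rightarrow> real. \<Sum>b\<in>Basis. f b *\<^sub>R b"
  define F where "F v f = (indicator C (N (?s f) + v) :: real)" for v f
  have [measurable]: "F v \<in> borel_measurable (Pi\<^sub>M Basis (\<lambda>_. std_normal))" for v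
    unfolding F_def by measurable
  have eq: "measure gauss {x. N x + v \<in> C} = (\<integral>f. F v f \<partial>Pi\<^sub>M Basis (\<lambda>_. std_normal))" for v
  proof -
    have "measure gauss {x. N x + v \<in> C} = (\<integral>x. indicator {x. N x + v \<in> C} x \<partial>gauss)"
      by simp
    also have "\<dots> = (\<integral>f. F v f \<partial>Pi\<^sub>M Basis (\<lambda>_. std_normal))"
      unfolding gauss_def by (subst integral_distr) (auto simp: F_def[abs_def] indicator_def)
    finally show ?thesis .
  qed
  have comb: "?s (\<lambda>k. (1 - l) * x k + l * y k) = (1 - l) *\<^sub>R ?s x + l *\<^sub>R ?s y" for x y
    by (simp add: scaleR_add_left sum.distrib scaleR_sum_right)
  show ?thesis unfolding eq
  proof (rule log_concave_marginal[OF finite_Basis l])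
    fix v w :: 'v and x y :: "'u \<Rightarrow> real"
    have "(1 - l) *\<^sub>R (N (?s x) + v) + l *\<^sub>R (N (?s y) + w)
      = N (?s (\<lambda>k. (1 - l) * x k + l * y k)) + ((1 - l) *\<^sub>R v + l *\<^sub>R w)"
      unfolding comb linear_add[OF \<open>linear N\<close>] linear_scale[OF \<open>linear N\<close>] by (simp add: scaleR_add_right)
    then show "F v x powr (1 - l) * F w y powr l
      \<le> F ((1 - l) *\<^sub>R v + l *\<^sub>R w) (\<lambda>k. (1 - l) * x k + l * y k)"
      using convexD[OF \<open>convex C\<close>, of "N (?s x) + v" "N (?s y) + w" "1 - l" l] l
      by (auto simp: F_def split: split_indicator)
  qed (auto simp: F_def)
qed

lemma PiM_std_normal_density:
  assumes "finite I"
  shows "Pi\<^sub>M I (\<lambda>_. std_normal) = density (Pi\<^sub>M I (\<lambda>_. lborel)) (\<lambda>f. \<Prod>b\<in>I. ennreal (std_normal_density (f b)))"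
proof -
  interpret N: prob_space std_normal by (rule std_normal_prob)
  interpret P: product_prob_space "\<lambda>_::'a. std_normal" by unfold_locales
  interpret L: product_sigma_finite "\<lambda>_::'a. lborel :: real measure" by unfold_locales
  show ?thesis
  proof (rule P.PiM_eqI[symmetric])
    show "sets (density (Pi\<^sub>M I (\<lambda>_. lborel)) (\<lambda>f. \<Prod>b\<in>I. ennreal (std_normal_density (f b)))) = sets (Pi\<^sub>M I (\<lambda>_. std_normal))"
      unfolding sets_density by (intro sets_PiM_cong) auto
    fix A :: "'a \<Rightarrow> real set" assume A: "\<And>i. i \<in> I \<Longrightarrow> A i \<in> sets std_normal"
    then have [measurable]: "i \<in> I \<Longrightarrow> A i \<in> sets borel" for i by simp
    have [measurable]: "(\<lambda>f. \<Prod>b\<in>I. ennreal (std_normal_density (f b))) \<in> borel_measurable (Pi\<^sub>M I (\<lambda>_. lborel))"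
      by (intro borel_measurable_prod_ennreal measurable_compose[OF measurable_component_singleton]) auto
    have "emeasure (density (Pi\<^sub>M I (\<lambda>_. lborel)) (\<lambda>f. \<Prod>b\<in>I. ennreal (std_normal_density (f b)))) (Pi\<^sub>E I A)
      = (\<integral>\<^sup>+f. (\<Prod>b\<in>I. ennreal (std_normal_density (f b))) * indicator (Pi\<^sub>E I A) f \<partial>Pi\<^sub>M I (\<lambda>_. lborel))"
      using assms by (intro emeasure_density) (auto intro!: sets_PiM_I_finite)
    also have "\<dots> = (\<integral>\<^sup>+f. (\<Prod>b\<in>I. ennreal (std_normal_density (f b)) * indicator (A b) (f b)) \<partial>Pi\<^sub>M I (\<lambda>_. lborel))"
    proof (rule nn_integral_cong)
      fix f :: "'a \<Rightarrow> real" assume "f \<in> space (Pi\<^sub>M I (\<lambda>_. lborel))"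
      then have "indicator (Pi\<^sub>E I A) f = (\<Prod>b\<in>I. indicator (A b) (f b) :: ennreal)"
        using assms by (auto simp: indicator_def space_PiM PiE_def Pi_def of_bool_def)
      then show "(\<Prod>b\<in>I. ennreal (std_normal_density (f b))) * indicator (Pi\<^sub>E I A) f
          = (\<Prod>b\<in>I. ennreal (std_normal_density (f b)) * indicator (A b) (f b))"
        by (simp add: prod.distrib)
    qed
    also have "\<dots> = (\<Prod>b\<in>I. \<integral>\<^sup>+x. ennreal (std_normal_density x) * indicator (A b) x \<partial>lborel)"
      using assms by (intro L.product_nn_integral_prod) auto
    also have "\<dots> = (\<Prod>b\<in>I. emeasure std_normal (A b))"
      by (intro prod.cong refl emeasure_density[symmetric]) auto
    finally show "emeasure (density (Pi\<^sub>M I (\<lambda>_. lborel)) (\<lambda>f. \<Prod>b\<in>I. ennreal (std_normal_density (f b)))) (Pi\<^sub>E I A)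
      = (\<Prod>b\<in>I. emeasure std_normal (A b))" .
  qed fact
qed

definition gauss_const :: "'a::euclidean_space itself \<Rightarrow> real" where
  "gauss_const _ = (1 / sqrt (2 * pi)) ^ DIM('a)"

lemma gauss_const_pos: "0 < gauss_const TYPE('a::euclidean_space)"
  by (simp add: gauss_const_def)

lemma gauss_density:
  "(gauss :: 'a::euclidean_space measure)
    = density lborel (\<lambda>x. ennreal (gauss_const TYPE('a) * exp (- (norm x)\<^sup>2 / 2)))"
proof -
  let ?s = "\<lambda>f::'a \<Rightarrow> real. \<Sum>b\<in>Basis. f b *\<^sub>R b"
  have d: "ennreal (gauss_const TYPE('a) * exp (- (norm x)\<^sup>2 / 2)) = (\<Prod>b\<in>Basis. ennreal (std_normal_density (x \<bullet> b)))" for x :: 'a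
  proof -
    have "(norm x)\<^sup>2 = (\<Sum>b\<in>Basis. (x \<bullet> b)\<^sup>2)"
      by (subst power2_norm_eq_inner, subst euclidean_inner) (simp add: power2_eq_square)
    then show ?thesis
      by (simp add: std_normal_density_def gauss_const_def prod_ennreal prod.distrib prod_dividef
          exp_sum[symmetric] sum_negf sum_divide_distrib power_one_over)
  qed
  have "gauss = distr (density (Pi\<^sub>M Basis (\<lambda>_. lborel)) (\<lambda>f. \<Prod>b\<in>Basis. ennreal (std_normal_density (?s f \<bullet> b)))) borel ?s"
    unfolding gauss_def by (subst PiM_std_normal_density) (auto intro!: distr_cong density_cong prod.cong)
  also have "\<dots> = density (distr (Pi\<^sub>M Basis (\<lambda>_. lborel)) borel ?s) (\<lambda>x. \<Prod>b\<in>Basis. ennreal (std_normal_density (x \<bullet> b)))"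
    by (rule density_distr[symmetric]) auto
  also have "distr (Pi\<^sub>M Basis (\<lambda>_. lborel)) borel ?s = lborel" by (rule lborel_eq[symmetric])
  finally show ?thesis unfolding d .
qed

lemma gauss_uminus:
  assumes [measurable]: "S \<in> sets borel"
  shows "measure gauss {x::'u::euclidean_space. - x \<in> S} = measure gauss S"
proof -
  have "emeasure gauss S = emeasure gauss {x::'u. - x \<in> S}"
  proof -
    have "emeasure gauss S = (\<integral>\<^sup>+x. ennreal (gauss_const TYPE('u) * exp (- (norm x)\<^sup>2 / 2)) * indicator S x \<partial>lborel)"
      by (simp add: gauss_density emeasure_density)
    also have "\<dots> = (\<integral>\<^sup>+x. ennreal (gauss_const TYPE('u) * exp (- (norm x)\<^sup>2 / 2)) * indicator {x. - x \<in> S} x \<partial>lborel)"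
      by (subst lborel_affine[of "-1" 0], simp)
        (auto simp: nn_integral_density nn_integral_distr indicator_def intro!: nn_integral_cong)
    also have "\<dots> = emeasure gauss {x::'u. - x \<in> S}"
      by (simp add: gauss_density emeasure_density)
    finally show ?thesis .
  qed
  then show ?thesis by (simp add: measure_def)
qed

theorem anderson_gauss:
  fixes N :: "'u::euclidean_space \<Rightarrow> 'v::euclidean_space"
  assumes "linear N" and [measurable]: "C \<in> sets borel" and "convex C" and sym: "uminus ` C = C"
    and r: "0 \<le> r" "r \<le> 1"
  shows "measure gauss {x. N x + v \<in> C} \<le> measure gauss {x. N x + r *\<^sub>R v \<in> C}"
proof -
  note [measurable] = borel_measurable_linear[OF \<open>linear N\<close>]
  define p where "p v = measure gauss {x. N x + v \<in> C}" for v
  have even: "p (- v) = p v" for v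
  proof -
    have "x \<in> C \<longleftrightarrow> - x \<in> C" for x using sym by (metis imageI minus_minus)
    then have "N x - v \<in> C \<longleftrightarrow> - (N x - v) \<in> C" for x by blast
    moreover have "- (N x - v) = N (- x) + v" for x
      using linear_neg[OF \<open>linear N\<close>] by simp
    ultimately have "{x. N x - v \<in> C} = {x. - x \<in> {x. N x + v \<in> C}}"
      by (simp only: mem_Collect_eq)
    then show ?thesis unfolding p_def by (simp add: gauss_uminus[of "{x. N x + v \<in> C}", simplified])
  qed
  show ?thesis
  proof (cases "r = 1")
    case False
    define l where "l = (1 - r) / 2"
    have l: "0 < l" "l < 1" using r False by (auto simp: l_def)
    have "(1 - l) *\<^sub>R v + l *\<^sub>R (- v) = (1 - l - l) *\<^sub>R v" by (simp add: algebra_simps flip: scaleR_add_left)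
    also have "1 - l - l = r" by (simp add: l_def field_simps)
    finally have "p v powr (1 - l) * p (- v) powr l \<le> p (r *\<^sub>R v)"
      using anderson_gauss_log_concave[OF assms(1-3) l, of v "- v"] by (simp add: p_def)
    moreover have "p v powr (1 - l) * p v powr l = p v"
      using l by (cases "p v = 0") (auto simp: p_def simp flip: powr_add)
    ultimately have "p v \<le> p (r *\<^sub>R v)" by (simp add: even)
    then show ?thesis by (simp add: p_def)
  qed simp
qed

section \<open>Radially decreasing functions under a Gaussian measure\<close>

lemma nn_integral_tail_gauss_kernel:
  assumes "0 \<le> u"
  shows "(\<integral>\<^sup>+r. ennreal (r * exp (- r\<^sup>2 / 2)) * indicator {u..} r \<partial>lborel) = ennreal (exp (- u\<^sup>2 / 2))"
proof -
  have "(\<integral>\<^sup>+r. ennreal (r * exp (- r\<^sup>2 / 2)) * indicator {u..} r \<partial>lborel) = ennreal (0 - (- exp (- u\<^sup>2 / 2)))"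
  proof (rule nn_integral_FTC_atLeast)
    show "((\<lambda>r::real. - exp (- r\<^sup>2 / 2)) has_real_derivative x * exp (- x\<^sup>2 / 2)) (at x)" for x
      by (auto intro!: derivative_eq_intros)
    show "((\<lambda>r::real. - exp (- r\<^sup>2 / 2)) \<longlongrightarrow> 0) at_top"
      by real_asymp
  qed (use assms in auto)
  then show ?thesis by simp
qed

lemma sets_borel_cball [measurable]: "cball (a::'a::euclidean_space) r \<in> sets borel"
  by (simp add: borel_closed)

lemma nn_integral_gauss_layers:
  fixes g :: "'a::euclidean_space \<Rightarrow> ennreal"
  assumes [measurable]: "g \<in> borel_measurable borel"
  shows "(\<integral>\<^sup>+x. g x \<partial>gauss) = ennreal (gauss_const TYPE('a)) *
    (\<integral>\<^sup>+r. ennreal (r * exp (- r\<^sup>2 / 2)) * indicator {0..} r * (\<integral>\<^sup>+x. g x * indicator (cball 0 r) x \<partial>lborel) \<partial>lborel)"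
proof -
  let ?c = "gauss_const TYPE('a)"
  let ?w = "\<lambda>r. ennreal (r * exp (- r\<^sup>2 / 2))"
  have "(\<integral>\<^sup>+x. g x \<partial>gauss) = (\<integral>\<^sup>+x. ennreal (?c * exp (- (norm x)\<^sup>2 / 2)) * g x \<partial>lborel)"
    unfolding gauss_density by (rule nn_integral_density) auto
  also have "\<dots> = ennreal ?c * (\<integral>\<^sup>+x. ennreal (exp (- (norm x)\<^sup>2 / 2)) * g x \<partial>lborel)"
    using gauss_const_pos[where 'a='a] by (subst nn_integral_cmult[symmetric]) (auto simp: ennreal_mult mult.assoc)
  also have "(\<integral>\<^sup>+x. ennreal (exp (- (norm x)\<^sup>2 / 2)) * g x \<partial>lborel)
     = (\<integral>\<^sup>+x. \<integral>\<^sup>+r. ?w r * indicator {0..} r * (g x * indicator (cball 0 r) x) \<partial>lborel \<partial>lborel)"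
  proof (rule nn_integral_cong)
    fix x :: 'a
    have "(\<integral>\<^sup>+r. ?w r * indicator {0..} r * (g x * indicator (cball 0 r) x) \<partial>lborel)
       = (\<integral>\<^sup>+r. ?w r * indicator {norm x..} r * g x \<partial>lborel)"
      by (rule nn_integral_cong) (auto split: split_indicator intro: order_trans[OF norm_ge_zero])
    also have "\<dots> = (\<integral>\<^sup>+r. ?w r * indicator {norm x..} r \<partial>lborel) * g x"
      by (rule nn_integral_multc) simp
    also have "\<dots> = ennreal (exp (- (norm x)\<^sup>2 / 2)) * g x"
      by (subst nn_integral_tail_gauss_kernel) auto
    finally show "ennreal (exp (- (norm x)\<^sup>2 / 2)) * g x
      = (\<integral>\<^sup>+r. ?w r * indicator {0..} r * (g x * indicator (cball 0 r) x) \<partial>lborel)" by simp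
  qed
  also have "\<dots> = (\<integral>\<^sup>+r. \<integral>\<^sup>+x. ?w r * indicator {0..} r * (g x * indicator (cball 0 r) x) \<partial>lborel \<partial>lborel)"
  proof (rule lborel_pair.Fubini')
    show "(\<lambda>(r, x). ?w r * indicator {0..} r * (g x * indicator (cball 0 r) x)) \<in> borel_measurable (lborel \<Otimes>\<^sub>M lborel)"
      unfolding indicator_def mem_cball by measurable
  qed
  also have "\<dots> = (\<integral>\<^sup>+r. ?w r * indicator {0..} r * (\<integral>\<^sup>+x. g x * indicator (cball 0 r) x \<partial>lborel) \<partial>lborel)"
    by (intro nn_integral_cong nn_integral_cmult) simp
  finally show ?thesis .
qed

lemma nn_integral_gauss_mono_layers:
  fixes g g' :: "'a::euclidean_space \<Rightarrow> ennreal"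
  assumes [measurable]: "g \<in> borel_measurable borel" "g' \<in> borel_measurable borel"
    and le: "\<And>r. c * (ennreal (r * exp (- r\<^sup>2 / 2)) * indicator {0..} r * (\<integral>\<^sup>+x. g x * indicator (cball 0 r) x \<partial>lborel))
      \<le> d * (ennreal (r * exp (- r\<^sup>2 / 2)) * indicator {0..} r * (\<integral>\<^sup>+x. g' x * indicator (cball 0 r) x \<partial>lborel))"
  shows "c * (\<integral>\<^sup>+x. g x \<partial>gauss) \<le> d * (\<integral>\<^sup>+x. g' x \<partial>gauss)"
proof -
  have [measurable]: "(\<lambda>r. \<integral>\<^sup>+x. u x * indicator (cball 0 r) x \<partial>lborel) \<in> borel_measurable lborel"
    if [measurable]: "u \<in> borel_measurable borel" for u :: "'a \<Rightarrow> ennreal"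
    unfolding indicator_def mem_cball by measurable
  have "c * (\<integral>\<^sup>+r. ennreal (r * exp (- r\<^sup>2 / 2)) * indicator {0..} r * (\<integral>\<^sup>+x. g x * indicator (cball 0 r) x \<partial>lborel) \<partial>lborel)
    \<le> d * (\<integral>\<^sup>+r. ennreal (r * exp (- r\<^sup>2 / 2)) * indicator {0..} r * (\<integral>\<^sup>+x. g' x * indicator (cball 0 r) x \<partial>lborel) \<partial>lborel)"
    using nn_integral_mono[OF le, of lborel "\<lambda>r. r"] by (simp add: nn_integral_cmult)
  then show ?thesis
    unfolding nn_integral_gauss_layers[OF assms(1)] nn_integral_gauss_layers[OF assms(2)]
    by (simp add: mult.left_commute[of _ "ennreal (gauss_const _)"] mult_left_mono)
qed

lemma nn_integral_lborel_scaleR: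
  fixes f :: "'a::euclidean_space \<Rightarrow> ennreal"
  assumes [measurable]: "f \<in> borel_measurable borel" and "0 < r"
  shows "(\<integral>\<^sup>+x. f x \<partial>lborel) = ennreal (r ^ DIM('a)) * (\<integral>\<^sup>+x. f (r *\<^sub>R x) \<partial>lborel)"
  using \<open>0 < r\<close> by (subst lborel_affine[of r 0])
    (auto simp: nn_integral_density nn_integral_distr nn_integral_cmult)

lemma gauss_ball_le_radial:
  fixes h :: "'a::euclidean_space \<Rightarrow> real"
  assumes [measurable]: "h \<in> borel_measurable borel" and h: "\<And>x. 0 \<le> h x" "\<And>x. h x \<le> 1"
    and rad: "\<And>x r. 0 \<le> r \<Longrightarrow> r \<le> 1 \<Longrightarrow> h x \<le> h (r *\<^sub>R x)" and "0 < \<rho>"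
  shows "measure gauss (cball (0::'a) \<rho>) * (\<integral>x. h x \<partial>gauss) \<le> (\<integral>x. h x * indicator (cball 0 \<rho>) x \<partial>gauss)"
proof -
  interpret G: prob_space "gauss :: 'a measure" by (rule gauss_prob)
  let ?d = "DIM('a)"
  let ?w = "\<lambda>r. ennreal (r * exp (- r\<^sup>2 / 2))"
  have fin: "(\<integral>\<^sup>+x. ennreal (h x) * indicator (cball (0::'a) r) x \<partial>lborel) \<noteq> \<infinity>" for r
  proof -
    have "(\<integral>\<^sup>+x. ennreal (h x) * indicator (cball (0::'a) r) x \<partial>lborel) \<le> (\<integral>\<^sup>+x. indicator (cball (0::'a) r) x \<partial>lborel)"
      using h by (intro nn_integral_mono) (auto split: split_indicator)
    also have "\<dots> < \<infinity>" using emeasure_bounded_finite[OF bounded_cball, of 0 r] by simp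
    finally show ?thesis by simp
  qed
  define H where "H r = enn2real (\<integral>\<^sup>+x. ennreal (h (r *\<^sub>R x)) * indicator (cball (0::'a) 1) x \<partial>lborel)" for r
  have fin1: "(\<integral>\<^sup>+x. ennreal (h (r *\<^sub>R x)) * indicator (cball (0::'a) 1) x \<partial>lborel) \<noteq> \<infinity>" for r
  proof -
    have "(\<integral>\<^sup>+x. ennreal (h (r *\<^sub>R x)) * indicator (cball (0::'a) 1) x \<partial>lborel) \<le> (\<integral>\<^sup>+x. indicator (cball (0::'a) 1) x \<partial>lborel)"
      using h by (intro nn_integral_mono) (auto split: split_indicator)
    also have "\<dots> < \<infinity>" using emeasure_bounded_finite[OF bounded_cball, of 0 1] by simp
    finally show ?thesis by simp
  qed
  have H_nn: "0 \<le> H r" for r by (simp add: H_def)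
  have H_anti: "H s \<le> H r" if "0 < r" "r \<le> s" for r s
  proof -
    have "h (s *\<^sub>R x) \<le> h (r *\<^sub>R x)" for x
      using rad[of "r / s" "s *\<^sub>R x"] that by simp
    then show ?thesis unfolding H_def
      by (intro enn2real_mono nn_integral_mono mult_right_mono ennreal_leI) (use fin1 in \<open>auto simp: less_top\<close>)
  qed
  have J: "(\<integral>\<^sup>+x. ennreal (h x) * indicator (cball (0::'a) r) x \<partial>lborel) = ennreal (r ^ ?d * H r)" if "0 < r" for r
  proof -
    have "(\<integral>\<^sup>+x. ennreal (h x) * indicator (cball (0::'a) r) x \<partial>lborel)
      = ennreal (r ^ ?d) * (\<integral>\<^sup>+x. ennreal (h (r *\<^sub>R x)) * indicator (cball 0 r) (r *\<^sub>R x) \<partial>lborel)"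
      by (rule nn_integral_lborel_scaleR[OF _ that]) measurable
    also have "(\<integral>\<^sup>+x. ennreal (h (r *\<^sub>R x)) * indicator (cball 0 r) (r *\<^sub>R x) \<partial>lborel)
      = (\<integral>\<^sup>+x. ennreal (h (r *\<^sub>R x)) * indicator (cball (0::'a) 1) x \<partial>lborel)"
      using that by (intro nn_integral_cong) (auto split: split_indicator simp: field_simps)
    also have "\<dots> = ennreal (H r)" using fin1[of r] by (simp add: H_def ennreal_enn2real less_top)
    finally show ?thesis using that H_nn by (simp add: ennreal_mult)
  qed
  define \<omega> where "\<omega> = measure lborel (cball (0::'a) 1)"
  have \<omega>: "0 < \<omega>" by (simp add: \<omega>_def content_cball_pos)
  have vol: "(\<integral>\<^sup>+x. indicator (cball (0::'a) r) x \<partial>lborel) = ennreal (r ^ ?d * \<omega>)" if "0 < r" for r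
  proof -
    have "(\<integral>\<^sup>+x. indicator (cball (0::'a) r) x \<partial>lborel)
      = ennreal (r ^ ?d) * (\<integral>\<^sup>+x. indicator (cball (0::'a) r) (r *\<^sub>R x) \<partial>lborel)"
      by (rule nn_integral_lborel_scaleR[OF _ that]) measurable
    also have "(\<integral>\<^sup>+x. indicator (cball (0::'a) r) (r *\<^sub>R x) \<partial>lborel) = (\<integral>\<^sup>+x. indicator (cball (0::'a) 1) x \<partial>lborel)"
      using that by (intro nn_integral_cong) (auto split: split_indicator simp: field_simps)
    also have "\<dots> = ennreal \<omega>"
      using emeasure_bounded_finite[OF bounded_cball, of "0::'a" 1] by (simp add: \<omega>_def emeasure_eq_ennreal_measure less_top)
    finally show ?thesis using that \<omega> by (simp add: ennreal_mult)
  qed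
  define \<kappa> where "\<kappa> = H \<rho>"
  have ann: "(\<integral>\<^sup>+x. g x * indicator (- cball 0 \<rho>) x * indicator (cball 0 r) x \<partial>lborel)
     = (\<integral>\<^sup>+x. g x * indicator (cball 0 r) x \<partial>lborel) - (\<integral>\<^sup>+x. g x * indicator (cball 0 \<rho>) x \<partial>lborel)"
    if [measurable]: "g \<in> borel_measurable borel" and "\<rho> \<le> r" "(\<integral>\<^sup>+x. g x * indicator (cball 0 \<rho>) x \<partial>lborel) \<noteq> \<infinity>"
    for g :: "'a \<Rightarrow> ennreal" and r
  proof -
    have "(\<integral>\<^sup>+x. g x * indicator (cball 0 r) x \<partial>lborel) =
      (\<integral>\<^sup>+x. g x * indicator (- cball 0 \<rho>) x * indicator (cball 0 r) x + g x * indicator (cball 0 \<rho>) x \<partial>lborel)"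
      using that by (intro nn_integral_cong) (auto split: split_indicator)
    also have "\<dots> = (\<integral>\<^sup>+x. g x * indicator (- cball 0 \<rho>) x * indicator (cball 0 r) x \<partial>lborel)
      + (\<integral>\<^sup>+x. g x * indicator (cball 0 \<rho>) x \<partial>lborel)"
      by (rule nn_integral_add) measurable
    finally show ?thesis using that(3) by (simp add: less_top)
  qed
  have in_ball: "ennreal \<kappa> * emeasure gauss (cball (0::'a) \<rho>)
    \<le> ennreal \<omega> * (\<integral>\<^sup>+x. ennreal (h x) * indicator (cball (0::'a) \<rho>) x \<partial>gauss)"
  proof -
    have pt: "ennreal \<kappa> * (?w r * indicator {0..} r * (\<integral>\<^sup>+x. indicator (cball (0::'a) \<rho>) x * indicator (cball 0 r) x \<partial>lborel))
      \<le> ennreal \<omega> * (?w r * indicator {0..} r * (\<integral>\<^sup>+x. ennreal (h x) * indicator (cball (0::'a) \<rho>) x * indicator (cball 0 r) x \<partial>lborel))" for r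
    proof (cases "0 < r")
      case True
      define s where "s = min r \<rho>"
      have s: "0 < s" "s \<le> \<rho>" using True \<open>0 < \<rho>\<close> by (auto simp: s_def)
      have i: "indicator (cball (0::'a) \<rho>) x * indicator (cball 0 r) x = (indicator (cball 0 s) x :: ennreal)" for x
        by (auto split: split_indicator simp: s_def)
      have "\<kappa> * (s ^ ?d * \<omega>) \<le> \<omega> * (s ^ ?d * H s)"
        using H_anti[OF s] \<omega> s by (simp add: \<kappa>_def mult_ac)
      then have "ennreal \<kappa> * ennreal (s ^ ?d * \<omega>) \<le> ennreal \<omega> * ennreal (s ^ ?d * H s)"
        using \<omega> s H_nn by (simp add: \<kappa>_def flip: ennreal_mult)
      then have "?w r * (ennreal \<kappa> * ennreal (s ^ ?d * \<omega>)) \<le> ?w r * (ennreal \<omega> * ennreal (s ^ ?d * H s))"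
        by (rule mult_left_mono) simp
      then show ?thesis using True
        unfolding mult.assoc[of "ennreal _" "indicator _ _" "indicator _ _"] i vol[OF s(1)] J[OF s(1)]
        by (simp add: mult_ac)
    qed (cases "r = 0"; simp)
    show ?thesis using nn_integral_gauss_mono_layers[OF _ _ pt] by simp
  qed
  have out_ball: "ennreal \<omega> * (\<integral>\<^sup>+x. ennreal (h x) * indicator (- cball (0::'a) \<rho>) x \<partial>gauss)
    \<le> ennreal \<kappa> * emeasure gauss (- cball (0::'a) \<rho>)"
  proof -
    have pt: "ennreal \<omega> * (?w r * indicator {0..} r * (\<integral>\<^sup>+x. ennreal (h x) * indicator (- cball (0::'a) \<rho>) x * indicator (cball 0 r) x \<partial>lborel))
      \<le> ennreal \<kappa> * (?w r * indicator {0..} r * (\<integral>\<^sup>+x. indicator (- cball (0::'a) \<rho>) x * indicator (cball 0 r) x \<partial>lborel))" for r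
    proof (cases "\<rho> < r")
      case True
      then have r: "0 < r" using \<open>0 < \<rho>\<close> by simp
      have e1: "(\<integral>\<^sup>+x. ennreal (h x) * indicator (- cball (0::'a) \<rho>) x * indicator (cball 0 r) x \<partial>lborel)
        = ennreal (r ^ ?d * H r - \<rho> ^ ?d * H \<rho>)"
        using True r \<open>0 < \<rho>\<close> H_nn by (subst ann) (auto simp: J ennreal_minus)
      have e2: "(\<integral>\<^sup>+x. indicator (- cball (0::'a) \<rho>) x * indicator (cball 0 r) x \<partial>lborel)
        = ennreal (r ^ ?d * \<omega> - \<rho> ^ ?d * \<omega>)"
        using ann[of "\<lambda>_. 1" r] True r \<open>0 < \<rho>\<close> \<omega> by (simp add: vol ennreal_minus del: nn_integral_indicator)
      have "r ^ ?d * H r \<le> r ^ ?d * H \<rho>" using H_anti[of \<rho> r] True \<open>0 < \<rho>\<close> by simp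
      then have "\<omega> * (r ^ ?d * H r - \<rho> ^ ?d * H \<rho>) \<le> \<omega> * (r ^ ?d * H \<rho> - \<rho> ^ ?d * H \<rho>)"
        using \<omega> by (intro mult_left_mono) auto
      also have "\<dots> = \<kappa> * (r ^ ?d * \<omega> - \<rho> ^ ?d * \<omega>)" by (simp add: \<kappa>_def algebra_simps)
      finally have "ennreal \<omega> * ennreal (r ^ ?d * H r - \<rho> ^ ?d * H \<rho>) \<le> ennreal \<kappa> * ennreal (r ^ ?d * \<omega> - \<rho> ^ ?d * \<omega>)"
        using \<omega> H_nn by (simp add: \<kappa>_def ennreal_leI flip: ennreal_mult')
      then have "?w r * (ennreal \<omega> * ennreal (r ^ ?d * H r - \<rho> ^ ?d * H \<rho>)) \<le> ?w r * (ennreal \<kappa> * ennreal (r ^ ?d * \<omega> - \<rho> ^ ?d * \<omega>))"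
        by (rule mult_left_mono) simp
      then show ?thesis using r unfolding e1 e2 by (simp add: mult_ac)
    next
      case False
      then have "(\<integral>\<^sup>+x. ennreal (h x) * indicator (- cball (0::'a) \<rho>) x * indicator (cball 0 r) x \<partial>lborel)
        = (\<integral>\<^sup>+x. 0 \<partial>(lborel :: 'a measure))"
        by (intro nn_integral_cong) (auto split: split_indicator)
      then show ?thesis by simp
    qed
    show ?thesis using nn_integral_gauss_mono_layers[OF _ _ pt] by simp
  qed
  define a where "a = (\<integral>x. h x * indicator (cball 0 \<rho>) x \<partial>(gauss :: 'a measure))"
  define b where "b = (\<integral>x. h x * indicator (- cball 0 \<rho>) x \<partial>(gauss :: 'a measure))"
  define p where "p = measure gauss (cball (0::'a) \<rho>)"
  have int: "integrable gauss (\<lambda>x. h x * indicator S x)" if [measurable]: "S \<in> sets borel" for S :: "'a set"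
    by (rule G.integrable_const_bound[where B=1]) (use h in \<open>auto split: split_indicator\<close>)
  have nnh: "(\<integral>\<^sup>+x. ennreal (h x) * indicator S x \<partial>gauss) = ennreal (\<integral>x. h x * indicator S x \<partial>gauss)"
    if [measurable]: "S \<in> sets borel" for S :: "'a set"
    using h by (subst nn_integral_eq_integral[OF int, symmetric])
      (auto intro!: nn_integral_cong split: split_indicator)
  have ab: "0 \<le> a" "0 \<le> b" using h by (auto simp: a_def b_def intro!: Bochner_Integration.integral_nonneg)
  have q: "measure gauss (- cball (0::'a) \<rho>) = 1 - p"
    using G.prob_compl[of "cball 0 \<rho>"] by (simp add: p_def Compl_eq_Diff_UNIV)
  have p: "0 \<le> p" "p \<le> 1" by (auto simp: p_def)
  have 1: "\<kappa> * p \<le> \<omega> * a"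
    using in_ball \<omega> H_nn ab p by (simp add: nnh G.emeasure_eq_measure \<kappa>_def flip: a_def p_def ennreal_mult)
  have 2: "\<omega> * b \<le> \<kappa> * (1 - p)"
    using out_ball \<omega> H_nn ab p by (simp add: nnh G.emeasure_eq_measure \<kappa>_def q flip: b_def ennreal_mult)
  have "\<omega> * (b * p) \<le> \<kappa> * (1 - p) * p" using 2 p by (simp add: mult_right_mono flip: mult.assoc)
  also have "\<dots> = \<kappa> * p * (1 - p)" by simp
  also have "\<dots> \<le> \<omega> * a * (1 - p)" using 1 p by (intro mult_right_mono) auto
  finally have "b * p \<le> a * (1 - p)" using \<omega> by (simp add: mult.assoc)
  then have "p * (a + b) \<le> a" by (simp add: algebra_simps)
  also have "a + b = (\<integral>x. h x * indicator (cball 0 \<rho>) x + h x * indicator (- cball 0 \<rho>) x \<partial>(gauss :: 'a measure))"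
    unfolding a_def b_def by (rule Bochner_Integration.integral_add[symmetric]) (auto intro!: int)
  also have "\<dots> = (\<integral>x. h x \<partial>(gauss :: 'a measure))"
    by (rule Bochner_Integration.integral_cong) (auto split: split_indicator)
  finally show ?thesis by (simp add: p_def a_def)
qed

lemma gauss_char:
  fixes s :: "'a::euclidean_space"
  shows "(\<integral>x. iexp (s \<bullet> x) \<partial>gauss) = complex_of_real (exp (- (norm s)\<^sup>2 / 2))"
proof -
  interpret N: prob_space std_normal by (rule std_normal_prob)
  interpret P: product_prob_space "\<lambda>_::'a. std_normal" by unfold_locales
  let ?s = "\<lambda>f::'a \<Rightarrow> real. \<Sum>b\<in>Basis. f b *\<^sub>R b"
  have "(\<integral>x. iexp (s \<bullet> x) \<partial>gauss) = (\<integral>f. iexp (s \<bullet> ?s f) \<partial>Pi\<^sub>M Basis (\<lambda>_. std_normal))"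
    unfolding gauss_def by (rule integral_distr) auto
  also have "\<dots> = (\<integral>f. (\<Prod>b\<in>Basis. iexp ((s \<bullet> b) * f b)) \<partial>Pi\<^sub>M Basis (\<lambda>_. std_normal))"
    by (simp add: inner_sum_right sum_distrib_left exp_sum mult_ac)
  also have "\<dots> = (\<Prod>b\<in>Basis. \<integral>y. iexp ((s \<bullet> b) * y) \<partial>std_normal)"
    by (rule P.product_integral_prod) (auto intro!: N.integrable_const_bound[where B=1])
  also have "\<dots> = (\<Prod>b\<in>Basis. complex_of_real (exp (- (s \<bullet> b)\<^sup>2 / 2)))"
    using char_std_normal_distribution by (simp add: char_def fun_eq_iff)
  also have "\<dots> = complex_of_real (exp (\<Sum>b\<in>Basis. - (s \<bullet> b)\<^sup>2 / 2))"
    by (simp add: exp_sum)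
  also have "(\<Sum>b\<in>Basis. - (s \<bullet> b)\<^sup>2 / 2) = - (norm s)\<^sup>2 / 2"
    unfolding power2_norm_eq_inner euclidean_inner[of s s] by (simp add: power2_eq_square sum_negf sum_divide_distrib)
  finally show ?thesis .
qed

section \<open>Weak convergence from characteristic functions\<close>

inductive trig_poly :: "('a::real_inner \<Rightarrow> real) \<Rightarrow> bool" where
  cos: "trig_poly (\<lambda>x. c * cos (t \<bullet> x + \<theta>))"
| add: "trig_poly f \<Longrightarrow> trig_poly g \<Longrightarrow> trig_poly (\<lambda>x. f x + g x)"

lemma trig_poly_const: "trig_poly (\<lambda>x. c)"
  using trig_poly.cos[of c 0 0] by simp

lemma trig_poly_mult:
  assumes "trig_poly f" "trig_poly g"
  shows "trig_poly (\<lambda>x. f x * g x)"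
  using assms(1)
proof induction
  case (cos c t \<theta>)
  show ?case using assms(2)
  proof induction
    case (cos c' t' \<theta>')
    have "(\<lambda>x. c * cos (t \<bullet> x + \<theta>) * (c' * cos (t' \<bullet> x + \<theta>'))) =
      (\<lambda>x. (c * c' / 2) * cos ((t - t') \<bullet> x + (\<theta> - \<theta>')) + (c * c' / 2) * cos ((t + t') \<bullet> x + (\<theta> + \<theta>')))"
    proof
      fix x
      have "c * cos (t \<bullet> x + \<theta>) * (c' * cos (t' \<bullet> x + \<theta>')) = c * c' * (cos (t \<bullet> x + \<theta>) * cos (t' \<bullet> x + \<theta>'))"
        by simp
      also have "\<dots> = (c * c' / 2) * (cos ((t \<bullet> x + \<theta>) - (t' \<bullet> x + \<theta>')) + cos ((t \<bullet> x + \<theta>) + (t' \<bullet> x + \<theta>')))"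
        unfolding cos_times_cos by simp
      also have "(t \<bullet> x + \<theta>) - (t' \<bullet> x + \<theta>') = (t - t') \<bullet> x + (\<theta> - \<theta>')" by (simp add: inner_diff_left)
      also have "(t \<bullet> x + \<theta>) + (t' \<bullet> x + \<theta>') = (t + t') \<bullet> x + (\<theta> + \<theta>')" by (simp add: inner_add_left)
      finally show "c * cos (t \<bullet> x + \<theta>) * (c' * cos (t' \<bullet> x + \<theta>')) =
        (c * c' / 2) * cos ((t - t') \<bullet> x + (\<theta> - \<theta>')) + (c * c' / 2) * cos ((t + t') \<bullet> x + (\<theta> + \<theta>'))"
        by (simp only: distrib_left)
    qed
    then show ?case by (simp only:) (intro trig_poly.intros)
  next
    case (add f g)
    then show ?case by (simp add: distrib_left) (rule trig_poly.add)
  qed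
next
  case (add f1 f2)
  then show ?case by (simp add: distrib_right) (rule trig_poly.add)
qed

lemma trig_poly_sum:
  "finite I \<Longrightarrow> (\<And>i. i \<in> I \<Longrightarrow> trig_poly (f i)) \<Longrightarrow> trig_poly (\<lambda>x. \<Sum>i\<in>I. f i x)"
  by (induction I rule: finite_induct) (auto intro: trig_poly.add trig_poly_const)

lemma trig_poly_polynomial_sin:
  fixes p :: "'a::euclidean_space \<Rightarrow> real"
  assumes "real_polynomial_function p"
  shows "trig_poly (\<lambda>x. p (\<Sum>b\<in>Basis. sin (k * (x \<bullet> b)) *\<^sub>R b))"
  using assms
proof induction
  case (linear f)
  interpret bounded_linear f by fact
  have "(\<lambda>x::'a. f (\<Sum>b\<in>Basis. sin (k * (x \<bullet> b)) *\<^sub>R b)) = (\<lambda>x. \<Sum>b\<in>Basis. f b * cos ((k *\<^sub>R b) \<bullet> x + (- pi / 2)))"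
  proof
    fix x :: 'a
    have "cos ((k *\<^sub>R b) \<bullet> x + (- pi / 2)) = sin (k * (x \<bullet> b))" for b :: 'a
      using sin_cos_eq[of "k * (x \<bullet> b)"] cos_minus[of "pi / 2 - k * (x \<bullet> b)"] by (simp add: inner_commute)
    then show "f (\<Sum>b\<in>Basis. sin (k * (x \<bullet> b)) *\<^sub>R b) = (\<Sum>b\<in>Basis. f b * cos ((k *\<^sub>R b) \<bullet> x + (- pi / 2)))"
      by (simp add: sum scaleR mult.commute)
  qed
  then show ?case by (simp only:) (intro trig_poly_sum trig_poly.cos finite_Basis)
qed (auto intro: trig_poly_const trig_poly.add trig_poly_mult)

lemma trig_poly_continuous: "trig_poly (f :: 'a::euclidean_space \<Rightarrow> real) \<Longrightarrow> continuous_on UNIV f"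
  by (induction rule: trig_poly.induct) (auto intro!: continuous_intros)

lemma trig_poly_bounded: "trig_poly (f :: 'a::euclidean_space \<Rightarrow> real) \<Longrightarrow> \<exists>B. \<forall>x. \<bar>f x\<bar> \<le> B"
proof (induction rule: trig_poly.induct)
  case (cos c t \<theta>)
  have "\<bar>c * cos (t \<bullet> x + \<theta>)\<bar> \<le> \<bar>c\<bar>" for x
    using mult_left_mono[OF abs_cos_le_one, of "\<bar>c\<bar>"] by (simp add: abs_mult)
  then show ?case by blast
next
  case (add f g)
  then obtain B B' where "\<And>x. \<bar>f x\<bar> \<le> B" "\<And>x. \<bar>g x\<bar> \<le> B'" by blast
  then have "\<bar>f x + g x\<bar> \<le> B + B'" for x by (meson abs_triangle_ineq add_mono order_trans)
  then show ?case by blast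
qed

lemma trig_poly_integral_tendsto:
  fixes M :: "nat \<Rightarrow> 'a::euclidean_space measure"
  assumes f: "trig_poly f"
    and M: "\<And>m. prob_space (M m)" "\<And>m. sets (M m) = sets borel"
    and \<mu>: "prob_space \<mu>" "sets \<mu> = sets borel"
    and char: "\<And>t. (\<lambda>m. \<integral>x. iexp (t \<bullet> x) \<partial>M m) \<longlonglongrightarrow> (\<integral>x. iexp (t \<bullet> x) \<partial>\<mu>)"
  shows "(\<lambda>m. \<integral>x. f x \<partial>M m) \<longlonglongrightarrow> (\<integral>x. f x \<partial>\<mu>)"
proof -
  have int: "integrable N u" if N: "prob_space N" "sets N = sets borel" "trig_poly u" for N :: "'a measure" and u
  proof -
    interpret prob_space N by fact
    obtain B where B: "\<forall>x. \<bar>u x\<bar> \<le> B" using trig_poly_bounded[OF N(3)] by blast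
    have "u \<in> borel_measurable N"
      using borel_measurable_continuous_onI[OF trig_poly_continuous[OF N(3)]] N(2)
      by (simp cong: measurable_cong_sets)
    then show ?thesis using B by (intro integrable_const_bound[where B=B]) auto
  qed
  show ?thesis using f
  proof induction
    case (cos c t \<theta>)
    have eq: "(\<integral>x. c * cos (t \<bullet> x + \<theta>) \<partial>N) = c * Re (cis \<theta> * (\<integral>x. iexp (t \<bullet> x) \<partial>N))"
      if "prob_space N" "sets N = sets borel" for N :: "'a measure"
    proof -
      interpret prob_space N by fact
      have i: "integrable N (\<lambda>x. iexp (t \<bullet> x))"
        by (rule integrable_const_bound[where B=1]) (use that in \<open>auto cong: measurable_cong_sets\<close>)
      have "cis \<theta> * (\<integral>x. iexp (t \<bullet> x) \<partial>N) = (\<integral>x. cis \<theta> * iexp (t \<bullet> x) \<partial>N)" by simp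
      then have "Re (cis \<theta> * (\<integral>x. iexp (t \<bullet> x) \<partial>N)) = (\<integral>x. Re (cis \<theta> * iexp (t \<bullet> x)) \<partial>N)"
        using i by (simp only: integral_Re[OF integrable_mult_right])
      also have "(\<lambda>x. Re (cis \<theta> * iexp (t \<bullet> x))) = (\<lambda>x. cos (t \<bullet> x + \<theta>))"
        by (simp add: fun_eq_iff cis_conv_exp[symmetric] cos_add mult.commute)
      finally show ?thesis by simp
    qed
    show ?case unfolding eq[OF M] eq[OF \<mu>]
      by (intro tendsto_intros char)
  next
    case (add f g)
    then show ?case using int M \<mu> by (simp add: tendsto_add)
  qed
qed

theorem char_tendsto_imp_weak_conv:
  fixes M :: "nat \<Rightarrow> 'a::euclidean_space measure"
  assumes M: "\<And>m. prob_space (M m)" "\<And>m. sets (M m) = sets borel"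
    and \<mu>: "prob_space \<mu>" "sets \<mu> = sets borel"
    and char: "\<And>t. (\<lambda>m. \<integral>x. iexp (t \<bullet> x) \<partial>M m) \<longlonglongrightarrow> (\<integral>x. iexp (t \<bullet> x) \<partial>\<mu>)"
    and tight: "\<And>e. 0 < e \<Longrightarrow> \<exists>R. \<forall>m. measure (M m) (- cball 0 R) \<le> e"
  shows "weak_conv_to M \<mu>"
  unfolding weak_conv_to_def
proof (intro conjI allI impI \<mu>)
  fix h :: "'a \<Rightarrow> real"
  assume "continuous_on UNIV h \<and> bounded (range h)"
  then obtain B where cont: "continuous_on UNIV h" and B: "\<And>x. \<bar>h x\<bar> \<le> B"
    by (auto simp: bounded_iff)
  have B0: "0 \<le> B" using B[of 0] by linarith
  have h[measurable]: "h \<in> borel_measurable borel" using cont by (rule borel_measurable_continuous_onI)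
  have tight_\<mu>: "\<exists>R. measure \<mu> (- cball 0 R) \<le> e" if "0 < e" for e
  proof -
    interpret prob_space \<mu> by fact
    have "(\<lambda>n. measure \<mu> (- cball 0 (real n))) \<longlonglongrightarrow> measure \<mu> (\<Inter>n. - cball 0 (real n))"
      by (rule finite_Lim_measure_decseq) (auto simp: decseq_def \<mu>(2))
    also have "(\<Inter>n. - cball (0::'a) (real n)) = {}"
    proof -
      have "\<exists>n. x \<in> cball 0 (real n)" for x :: 'a
        using real_arch_simple[of "norm x"] by auto
      then show ?thesis by blast
    qed
    finally have "(\<lambda>n. measure \<mu> (- cball 0 (real n))) \<longlonglongrightarrow> 0" by simp
    then have "\<forall>\<^sub>F n in sequentially. measure \<mu> (- cball 0 (real n)) < e"
      using that by (rule order_tendstoD)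
    then show ?thesis by (auto simp: eventually_sequentially intro: less_imp_le)
  qed
  show "(\<lambda>m. \<integral>x. h x \<partial>M m) \<longlonglongrightarrow> (\<integral>x. h x \<partial>\<mu>)"
  proof (rule LIMSEQ_I)
    fix \<epsilon> :: real assume \<epsilon>: "0 < \<epsilon>"
    define e where "e = min 1 (\<epsilon> / (4 * B + 6))"
    have e: "0 < e" "e \<le> 1" using \<epsilon> B0 by (auto simp: e_def)
    have "e \<le> \<epsilon> / (4 * B + 6)" by (simp add: e_def)
    then have e_le: "(4 * B + 6) * e \<le> \<epsilon>"
      using B0 by (simp add: pos_le_divide_eq mult.commute)
    obtain R1 where R1: "\<And>m. measure (M m) (- cball 0 R1) \<le> e" using tight[OF e(1)] by blast
    obtain R2 where R2: "measure \<mu> (- cball 0 R2) \<le> e" using tight_\<mu>[OF e(1)] by blast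
    define R where "R = max 1 (max R1 R2)"
    have R: "0 < R" "R1 \<le> R" "R2 \<le> R" by (auto simp: R_def)
    define k where "k = pi / (2 * R)"
    have k: "0 < k" using R by (simp add: k_def)
    define H where "H y = h (\<Sum>b\<in>Basis. (arcsin (y \<bullet> b) / k) *\<^sub>R b)" for y :: 'a
    define E where "E x = (\<Sum>b\<in>Basis. sin (k * (x \<bullet> b)) *\<^sub>R b)" for x :: 'a
    have box: "y \<in> cbox (- One) One \<longleftrightarrow> (\<forall>b\<in>Basis. -1 \<le> y \<bullet> b \<and> y \<bullet> b \<le> 1)" for y :: 'a
      by (simp add: mem_box)
    have "continuous_on (cbox (- One) One) H"
      unfolding H_def
      by (intro continuous_on_compose2[OF cont] continuous_intros continuous_on_compose2[OF continuous_on_arcsin'])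
        (use k in \<open>auto simp: mem_box\<close>)
    then obtain p where p: "real_polynomial_function p" and pH: "\<And>y. y \<in> cbox (- One) One \<Longrightarrow> \<bar>H y - p y\<bar> < e"
      using Stone_Weierstrass_real_polynomial_function[OF compact_cbox _ e(1)] by blast
    define T where "T x = p (E x)" for x
    have T: "trig_poly T" unfolding T_def E_def by (rule trig_poly_polynomial_sin[OF p])
    have Ebox: "E x \<in> cbox (- One) One" for x by (simp add: box E_def)
    have HE: "\<bar>H (E x) - T x\<bar> < e" for x unfolding T_def by (rule pH[OF Ebox])
    have near: "\<bar>h x - T x\<bar> \<le> e" if "x \<in> cball 0 R" for x
    proof -
      have "arcsin (E x \<bullet> b) / k = x \<bullet> b" if b: "b \<in> Basis" for b
      proof -
        have "\<bar>x \<bullet> b\<bar> \<le> R" using Basis_le_norm[OF b, of x] \<open>x \<in> cball 0 R\<close> by simp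
        then have "k * \<bar>x \<bullet> b\<bar> \<le> pi / 2" using R by (simp add: k_def field_simps)
        then have "\<bar>k * (x \<bullet> b)\<bar> \<le> pi / 2" using k by (simp add: abs_mult)
        then show ?thesis using b k by (simp add: E_def arcsin_sin)
      qed
      then have "H (E x) = h x" by (simp add: H_def euclidean_representation)
      then show ?thesis using HE[of x] by simp
    qed
    have far: "\<bar>h x - T x\<bar> \<le> 2 * B + 1" for x
      using HE[of x] B[of x] B[of "\<Sum>b\<in>Basis. (arcsin (E x \<bullet> b) / k) *\<^sub>R b"] e unfolding H_def by linarith
    have approx: "\<bar>(\<integral>x. h x \<partial>N) - (\<integral>x. T x \<partial>N)\<bar> \<le> (2 * B + 2) * e"
      if N: "prob_space N" "sets N = sets borel" and t: "measure N (- cball 0 R) \<le> e" for N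
    proof -
      interpret prob_space N by fact
      note [measurable_cong] = N(2)
      have [measurable]: "T \<in> borel_measurable borel"
        by (rule borel_measurable_continuous_onI[OF trig_poly_continuous[OF T]])
      obtain BT where BT: "\<And>x. \<bar>T x\<bar> \<le> BT" using trig_poly_bounded[OF T] by blast
      have i: "integrable N h" "integrable N T"
        by (rule integrable_const_bound[where B=B], use B in auto)
          (rule integrable_const_bound[where B=BT], use BT in auto)
      have j: "integrable N (\<lambda>x. indicator (- cball 0 R) x :: real)"
        by (rule integrable_const_bound[where B=1]) (auto split: split_indicator)
      have "\<bar>(\<integral>x. h x \<partial>N) - (\<integral>x. T x \<partial>N)\<bar> = \<bar>\<integral>x. h x - T x \<partial>N\<bar>" using i by simp
      also have "\<dots> \<le> (\<integral>x. \<bar>h x - T x\<bar> \<partial>N)" by (rule integral_abs_bound)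
      also have "\<dots> \<le> (\<integral>x. e + (2 * B + 1) * indicator (- cball 0 R) x \<partial>N)"
        using near far i j e B0 by (intro integral_mono) (auto split: split_indicator intro: add_increasing)
      also have "\<dots> = e + (2 * B + 1) * measure N (- cball 0 R)"
        using j by (subst Bochner_Integration.integral_add) (auto simp: prob_space)
      also have "\<dots> \<le> e + (2 * B + 1) * e" using t B0 by (intro add_mono mult_left_mono) auto
      finally show ?thesis by (simp add: algebra_simps)
    qed
    have mono: "measure N (- cball 0 R) \<le> measure N (- cball 0 R')"
      if "prob_space N" "sets N = sets borel" "R' \<le> R" for N :: "'a measure" and R'
    proof -
      interpret prob_space N by fact
      show ?thesis using that by (intro finite_measure_mono) auto
    qed
    have aM: "\<bar>(\<integral>x. h x \<partial>M m) - (\<integral>x. T x \<partial>M m)\<bar> \<le> (2 * B + 2) * e" for m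
      by (rule approx[OF M order_trans[OF mono[OF M R(2)] R1]])
    have a\<mu>: "\<bar>(\<integral>x. h x \<partial>\<mu>) - (\<integral>x. T x \<partial>\<mu>)\<bar> \<le> (2 * B + 2) * e"
      by (rule approx[OF \<mu> order_trans[OF mono[OF \<mu> R(3)] R2]])
    obtain n0 where n0: "\<And>m. m \<ge> n0 \<Longrightarrow> \<bar>(\<integral>x. T x \<partial>M m) - (\<integral>x. T x \<partial>\<mu>)\<bar> < e"
      using LIMSEQ_D[OF trig_poly_integral_tendsto[OF T M \<mu> char] e(1)] by auto
    have "\<bar>(\<integral>x. h x \<partial>M m) - (\<integral>x. h x \<partial>\<mu>)\<bar> < \<epsilon>" if "m \<ge> n0" for m
    proof -
      have "\<bar>(\<integral>x. h x \<partial>M m) - (\<integral>x. h x \<partial>\<mu>)\<bar> < 2 * ((2 * B + 2) * e) + e"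
        using aM[of m] a\<mu> n0[OF that] by linarith
      also have "\<dots> \<le> (4 * B + 6) * e" using e by (simp add: algebra_simps)
      finally show ?thesis using e_le by linarith
    qed
    then show "\<exists>no. \<forall>m\<ge>no. norm ((\<integral>x. h x \<partial>M m) - (\<integral>x. h x \<partial>\<mu>)) < \<epsilon>" by auto
  qed
qed

section \<open>A central limit theorem for random assignments\<close>

lemma assignments_finite: "finite (assignments n (nq :: 'q::finite \<Rightarrow> nat))"
  unfolding assignments_def by (rule finite_subset[of _ "{..<n} \<rightarrow>\<^sub>E UNIV"]) (auto intro: finite_PiE)

lemma assignments_nonempty:
  fixes nq :: "'q::finite \<Rightarrow> nat"
  assumes "(\<Sum>q\<in>UNIV. nq q) = n"
  shows "assignments n nq \<noteq> {}"
proof -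
  obtain xs where xs: "mset xs = (\<Sum>q\<in>UNIV. replicate_mset (nq q) q)" using ex_mset by blast
  have len: "length xs = n"
    using arg_cong[OF xs, of size] assms by (simp add: size_multiset_sum)
  define Z where "Z = (\<lambda>i\<in>{..<n}. xs ! i)"
  have "card {i. i < n \<and> Z i = q} = nq q" for q
  proof -
    have "count (mset xs) q = nq q"
      by (simp add: xs count_sum sum.delta)
    moreover have "count (mset xs) q = length (filter ((=) q) xs)"
      by (induction xs) auto
    ultimately have "length (filter ((=) q) xs) = nq q" by simp
    then have "card {i. i < length xs \<and> q = xs ! i} = nq q" by (simp only: length_filter_conv_card)
    moreover have "{i. i < length xs \<and> q = xs ! i} = {i. i < n \<and> Z i = q}" by (auto simp: Z_def len)
    ultimately show ?thesis by simp
  qed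
  then have "Z \<in> assignments n nq" by (auto simp: assignments_def Z_def)
  then show ?thesis by blast
qed

locale assignment_design =
  fixes n :: nat and nq :: "'q::finite \<Rightarrow> nat"
  assumes n_pos: "0 < n" and nq_sum: "(\<Sum>q\<in>UNIV. nq q) = n"
begin

definition \<Omega> :: "(nat \<Rightarrow> 'q) set" where
  "\<Omega> = assignments n nq"

definition share :: "'q \<Rightarrow> real" where
  "share q = real (nq q) / real n"

definition avg :: "((nat \<Rightarrow> 'q) \<Rightarrow> 'c::real_normed_field) \<Rightarrow> 'c" where
  "avg f = (\<Sum>Z\<in>\<Omega>. f Z) / of_nat (card \<Omega>)"

lemma finite_\<Omega>: "finite \<Omega>" by (simp add: \<Omega>_def assignments_finite)

lemma card_\<Omega>_pos: "0 < card \<Omega>"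
  using assignments_nonempty[OF nq_sum] finite_\<Omega> by (simp add: \<Omega>_def card_gt_0_iff)

lemma share_nonneg: "0 \<le> share q" by (simp add: share_def)

lemma share_sum: "(\<Sum>q\<in>UNIV. share q) = 1"
  using n_pos nq_sum by (simp add: share_def flip: sum_divide_distrib of_nat_sum)

lemma share_le_1: "share q \<le> 1"
  using member_le_sum[of q UNIV share] share_nonneg by (simp add: share_sum)

lemma avg_add: "avg (\<lambda>Z. f Z + g Z) = avg f + avg g"
  by (simp add: avg_def sum.distrib add_divide_distrib)

lemma avg_diff: "avg (\<lambda>Z. f Z - g Z) = avg f - avg g"
  by (simp add: avg_def sum_subtractf diff_divide_distrib)

lemma avg_cmult: "avg (\<lambda>Z. c * f Z) = c * avg f"
  by (simp add: avg_def sum_distrib_left)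

lemma avg_sum: "avg (\<lambda>Z. \<Sum>i\<in>I. f i Z) = (\<Sum>i\<in>I. avg (f i))"
  unfolding avg_def by (subst sum.swap) (simp add: sum_divide_distrib)

lemma avg_const: "avg (\<lambda>Z. c) = c"
  using card_\<Omega>_pos by (simp add: avg_def)

lemma avg_mono: "(\<And>Z. Z \<in> \<Omega> \<Longrightarrow> f Z \<le> g Z) \<Longrightarrow> avg f \<le> (avg g :: real)"
  unfolding avg_def by (intro divide_right_mono sum_mono) auto

lemma avg_nonneg: "(\<And>Z. Z \<in> \<Omega> \<Longrightarrow> 0 \<le> f Z) \<Longrightarrow> 0 \<le> (avg f :: real)"
  unfolding avg_def by (intro divide_nonneg_nonneg sum_nonneg) auto

lemma avg_cong: "(\<And>Z. Z \<in> \<Omega> \<Longrightarrow> f Z = g Z) \<Longrightarrow> avg f = avg g"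
  unfolding avg_def by (simp cong: sum.cong)

lemma norm_avg_le: "norm (avg f) \<le> avg (\<lambda>Z. norm (f Z))"
  unfolding avg_def norm_divide norm_of_nat of_nat_eq_iff by (intro divide_right_mono norm_sum) simp_all

lemma integral_assignments_eq_avg:
  fixes f :: "(nat \<Rightarrow> 'q) \<Rightarrow> 'c::{real_normed_field, banach, second_countable_topology}"
  shows "(\<integral>Z. f Z \<partial>measure_pmf (pmf_of_set (assignments n nq))) = avg f"
proof -
  have ne: "\<Omega> \<noteq> {}" using card_\<Omega>_pos by auto
  have "(\<integral>Z. f Z \<partial>measure_pmf (pmf_of_set \<Omega>)) = (\<Sum>Z\<in>\<Omega>. pmf (pmf_of_set \<Omega>) Z *\<^sub>R f Z)"
    using finite_\<Omega> ne by (intro integral_measure_pmf) (auto simp: set_pmf_of_set)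
  also have "\<dots> = avg f"
    using finite_\<Omega> ne by (simp add: avg_def scaleR_conv_of_real divide_inverse sum_distrib_right mult.commute)
  finally show ?thesis by (simp add: \<Omega>_def)
qed

lemma avg_abs_le_sqrt:
  assumes "avg (\<lambda>Z. (f Z)\<^sup>2) \<le> b"
  shows "avg (\<lambda>Z. \<bar>f Z\<bar> :: real) \<le> sqrt b"
proof -
  define m where "m = avg (\<lambda>Z. \<bar>f Z\<bar>)"
  have "0 \<le> avg (\<lambda>Z. (\<bar>f Z\<bar> - m)\<^sup>2)" by (rule avg_nonneg) simp
  also have "(\<lambda>Z. (\<bar>f Z\<bar> - m)\<^sup>2) = (\<lambda>Z. (f Z)\<^sup>2 - (2 * m) * \<bar>f Z\<bar> + m\<^sup>2)"
    by (simp add: fun_eq_iff power2_diff)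
  also have "avg \<dots> = avg (\<lambda>Z. (f Z)\<^sup>2) - 2 * m * m + m\<^sup>2"
    by (simp only: avg_add avg_diff avg_cmult avg_const m_def)
  finally have "m\<^sup>2 \<le> b" using assms by (simp add: power2_eq_square)
  then show ?thesis unfolding m_def by (rule real_le_rsqrt)
qed

definition swap :: "nat \<Rightarrow> nat \<Rightarrow> (nat \<Rightarrow> 'q) \<Rightarrow> nat \<Rightarrow> 'q" where
  "swap i j Z = Z \<circ> Transposition.transpose i j"

lemma swap_swap [simp]: "swap i j (swap i j Z) = Z"
  by (simp add: swap_def fun_eq_iff)

lemma swap_in_\<Omega>:
  assumes "i < n" "j < n" "Z \<in> \<Omega>"
  shows "swap i j Z \<in> \<Omega>"
proof -
  have t: "Transposition.transpose i j k < n \<longleftrightarrow> k < n" for k using assms(1,2) by (auto simp: Transposition.transpose_def)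
  have "{k. k < n \<and> swap i j Z k = q} = Transposition.transpose i j ` {k. k < n \<and> Z k = q}" for q
  proof (intro set_eqI iffI)
    fix k assume "k \<in> {k. k < n \<and> swap i j Z k = q}"
    then show "k \<in> Transposition.transpose i j ` {k. k < n \<and> Z k = q}"
      by (intro image_eqI[of _ _ "Transposition.transpose i j k"]) (auto simp: swap_def t)
  qed (auto simp: swap_def t)
  then have "card {k. k < n \<and> swap i j Z k = q} = card {k. k < n \<and> Z k = q}" for q
    by (simp add: card_image inj_on_subset[OF inj_transpose])
  moreover have "swap i j Z \<in> {..<n} \<rightarrow>\<^sub>E UNIV"
    using assms t by (auto simp: \<Omega>_def assignments_def swap_def PiE_iff extensional_def)
  ultimately show ?thesis using assms(3) by (simp add: \<Omega>_def assignments_def)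
qed

lemma avg_swap:
  assumes "i < n" "j < n"
  shows "avg (\<lambda>Z. f (swap i j Z)) = avg f"
proof -
  have "(\<Sum>Z\<in>\<Omega>. f (swap i j Z)) = (\<Sum>Z\<in>\<Omega>. f Z)"
    by (rule sum.reindex_bij_witness[of _ "swap i j" "swap i j"]) (auto simp: swap_in_\<Omega> assms)
  then show ?thesis by (simp add: avg_def)
qed

lemma sum_group:
  fixes f :: "'q \<Rightarrow> 'c::real_normed_field"
  assumes "Z \<in> \<Omega>"
  shows "(\<Sum>i<n. f (Z i)) = (\<Sum>q\<in>UNIV. of_nat (nq q) * f q)"
proof -
  have "(\<Sum>i<n. f (Z i)) = (\<Sum>q\<in>UNIV. \<Sum>i | i \<in> {..<n} \<and> Z i = q. f (Z i))"
    by (rule sum.group[symmetric]) auto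
  also have "\<dots> = (\<Sum>q\<in>UNIV. of_nat (nq q) * f q)"
    using assms by (intro sum.cong refl) (simp add: \<Omega>_def assignments_def)
  finally show ?thesis .
qed

lemma avg_at:
  assumes "i < n"
  shows "avg (\<lambda>Z. f (Z i)) = (\<Sum>q\<in>UNIV. share q * f q :: real)"
proof -
  have "avg (\<lambda>Z. f (Z j)) = avg (\<lambda>Z. f (Z i))" if "j < n" for j
    using avg_swap[OF assms that, of "\<lambda>Z. f (Z j)"] by (simp add: swap_def)
  then have "real n * avg (\<lambda>Z. f (Z i)) = (\<Sum>j<n. avg (\<lambda>Z. f (Z j)))" by simp
  also have "\<dots> = avg (\<lambda>Z. \<Sum>j<n. f (Z j))" by (rule avg_sum[symmetric])
  also have "\<dots> = avg (\<lambda>Z. \<Sum>q\<in>UNIV. real (nq q) * f q)" by (rule avg_cong) (rule sum_group)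
  also have "\<dots> = (\<Sum>q\<in>UNIV. real (nq q) * f q)" by (rule avg_const)
  finally have "avg (\<lambda>Z. f (Z i)) = (\<Sum>q\<in>UNIV. real (nq q) * f q) / real n"
    using n_pos by (simp add: field_simps)
  then show ?thesis by (simp add: share_def sum_divide_distrib)
qed

definition stat :: "(nat \<Rightarrow> 'q \<Rightarrow> real) \<Rightarrow> (nat \<Rightarrow> 'q) \<Rightarrow> real" where
  "stat a Z = (\<Sum>i<n. a i (Z i))"

definition centred :: "(nat \<Rightarrow> 'q \<Rightarrow> real) \<Rightarrow> bool" where
  "centred a \<longleftrightarrow> (\<forall>q. (\<Sum>i<n. a i q) = 0)"

definition incr :: "(nat \<Rightarrow> 'q \<Rightarrow> real) \<Rightarrow> nat \<Rightarrow> nat \<Rightarrow> (nat \<Rightarrow> 'q) \<Rightarrow> real" where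
  "incr a i j Z = a i (Z j) + a j (Z i) - a i (Z i) - a j (Z j)"

definition qvar :: "(nat \<Rightarrow> 'q \<Rightarrow> real) \<Rightarrow> (nat \<Rightarrow> 'q) \<Rightarrow> real" where
  "qvar a Z = (\<Sum>i<n. \<Sum>j<n. (incr a i j Z)\<^sup>2) / (4 * real n)"

definition energy :: "(nat \<Rightarrow> 'q \<Rightarrow> real) \<Rightarrow> real" where
  "energy a = (\<Sum>i<n. \<Sum>q\<in>UNIV. share q * (a i q)\<^sup>2)"

lemma energy_nonneg: "0 \<le> energy a"
  unfolding energy_def by (intro sum_nonneg mult_nonneg_nonneg share_nonneg) auto

lemma stat_swap:
  assumes "i < n" "j < n"
  shows "stat a (swap i j Z) = stat a Z + incr a i j Z"
proof (cases "i = j")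
  case True
  then show ?thesis by (simp add: stat_def incr_def swap_def)
next
  case False
  have split: "(\<Sum>k<n. g k) = g i + g j + (\<Sum>k\<in>{..<n} - {i, j}. g k)" for g :: "nat \<Rightarrow> real"
  proof -
    have "(\<Sum>k<n. g k) = g i + (\<Sum>k\<in>{..<n} - {i}. g k)" using assms by (subst sum.remove[of _ i]) auto
    also have "(\<Sum>k\<in>{..<n} - {i}. g k) = g j + (\<Sum>k\<in>{..<n} - {i} - {j}. g k)"
      using assms False by (subst sum.remove[of _ j]) auto
    also have "{..<n} - {i} - {j} = {..<n} - {i, j}" by auto
    finally show ?thesis by simp
  qed
  have "(\<Sum>k\<in>{..<n} - {i, j}. a k (swap i j Z k)) = (\<Sum>k\<in>{..<n} - {i, j}. a k (Z k))"
    by (intro sum.cong refl) (auto simp: swap_def Transposition.transpose_def)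
  then show ?thesis unfolding stat_def split by (simp add: swap_def incr_def)
qed

lemma sum_at_eq_0:
  assumes "centred a"
  shows "(\<Sum>i<n. \<Sum>j<n. a i (Z j)) = 0"
  using assms by (subst sum.swap) (simp add: centred_def)

lemma sum_incr:
  assumes "centred a"
  shows "(\<Sum>i<n. \<Sum>j<n. incr a i j Z) = - (2 * real n * stat a Z)"
proof -
  have "(\<Sum>i<n. \<Sum>j<n. a j (Z i)) = 0"
    using sum_at_eq_0[OF assms, of Z] by (subst sum.swap) simp
  then show ?thesis using sum_at_eq_0[OF assms, of Z]
    by (simp add: incr_def sum.distrib sum_subtractf stat_def flip: sum_distrib_left)
qed

text \<open>The exchangeable pair \<open>(Z, swap i j Z)\<close> makes \<open>incr a i j\<close> antisymmetric, hence Stein's identity.\<close>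

lemma stein_identity:
  fixes g :: "real \<Rightarrow> 'c::real_normed_field"
  assumes "centred a"
  shows "avg (\<lambda>Z. of_real (stat a Z) * g (stat a Z)) =
    (\<Sum>i<n. \<Sum>j<n. avg (\<lambda>Z. of_real (incr a i j Z) * (g (stat a Z + incr a i j Z) - g (stat a Z)))) / of_nat (4 * n)"
proof -
  have pair: "avg (\<lambda>Z. of_real (incr a i j Z) * (g (stat a Z + incr a i j Z) - g (stat a Z)))
      = - 2 * avg (\<lambda>Z. of_real (incr a i j Z) * g (stat a Z))" if ij: "i < n" "j < n" for i j
  proof -
    have anti: "incr a i j (swap i j Z) = - incr a i j Z" for Z
      by (simp add: incr_def swap_def)
    have "avg (\<lambda>Z. of_real (incr a i j Z) * g (stat a Z)) = avg (\<lambda>Z. - (of_real (incr a i j Z) * g (stat a Z + incr a i j Z)))"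
      using avg_swap[OF ij, of "\<lambda>Z. of_real (incr a i j Z) * g (stat a Z)"] by (simp add: anti stat_swap[OF ij])
    also have "\<dots> = - avg (\<lambda>Z. of_real (incr a i j Z) * g (stat a Z + incr a i j Z))"
      using avg_cmult[of "-1"] by simp
    finally show ?thesis by (simp add: right_diff_distrib avg_diff)
  qed
  have "(\<Sum>i<n. \<Sum>j<n. avg (\<lambda>Z. of_real (incr a i j Z) * (g (stat a Z + incr a i j Z) - g (stat a Z))))
     = (\<Sum>i<n. \<Sum>j<n. - 2 * avg (\<lambda>Z. of_real (incr a i j Z) * g (stat a Z)))"
    by (intro sum.cong refl pair) auto
  also have "\<dots> = - 2 * avg (\<lambda>Z. of_real (\<Sum>i<n. \<Sum>j<n. incr a i j Z) * g (stat a Z))"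
    by (simp add: avg_sum sum_distrib_left sum_distrib_right)
  also have "\<dots> = of_nat (4 * n) * avg (\<lambda>Z. of_real (stat a Z) * g (stat a Z))"
    unfolding sum_incr[OF assms] by (simp add: mult.assoc flip: avg_cmult)
  finally show ?thesis using n_pos by simp
qed

lemma avg_stat_sq: "centred a \<Longrightarrow> avg (\<lambda>Z. (stat a Z)\<^sup>2) = avg (qvar a)"
  using stein_identity[of a "\<lambda>x. x"]
  by (simp add: power2_eq_square qvar_def[abs_def] avg_sum sum_divide_distrib avg_cmult[of "1 / (4 * real n)", simplified])

lemma avg_sum_at_sq: "avg (\<lambda>Z. \<Sum>i<n. \<Sum>j<n. (a i (Z j))\<^sup>2) = real n * energy a"
proof -
  have "avg (\<lambda>Z. \<Sum>i<n. \<Sum>j<n. (a i (Z j))\<^sup>2) = (\<Sum>i<n. \<Sum>j<n. \<Sum>q\<in>UNIV. share q * (a i q)\<^sup>2)"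
    unfolding avg_sum by (intro sum.cong refl avg_at) auto
  then show ?thesis by (simp add: energy_def sum_distrib_left)
qed

lemma avg_sum_diag_sq: "avg (\<lambda>Z. \<Sum>i<n. (a i (Z i))\<^sup>2) = energy a"
  unfolding avg_sum energy_def by (intro sum.cong refl avg_at) auto

lemma avg_stat_sq_le:
  assumes "centred a"
  shows "avg (\<lambda>Z. (stat a Z)\<^sup>2) \<le> 4 * energy a"
proof -
  have sq: "(x + y - z - w)\<^sup>2 \<le> 4 * (x\<^sup>2 + y\<^sup>2 + z\<^sup>2 + w\<^sup>2)" for x y z w :: real
  proof -
    have "0 \<le> (x - y)\<^sup>2 + (x + z)\<^sup>2 + (x + w)\<^sup>2 + (y + z)\<^sup>2 + (y + w)\<^sup>2 + (z - w)\<^sup>2" by simp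
    then show ?thesis by (simp add: power2_eq_square algebra_simps)
  qed
  have "(\<Sum>i<n. \<Sum>j<n. (incr a i j Z)\<^sup>2) \<le>
      4 * (2 * (\<Sum>i<n. \<Sum>j<n. (a i (Z j))\<^sup>2) + 2 * (real n * (\<Sum>i<n. (a i (Z i))\<^sup>2)))" for Z
  proof -
    have "(\<Sum>i<n. \<Sum>j<n. (incr a i j Z)\<^sup>2)
      \<le> (\<Sum>i<n. \<Sum>j<n. 4 * ((a i (Z j))\<^sup>2 + (a j (Z i))\<^sup>2 + (a i (Z i))\<^sup>2 + (a j (Z j))\<^sup>2))"
      unfolding incr_def by (intro sum_mono sq)
    also have "\<dots> = 4 * ((\<Sum>i<n. \<Sum>j<n. (a i (Z j))\<^sup>2) + (\<Sum>i<n. \<Sum>j<n. (a j (Z i))\<^sup>2)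
       + real n * (\<Sum>i<n. (a i (Z i))\<^sup>2) + real n * (\<Sum>i<n. (a i (Z i))\<^sup>2))"
      by (simp add: sum.distrib flip: sum_distrib_left)
    also have "(\<Sum>i<n. \<Sum>j<n. (a j (Z i))\<^sup>2) = (\<Sum>i<n. \<Sum>j<n. (a i (Z j))\<^sup>2)"
      by (rule sum.swap)
    finally show ?thesis by simp
  qed
  then have "qvar a Z \<le> (4 * (2 * (\<Sum>i<n. \<Sum>j<n. (a i (Z j))\<^sup>2) + 2 * (real n * (\<Sum>i<n. (a i (Z i))\<^sup>2)))) / (4 * real n)" for Z
    unfolding qvar_def by (rule divide_right_mono) simp
  moreover have "(4 * (2 * x + 2 * (real n * y))) / (4 * real n) = (2 / real n) * x + 2 * y" for x y
    using n_pos by (simp add: field_simps)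
  ultimately have "qvar a Z \<le> (2 / real n) * (\<Sum>i<n. \<Sum>j<n. (a i (Z j))\<^sup>2) + 2 * (\<Sum>i<n. (a i (Z i))\<^sup>2)" for Z
    by (simp only:)
  then have "avg (qvar a) \<le> avg (\<lambda>Z. (2 / real n) * (\<Sum>i<n. \<Sum>j<n. (a i (Z j))\<^sup>2) + 2 * (\<Sum>i<n. (a i (Z i))\<^sup>2))"
    by (intro avg_mono)
  also have "\<dots> = 4 * energy a"
    unfolding avg_add avg_cmult avg_sum_at_sq avg_sum_diag_sq using n_pos by simp
  finally show ?thesis by (simp add: avg_stat_sq assms)
qed

definition unit_mean :: "(nat \<Rightarrow> 'q \<Rightarrow> real) \<Rightarrow> nat \<Rightarrow> real" where
  "unit_mean a i = (\<Sum>q\<in>UNIV. share q * a i q)"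

definition limvar :: "(nat \<Rightarrow> 'q \<Rightarrow> real) \<Rightarrow> real" where
  "limvar a = energy a - (\<Sum>i<n. (unit_mean a i)\<^sup>2)"

definition group_stat :: "(nat \<Rightarrow> 'q \<Rightarrow> real) \<Rightarrow> 'q \<Rightarrow> 'q \<Rightarrow> (nat \<Rightarrow> 'q) \<Rightarrow> real" where
  "group_stat a q r = stat (\<lambda>i s. of_bool (s = r) * a i q)"

definition total_energy :: "(nat \<Rightarrow> 'q \<Rightarrow> real) \<Rightarrow> real" where
  "total_energy a = (\<Sum>i<n. \<Sum>q\<in>UNIV. (a i q)\<^sup>2)"

lemma energy_le_total: "energy a \<le> total_energy a"
  unfolding energy_def total_energy_def
  by (intro sum_mono mult_left_le_one_le share_nonneg share_le_1) auto

lemma total_energy_nonneg: "0 \<le> total_energy a"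
  unfolding total_energy_def by (intro sum_nonneg) auto

lemma limvar_nonneg: "0 \<le> limvar a"
proof -
  have "(unit_mean a i)\<^sup>2 \<le> (\<Sum>q\<in>UNIV. share q * (a i q)\<^sup>2)" for i
  proof -
    have "0 \<le> (\<Sum>q\<in>UNIV. share q * (a i q - unit_mean a i)\<^sup>2)" by (intro sum_nonneg mult_nonneg_nonneg share_nonneg) simp
    also have "\<dots> = (\<Sum>q\<in>UNIV. share q * (a i q)\<^sup>2 - 2 * unit_mean a i * (share q * a i q) + (unit_mean a i)\<^sup>2 * share q)"
      by (intro sum.cong refl) (simp add: power2_eq_square algebra_simps)
    also have "\<dots> = (\<Sum>q\<in>UNIV. share q * (a i q)\<^sup>2) - 2 * unit_mean a i * unit_mean a i + (unit_mean a i)\<^sup>2"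
      by (simp add: sum.distrib sum_subtractf share_sum unit_mean_def flip: sum_distrib_left)
    finally show ?thesis by (simp add: power2_eq_square)
  qed
  then show ?thesis unfolding limvar_def energy_def by (simp add: sum_mono)
qed

lemma avg_stat: "avg (stat c) = (\<Sum>i<n. \<Sum>q\<in>UNIV. share q * c i q)"
  unfolding stat_def[abs_def] avg_sum by (intro sum.cong refl avg_at) auto

lemma stat_variance_le: "avg (\<lambda>Z. (stat c Z - avg (stat c))\<^sup>2) \<le> 4 * energy c"
proof -
  define m where "m q = (\<Sum>i<n. c i q) / real n" for q
  define c' where "c' i q = c i q - m q" for i q
  have c': "centred c'" using n_pos by (simp add: centred_def c'_def sum_subtractf m_def)
  have stat_eq: "stat c Z - avg (stat c) = stat c' Z" if "Z \<in> \<Omega>" for Z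
  proof -
    have "(\<Sum>i<n. m (Z i)) = (\<Sum>q\<in>UNIV. real (nq q) * m q)" by (rule sum_group[OF that])
    also have "\<dots> = (\<Sum>q\<in>UNIV. \<Sum>i<n. share q * c i q)"
      by (simp add: m_def share_def sum_distrib_left sum_divide_distrib)
    also have "\<dots> = avg (stat c)" unfolding avg_stat by (rule sum.swap)
    finally show ?thesis by (simp add: stat_def c'_def sum_subtractf)
  qed
  have "avg (\<lambda>Z. (stat c Z - avg (stat c))\<^sup>2) = avg (\<lambda>Z. (stat c' Z)\<^sup>2)"
    by (rule avg_cong) (simp add: stat_eq)
  also have "\<dots> \<le> 4 * energy c'" by (rule avg_stat_sq_le[OF c'])
  also have "energy c' \<le> energy c"
  proof -
    have "(\<Sum>i<n. (c' i q)\<^sup>2) \<le> (\<Sum>i<n. (c i q)\<^sup>2)" for q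
    proof -
      have "(c i q)\<^sup>2 = (c' i q)\<^sup>2 + 2 * m q * c' i q + (m q)\<^sup>2" for i
        by (simp add: c'_def power2_eq_square algebra_simps)
      then have "(\<Sum>i<n. (c i q)\<^sup>2) = (\<Sum>i<n. (c' i q)\<^sup>2) + 2 * m q * (\<Sum>i<n. c' i q) + real n * (m q)\<^sup>2"
        by (simp add: sum.distrib sum_distrib_left)
      then show ?thesis using c' by (simp add: centred_def)
    qed
    then have "(\<Sum>q\<in>UNIV. share q * (\<Sum>i<n. (c' i q)\<^sup>2)) \<le> (\<Sum>q\<in>UNIV. share q * (\<Sum>i<n. (c i q)\<^sup>2))"
      by (metis (no_types, lifting) sum_mono mult_left_mono share_nonneg)
    then show ?thesis unfolding energy_def
      by (subst (1 2) sum.swap) (simp add: sum_distrib_left)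
  qed
  finally show ?thesis by simp
qed

lemma qvar_expand:
  assumes c: "centred a" and Z: "Z \<in> \<Omega>"
  shows "qvar a Z = energy a / 2 + stat (\<lambda>i q. (a i q)\<^sup>2 - 2 * a i q * unit_mean a i) Z / 2
    + (\<Sum>q\<in>UNIV. \<Sum>r\<in>UNIV. group_stat a q r Z * group_stat a r q Z) / (2 * real n) + (stat a Z)\<^sup>2 / (2 * real n)"
proof -
  have sq: "(x + y - z - w)\<^sup>2 = x\<^sup>2 + y\<^sup>2 + z\<^sup>2 + w\<^sup>2 + 2 * (x * y) + 2 * (z * w) - 2 * (x * z) - 2 * (y * w) - 2 * (x * w) - 2 * (y * z)" for x y z w :: real
    by (simp add: power2_eq_square algebra_simps)
  have e1: "(\<Sum>i<n. \<Sum>j<n. (a i (Z j))\<^sup>2) = real n * energy a"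
    unfolding energy_def sum_distrib_left
  proof (intro sum.cong refl)
    fix i
    show "(\<Sum>j<n. (a i (Z j))\<^sup>2) = (\<Sum>q\<in>UNIV. real n * (share q * (a i q)\<^sup>2))"
      using sum_group[OF Z, of "\<lambda>q. (a i q)\<^sup>2"] n_pos by (simp add: share_def)
  qed
  then have e1': "(\<Sum>i<n. \<Sum>j<n. (a j (Z i))\<^sup>2) = real n * energy a" by (subst sum.swap)
  have e2: "(\<Sum>i<n. \<Sum>j<n. a i (Z j) * a j (Z i)) = (\<Sum>q\<in>UNIV. \<Sum>r\<in>UNIV. group_stat a q r Z * group_stat a r q Z)"
  proof -
    have "a i (Z j) * a j (Z i) = (\<Sum>q\<in>UNIV. \<Sum>r\<in>UNIV. (of_bool (Z i = r) * a i q) * (of_bool (Z j = q) * a j r))" for i j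
    proof -
      have "(\<Sum>q\<in>UNIV. \<Sum>r\<in>UNIV. (of_bool (Z i = r) * a i q) * (of_bool (Z j = q) * a j r))
        = (\<Sum>q\<in>UNIV. of_bool (Z j = q) * a i q * (\<Sum>r\<in>UNIV. of_bool (Z i = r) * a j r))"
        unfolding sum_distrib_left by (intro sum.cong refl) (simp only: mult_ac)
      also have "(\<Sum>r\<in>UNIV. of_bool (Z i = r) * a j r) = a j (Z i)"
        by (simp add: of_bool_def if_distrib[of "\<lambda>x. x * _"] sum.delta cong: if_cong)
      also have "(\<Sum>q\<in>UNIV. of_bool (Z j = q) * a i q * a j (Z i)) = a i (Z j) * a j (Z i)"
        by (simp add: of_bool_def if_distrib[of "\<lambda>x. x * _"] sum.delta cong: if_cong flip: sum_distrib_right)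
      finally show ?thesis by simp
    qed
    then have "(\<Sum>i<n. \<Sum>j<n. a i (Z j) * a j (Z i))
      = (\<Sum>i<n. \<Sum>j<n. \<Sum>q\<in>UNIV. \<Sum>r\<in>UNIV. (of_bool (Z i = r) * a i q) * (of_bool (Z j = q) * a j r))" by simp
    also have "\<dots> = (\<Sum>i<n. \<Sum>q\<in>UNIV. \<Sum>j<n. \<Sum>r\<in>UNIV. (of_bool (Z i = r) * a i q) * (of_bool (Z j = q) * a j r))"
      by (intro sum.cong refl sum.swap)
    also have "\<dots> = (\<Sum>q\<in>UNIV. \<Sum>i<n. \<Sum>r\<in>UNIV. \<Sum>j<n. (of_bool (Z i = r) * a i q) * (of_bool (Z j = q) * a j r))"
      by (subst sum.swap) (intro sum.cong refl sum.swap)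
    also have "\<dots> = (\<Sum>q\<in>UNIV. \<Sum>r\<in>UNIV. \<Sum>i<n. \<Sum>j<n. (of_bool (Z i = r) * a i q) * (of_bool (Z j = q) * a j r))"
      by (intro sum.cong refl sum.swap)
    also have "\<dots> = (\<Sum>q\<in>UNIV. \<Sum>r\<in>UNIV. group_stat a q r Z * group_stat a r q Z)"
      unfolding group_stat_def stat_def sum_product ..
    finally show ?thesis .
  qed
  have e3: "(\<Sum>i<n. a i (Z i) * (\<Sum>j<n. a j (Z j))) = (stat a Z)\<^sup>2"
    by (simp add: stat_def power2_eq_square flip: sum_distrib_right)
  have e4: "(\<Sum>i<n. \<Sum>j<n. a i (Z j) * a i (Z i)) = real n * (\<Sum>i<n. a i (Z i) * unit_mean a i)"
    unfolding sum_distrib_left[of "real n"]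
  proof (intro sum.cong refl)
    fix i
    have "(\<Sum>j<n. a i (Z j)) = real n * unit_mean a i"
      using sum_group[OF Z, of "a i"] n_pos by (simp add: share_def unit_mean_def sum_distrib_left)
    then show "(\<Sum>j<n. a i (Z j) * a i (Z i)) = real n * (a i (Z i) * unit_mean a i)"
      by (simp flip: sum_distrib_right)
  qed
  then have e4': "(\<Sum>i<n. \<Sum>j<n. a j (Z i) * a j (Z j)) = real n * (\<Sum>i<n. a i (Z i) * unit_mean a i)"
    by (subst sum.swap)
  have e5: "(\<Sum>i<n. \<Sum>j<n. a j (Z i) * a i (Z i)) = 0"
    using c by (simp add: centred_def flip: sum_distrib_right)
  then have e5': "(\<Sum>i<n. \<Sum>j<n. a i (Z j) * a j (Z j)) = 0" by (subst sum.swap)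
  have A: "(\<Sum>i<n. \<Sum>j<n. (incr a i j Z)\<^sup>2) = 2 * real n * energy a + 2 * real n * (\<Sum>i<n. (a i (Z i))\<^sup>2)
    + 2 * (\<Sum>q\<in>UNIV. \<Sum>r\<in>UNIV. group_stat a q r Z * group_stat a r q Z) + 2 * (stat a Z)\<^sup>2
    - 4 * real n * (\<Sum>i<n. a i (Z i) * unit_mean a i)"
    unfolding incr_def sq sum.distrib sum_subtractf sum_distrib_left[symmetric] e1 e1' e2 e4 e4' e5 e5'
    by (simp add: sum_distrib_left[symmetric] e3)
  have B: "stat (\<lambda>i q. (a i q)\<^sup>2 - 2 * a i q * unit_mean a i) Z
     = (\<Sum>i<n. (a i (Z i))\<^sup>2) - 2 * (\<Sum>i<n. a i (Z i) * unit_mean a i)"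
    by (simp add: stat_def sum_subtractf sum_distrib_left mult.assoc)
  show ?thesis
    unfolding qvar_def A B using n_pos by (simp add: field_simps)
qed

lemma qvar_concentration:
  assumes c: "centred a" and \<delta>: "\<And>i q. i < n \<Longrightarrow> \<bar>a i q\<bar> \<le> \<delta>"
  shows "avg (\<lambda>Z. \<bar>qvar a Z - limvar a\<bar>) \<le> 3 * \<delta> * sqrt (total_energy a) + 4 * total_energy a / real n"
proof -
  define b where "b i q = (a i q)\<^sup>2 - 2 * a i q * unit_mean a i" for i q
  define W where "W Z = (\<Sum>q\<in>UNIV. \<Sum>r\<in>UNIV. group_stat a q r Z * group_stat a r q Z)" for Z
  have \<delta>0: "0 \<le> \<delta>" using \<delta>[OF n_pos] by (meson abs_ge_zero order_trans)
  have um: "\<bar>unit_mean a i\<bar> \<le> \<delta>" if "i < n" for i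
  proof -
    have "\<bar>unit_mean a i\<bar> \<le> (\<Sum>q\<in>UNIV. \<bar>share q * a i q\<bar>)" unfolding unit_mean_def by (rule sum_abs)
    also have "\<dots> \<le> (\<Sum>q\<in>UNIV. share q * \<delta>)"
      using \<delta>[OF that] share_nonneg by (intro sum_mono) (simp add: abs_mult mult_left_mono)
    also have "\<dots> = \<delta>" by (simp add: share_sum flip: sum_distrib_right)
    finally show ?thesis .
  qed
  have b: "(b i q)\<^sup>2 \<le> (3 * \<delta>)\<^sup>2 * (a i q)\<^sup>2" if "i < n" for i q
  proof -
    have "\<bar>b i q\<bar> = \<bar>a i q\<bar> * \<bar>a i q - 2 * unit_mean a i\<bar>"
      by (simp add: b_def power2_eq_square algebra_simps flip: abs_mult)
    also have "\<dots> \<le> \<bar>a i q\<bar> * (3 * \<delta>)"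
      using \<delta>[OF that, of q] um[OF that] by (intro mult_left_mono) auto
    finally have "\<bar>b i q\<bar>\<^sup>2 \<le> (\<bar>a i q\<bar> * (3 * \<delta>))\<^sup>2" by (rule power_mono) simp
    then show ?thesis by (simp add: power_mult_distrib mult_ac)
  qed
  have "energy b \<le> (3 * \<delta>)\<^sup>2 * energy a"
    unfolding energy_def sum_distrib_left
  proof (intro sum_mono)
    fix i q assume "i \<in> {..<n}"
    then show "share q * (b i q)\<^sup>2 \<le> (3 * \<delta>)\<^sup>2 * (share q * (a i q)\<^sup>2)"
      using mult_left_mono[OF b share_nonneg, of i q q] by (simp add: mult_ac)
  qed
  also have "\<dots> \<le> (3 * \<delta>)\<^sup>2 * total_energy a" by (intro mult_left_mono energy_le_total) simp
  finally have "avg (\<lambda>Z. (stat b Z - avg (stat b))\<^sup>2) \<le> 4 * ((3 * \<delta>)\<^sup>2 * total_energy a)"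
    using stat_variance_le[of b] by simp
  from avg_abs_le_sqrt[OF this] have C: "avg (\<lambda>Z. \<bar>stat b Z - avg (stat b)\<bar>) \<le> 6 * \<delta> * sqrt (total_energy a)"
    using \<delta>0 by (simp add: real_sqrt_mult)
  have G: "avg (\<lambda>Z. (group_stat a q r Z)\<^sup>2) \<le> 4 * (share r * (\<Sum>i<n. (a i q)\<^sup>2))" for q r
  proof -
    have "centred (\<lambda>i s. of_bool (s = r) * a i q)"
      using c by (simp add: centred_def flip: sum_distrib_left)
    then have "avg (\<lambda>Z. (group_stat a q r Z)\<^sup>2) \<le> 4 * energy (\<lambda>i s. of_bool (s = r) * a i q)"
      unfolding group_stat_def by (rule avg_stat_sq_le)
    also have "energy (\<lambda>i s. of_bool (s = r) * a i q) = share r * (\<Sum>i<n. (a i q)\<^sup>2)"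
    proof -
      have "(\<Sum>s\<in>UNIV. share s * (of_bool (s = r) * a i q)\<^sup>2) = share r * (a i q)\<^sup>2" for i
      proof -
        have "(\<Sum>s\<in>UNIV. share s * (of_bool (s = r) * a i q)\<^sup>2) = (\<Sum>s\<in>UNIV. if s = r then share r * (a i q)\<^sup>2 else 0)"
          by (intro sum.cong) auto
        then show ?thesis by simp
      qed
      then show ?thesis by (simp add: energy_def sum_distrib_left)
    qed
    finally show ?thesis .
  qed
  have W: "avg (\<lambda>Z. \<bar>W Z\<bar>) \<le> 4 * total_energy a"
  proof -
    have "avg (\<lambda>Z. \<bar>W Z\<bar>) \<le> avg (\<lambda>Z. \<Sum>q\<in>UNIV. \<Sum>r\<in>UNIV. (1/2) * (group_stat a q r Z)\<^sup>2 + (1/2) * (group_stat a r q Z)\<^sup>2)"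
    proof (rule avg_mono)
      fix Z
      have "\<bar>W Z\<bar> \<le> (\<Sum>q\<in>UNIV. \<Sum>r\<in>UNIV. \<bar>group_stat a q r Z * group_stat a r q Z\<bar>)"
        unfolding W_def by (rule order_trans[OF sum_abs]) (intro sum_mono sum_abs)
      also have "\<dots> \<le> (\<Sum>q\<in>UNIV. \<Sum>r\<in>UNIV. (1/2) * (group_stat a q r Z)\<^sup>2 + (1/2) * (group_stat a r q Z)\<^sup>2)"
      proof (intro sum_mono)
        fix q r
        show "\<bar>group_stat a q r Z * group_stat a r q Z\<bar> \<le> (1/2) * (group_stat a q r Z)\<^sup>2 + (1/2) * (group_stat a r q Z)\<^sup>2"
          using sum_squares_bound[of "\<bar>group_stat a q r Z\<bar>" "\<bar>group_stat a r q Z\<bar>"] by (simp add: abs_mult)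
      qed
      finally show "\<bar>W Z\<bar> \<le> (\<Sum>q\<in>UNIV. \<Sum>r\<in>UNIV. (1/2) * (group_stat a q r Z)\<^sup>2 + (1/2) * (group_stat a r q Z)\<^sup>2)" .
    qed
    also have "\<dots> = (\<Sum>q\<in>UNIV. \<Sum>r\<in>UNIV. (1/2) * avg (\<lambda>Z. (group_stat a q r Z)\<^sup>2) + (1/2) * avg (\<lambda>Z. (group_stat a r q Z)\<^sup>2))"
      unfolding avg_sum avg_add avg_cmult ..
    also have "\<dots> \<le> (\<Sum>q\<in>UNIV. \<Sum>r\<in>UNIV. 2 * (share r * (\<Sum>i<n. (a i q)\<^sup>2)) + 2 * (share q * (\<Sum>i<n. (a i r)\<^sup>2)))"
    proof (intro sum_mono)
      fix q r
      show "(1/2) * avg (\<lambda>Z. (group_stat a q r Z)\<^sup>2) + (1/2) * avg (\<lambda>Z. (group_stat a r q Z)\<^sup>2)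
        \<le> 2 * (share r * (\<Sum>i<n. (a i q)\<^sup>2)) + 2 * (share q * (\<Sum>i<n. (a i r)\<^sup>2))"
        using G[of q r] G[of r q] by simp
    qed
    also have "\<dots> = 4 * (\<Sum>q\<in>UNIV. \<Sum>i<n. (a i q)\<^sup>2)"
      by (simp add: sum.distrib share_sum flip: sum_distrib_left sum_distrib_right)
    also have "(\<Sum>q\<in>UNIV. \<Sum>i<n. (a i q)\<^sup>2) = total_energy a" unfolding total_energy_def by (rule sum.swap)
    finally show ?thesis .
  qed
  have S: "avg (\<lambda>Z. (stat a Z)\<^sup>2) \<le> 4 * total_energy a"
    using avg_stat_sq_le[OF c] energy_le_total[of a] by linarith
  have mean: "avg (stat b) = energy a - 2 * (\<Sum>i<n. (unit_mean a i)\<^sup>2)"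
  proof -
    have "(\<Sum>q\<in>UNIV. share q * b i q) = (\<Sum>q\<in>UNIV. share q * (a i q)\<^sup>2) - 2 * (unit_mean a i)\<^sup>2" for i
    proof -
      have "(\<Sum>q\<in>UNIV. share q * b i q) = (\<Sum>q\<in>UNIV. share q * (a i q)\<^sup>2) - 2 * unit_mean a i * (\<Sum>q\<in>UNIV. share q * a i q)"
        by (simp add: b_def right_diff_distrib sum_subtractf sum_distrib_left mult_ac)
      then show ?thesis by (simp add: power2_eq_square flip: unit_mean_def)
    qed
    then show ?thesis by (simp add: avg_stat energy_def sum_subtractf sum_distrib_left)
  qed
  have "avg (\<lambda>Z. \<bar>qvar a Z - limvar a\<bar>) \<le> avg (\<lambda>Z. (1/2) * \<bar>stat b Z - avg (stat b)\<bar> + (1 / (2 * real n)) * \<bar>W Z\<bar> + (1 / (2 * real n)) * (stat a Z)\<^sup>2)"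
  proof (rule avg_mono)
    fix Z assume Z: "Z \<in> \<Omega>"
    have "qvar a Z - limvar a = (1/2) * (stat b Z - avg (stat b)) + (1 / (2 * real n)) * W Z + (1 / (2 * real n)) * (stat a Z)\<^sup>2"
      unfolding qvar_expand[OF c Z, folded b_def W_def] mean limvar_def by (simp add: field_simps)
    also have "\<bar>\<dots>\<bar> \<le> \<bar>(1/2) * (stat b Z - avg (stat b))\<bar> + \<bar>(1 / (2 * real n)) * W Z\<bar> + \<bar>(1 / (2 * real n)) * (stat a Z)\<^sup>2\<bar>"
      by (intro order_trans[OF abs_triangle_ineq] add_mono abs_triangle_ineq) simp
    finally show "\<bar>qvar a Z - limvar a\<bar> \<le> (1/2) * \<bar>stat b Z - avg (stat b)\<bar> + (1 / (2 * real n)) * \<bar>W Z\<bar> + (1 / (2 * real n)) * (stat a Z)\<^sup>2"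
      by (simp add: abs_mult)
  qed
  also have "\<dots> = (1/2) * avg (\<lambda>Z. \<bar>stat b Z - avg (stat b)\<bar>) + (1 / (2 * real n)) * avg (\<lambda>Z. \<bar>W Z\<bar>) + (1 / (2 * real n)) * avg (\<lambda>Z. (stat a Z)\<^sup>2)"
    unfolding avg_add avg_cmult ..
  also have "\<dots> \<le> (1/2) * (6 * \<delta> * sqrt (total_energy a)) + (1 / (2 * real n)) * (4 * total_energy a) + (1 / (2 * real n)) * (4 * total_energy a)"
    by (intro add_mono mult_left_mono C W S) auto
  also have "\<dots> = 3 * \<delta> * sqrt (total_energy a) + 4 * total_energy a / real n"
    using n_pos by (simp add: field_simps)
  finally show ?thesis .
qed

lemma iexp_quadratic_bound: "cmod (iexp x - 1 - \<i> * x) \<le> x\<^sup>2 / 2"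
  using iexp_approx1[of x 1] by (simp add: power2_eq_square field_simps)

lemma char_stat_deriv_bound:
  assumes c: "centred a" and \<delta>: "\<And>i q. i < n \<Longrightarrow> \<bar>a i q\<bar> \<le> \<delta>"
  shows "cmod (\<i> * avg (\<lambda>Z. of_real (stat a Z) * iexp (t * stat a Z)) + of_real (t * limvar a) * avg (\<lambda>Z. iexp (t * stat a Z)))
    \<le> \<bar>t\<bar> * avg (\<lambda>Z. \<bar>qvar a Z - limvar a\<bar>) + 8 * t\<^sup>2 * \<delta> * energy a"
proof -
  let ?S = "stat a" and ?D = "incr a"
  define g where "g s = iexp (t * s)" for s :: real
  define rem where "rem i j Z = of_real (?D i j Z) * (g (?S Z + ?D i j Z) - g (?S Z)) - \<i> * of_real (t * (?D i j Z)\<^sup>2) * g (?S Z)" for i j Z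
  have rem: "cmod (rem i j Z) \<le> (2 * t\<^sup>2 * \<delta>) * (?D i j Z)\<^sup>2" if ij: "i < n" "j < n" for i j Z
  proof -
    define d where "d = ?D i j Z"
    have "rem i j Z = of_real d * g (?S Z) * (iexp (t * d) - 1 - \<i> * of_real (t * d))"
      by (simp add: rem_def g_def d_def[symmetric] algebra_simps power2_eq_square flip: exp_add)
    then have "cmod (rem i j Z) = \<bar>d\<bar> * cmod (iexp (t * d) - 1 - \<i> * of_real (t * d))"
      by (simp add: norm_mult g_def)
    also have "\<dots> \<le> \<bar>d\<bar> * ((t * d)\<^sup>2 / 2)" by (intro mult_left_mono iexp_quadratic_bound) simp
    also have "\<dots> \<le> (4 * \<delta>) * ((t * d)\<^sup>2 / 2)"
    proof (rule mult_right_mono)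
      show "\<bar>d\<bar> \<le> 4 * \<delta>"
        using \<delta>[OF ij(1), of "Z i"] \<delta>[OF ij(1), of "Z j"] \<delta>[OF ij(2), of "Z i"] \<delta>[OF ij(2), of "Z j"]
        unfolding d_def incr_def by linarith
    qed simp
    finally show ?thesis by (simp add: d_def power_mult_distrib mult_ac)
  qed
  have "avg (\<lambda>Z. of_real (?S Z) * g (?S Z)) - \<i> * of_real t * avg (\<lambda>Z. of_real (qvar a Z) * g (?S Z))
     = (\<Sum>i<n. \<Sum>j<n. avg (rem i j)) / of_nat (4 * n)"
  proof -
    have "(\<Sum>i<n. \<Sum>j<n. avg (rem i j)) = (\<Sum>i<n. \<Sum>j<n. avg (\<lambda>Z. of_real (?D i j Z) * (g (?S Z + ?D i j Z) - g (?S Z))))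
      - avg (\<lambda>Z. \<Sum>i<n. \<Sum>j<n. \<i> * of_real (t * (?D i j Z)\<^sup>2) * g (?S Z))"
      unfolding rem_def avg_diff avg_sum sum_subtractf ..
    also have "(\<lambda>Z. \<Sum>i<n. \<Sum>j<n. \<i> * of_real (t * (?D i j Z)\<^sup>2) * g (?S Z)) = (\<lambda>Z. (of_nat (4 * n) * \<i> * of_real t) * (of_real (qvar a Z) * g (?S Z)))"
    proof
      fix Z
      have "(\<Sum>i<n. \<Sum>j<n. \<i> * of_real (t * (?D i j Z)\<^sup>2) * g (?S Z)) = \<i> * of_real t * g (?S Z) * of_real (\<Sum>i<n. \<Sum>j<n. (?D i j Z)\<^sup>2)"
        by (simp add: sum_distrib_left mult_ac)
      also have "(\<Sum>i<n. \<Sum>j<n. (?D i j Z)\<^sup>2) = 4 * real n * qvar a Z"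
        using n_pos by (simp add: qvar_def)
      finally show "(\<Sum>i<n. \<Sum>j<n. \<i> * of_real (t * (?D i j Z)\<^sup>2) * g (?S Z)) = (of_nat (4 * n) * \<i> * of_real t) * (of_real (qvar a Z) * g (?S Z))"
        by (simp add: mult_ac)
    qed
    finally show ?thesis unfolding stein_identity[OF c, of g] avg_cmult using n_pos
      by (simp add: diff_divide_distrib)
  qed
  moreover have "cmod ((\<Sum>i<n. \<Sum>j<n. avg (rem i j)) / of_nat (4 * n)) \<le> 8 * t\<^sup>2 * \<delta> * energy a"
  proof -
    have \<delta>0: "0 \<le> \<delta>" using \<delta>[OF n_pos] by (meson abs_ge_zero order_trans)
    have "cmod (\<Sum>i<n. \<Sum>j<n. avg (rem i j)) \<le> (\<Sum>i<n. \<Sum>j<n. cmod (avg (rem i j)))"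
      by (rule order_trans[OF norm_sum]) (intro sum_mono norm_sum)
    also have "\<dots> \<le> (\<Sum>i<n. \<Sum>j<n. avg (\<lambda>Z. (2 * t\<^sup>2 * \<delta>) * (?D i j Z)\<^sup>2))"
      by (intro sum_mono order_trans[OF norm_avg_le] avg_mono rem) auto
    also have "\<dots> = (2 * t\<^sup>2 * \<delta>) * (4 * real n * avg (qvar a))"
    proof -
      have "avg (qvar a) = (\<Sum>i<n. \<Sum>j<n. avg (\<lambda>Z. (?D i j Z)\<^sup>2)) / (4 * real n)"
        using avg_cmult[of "1 / (4 * real n)" "\<lambda>Z. \<Sum>i<n. \<Sum>j<n. (?D i j Z)\<^sup>2"]
        by (simp add: qvar_def[abs_def] avg_sum)
      then have "4 * real n * avg (qvar a) = (\<Sum>i<n. \<Sum>j<n. avg (\<lambda>Z. (?D i j Z)\<^sup>2))" using n_pos by simp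
      then show ?thesis unfolding avg_cmult by (simp only: sum_distrib_left)
    qed
    finally have "cmod (\<Sum>i<n. \<Sum>j<n. avg (rem i j)) / (4 * real n) \<le> (2 * t\<^sup>2 * \<delta>) * (4 * real n * avg (qvar a)) / (4 * real n)"
      by (rule divide_right_mono) simp
    also have "\<dots> = (2 * t\<^sup>2 * \<delta>) * avg (qvar a)" using n_pos by simp
    also have "\<dots> \<le> (2 * t\<^sup>2 * \<delta>) * (4 * energy a)"
      using avg_stat_sq_le[OF c] \<delta>0 by (intro mult_left_mono) (auto simp: avg_stat_sq[OF c])
    finally show ?thesis by (simp add: norm_divide norm_mult)
  qed
  ultimately have 1: "cmod (avg (\<lambda>Z. of_real (?S Z) * g (?S Z)) - \<i> * of_real t * avg (\<lambda>Z. of_real (qvar a Z) * g (?S Z)))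
     \<le> 8 * t\<^sup>2 * \<delta> * energy a" by simp
  have 2: "cmod (avg (\<lambda>Z. of_real (qvar a Z - limvar a) * g (?S Z))) \<le> avg (\<lambda>Z. \<bar>qvar a Z - limvar a\<bar>)"
    using norm_avg_le[of "\<lambda>Z. of_real (qvar a Z - limvar a) * g (?S Z)"] by (simp add: norm_mult g_def flip: of_real_diff)
  define u where "u = avg (\<lambda>Z. of_real (?S Z) * g (?S Z)) - \<i> * of_real t * avg (\<lambda>Z. of_real (qvar a Z) * g (?S Z))"
  define w where "w = avg (\<lambda>Z. of_real (qvar a Z - limvar a) * g (?S Z))"
  have eq: "\<i> * avg (\<lambda>Z. of_real (?S Z) * g (?S Z)) + of_real (t * limvar a) * avg (\<lambda>Z. g (?S Z)) = \<i> * u - of_real t * w"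
    by (simp add: u_def w_def left_diff_distrib avg_diff avg_cmult algebra_simps)
  have "cmod (\<i> * u - of_real t * w) \<le> cmod u + \<bar>t\<bar> * cmod w"
    using norm_triangle_ineq4[of "\<i> * u" "of_real t * w"] by (simp add: norm_mult)
  moreover have "\<bar>t\<bar> * cmod w \<le> \<bar>t\<bar> * avg (\<lambda>Z. \<bar>qvar a Z - limvar a\<bar>)"
    using 2 by (intro mult_left_mono) (auto simp: w_def)
  ultimately have "cmod (\<i> * u - of_real t * w) \<le> \<bar>t\<bar> * avg (\<lambda>Z. \<bar>qvar a Z - limvar a\<bar>) + 8 * t\<^sup>2 * \<delta> * energy a"
    using 1 unfolding u_def by linarith
  then show ?thesis using eq by (simp only: g_def)
qed

text \<open>\<open>\<phi>(t) exp(limvar a * t^2 / 2)\<close> has small derivative on \<open>[0, 1]\<close> for the characteristic function \<open>\<phi>\<close> of \<open>stat a\<close>.\<close>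

theorem finite_population_clt:
  assumes c: "centred a" and \<delta>: "\<And>i q. i < n \<Longrightarrow> \<bar>a i q\<bar> \<le> \<delta>"
  shows "cmod (avg (\<lambda>Z. iexp (stat a Z)) - of_real (exp (- limvar a / 2)))
    \<le> 3 * \<delta> * sqrt (total_energy a) + 4 * total_energy a / real n + 8 * \<delta> * total_energy a" (is "_ \<le> ?e")
proof -
  define v where "v = limvar a"
  define \<phi> where "\<phi> t = avg (\<lambda>Z. iexp (t * stat a Z))" for t :: real
  define \<phi>' where "\<phi>' t = \<i> * avg (\<lambda>Z. of_real (stat a Z) * iexp (t * stat a Z))" for t :: real
  define f where "f t = \<phi> t * of_real (exp (v * t\<^sup>2 / 2))" for t
  have \<delta>0: "0 \<le> \<delta>" using \<delta>[OF n_pos] by (meson abs_ge_zero order_trans)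
  have e0: "0 \<le> ?e" using \<delta>0 total_energy_nonneg[of a] by simp
  have v0: "0 \<le> v" unfolding v_def by (rule limvar_nonneg)
  have d\<phi>: "(\<phi> has_vector_derivative \<phi>' t) (at t)" for t
  proof -
    have "((\<lambda>t. iexp (t * stat a Z)) has_vector_derivative \<i> * (of_real (stat a Z) * iexp (t * stat a Z))) (at t)" for Z
      by (auto intro!: derivative_eq_intros has_vector_derivative_real_field[where f="\<lambda>z. exp (\<i> * (z * of_real (stat a Z)))", simplified] simp: mult_ac)
    then show ?thesis unfolding \<phi>_def[abs_def] \<phi>'_def avg_def
      by (auto intro!: derivative_eq_intros simp: sum_distrib_left)
  qed
  have df: "(f has_vector_derivative (\<phi>' t + of_real (t * v) * \<phi> t) * of_real (exp (v * t\<^sup>2 / 2))) (at t)" for t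
  proof -
    have "((\<lambda>t. complex_of_real (exp (v * t\<^sup>2 / 2))) has_vector_derivative of_real (t * v * exp (v * t\<^sup>2 / 2))) (at t)"
      by (rule has_vector_derivative_of_real)
        (auto intro!: derivative_eq_intros simp flip: has_real_derivative_iff_has_vector_derivative)
    from has_vector_derivative_mult[OF d\<phi> this] show ?thesis
      unfolding f_def[abs_def] by (simp add: algebra_simps)
  qed
  have bound: "cmod ((\<phi>' t + of_real (t * v) * \<phi> t) * of_real (exp (v * t\<^sup>2 / 2))) \<le> ?e * exp (v / 2)" if t: "t \<in> {0..1}" for t
  proof -
    have t2: "t\<^sup>2 \<le> 1" using t by (simp add: power_le_one)
    have "cmod (\<phi>' t + of_real (t * v) * \<phi> t) \<le> \<bar>t\<bar> * avg (\<lambda>Z. \<bar>qvar a Z - limvar a\<bar>) + 8 * t\<^sup>2 * \<delta> * energy a"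
      unfolding \<phi>'_def \<phi>_def v_def by (rule char_stat_deriv_bound[OF c \<delta>])
    also have "\<dots> \<le> 1 * avg (\<lambda>Z. \<bar>qvar a Z - limvar a\<bar>) + 8 * 1 * \<delta> * total_energy a"
      using t t2 \<delta>0 energy_le_total energy_nonneg by (intro add_mono mult_mono avg_nonneg) auto
    also have "\<dots> \<le> ?e" using qvar_concentration[OF c \<delta>] by simp
    finally have "cmod (\<phi>' t + of_real (t * v) * \<phi> t) \<le> ?e" .
    moreover have "exp (v * t\<^sup>2 / 2) \<le> exp (v / 2)" using v0 t2 mult_left_mono[of "t\<^sup>2" 1 v] by simp
    ultimately show ?thesis unfolding norm_mult using e0 by (intro mult_mono) auto
  qed
  have "norm (f 1 - f 0) \<le> (?e * exp (v / 2)) * 1 - (?e * exp (v / 2)) * 0"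
  proof (rule differentiable_bound_general[OF zero_less_one])
    show "continuous_on {0..1} f"
      using df by (intro continuous_at_imp_continuous_on ballI has_vector_derivative_continuous) blast
    show "((\<lambda>t. (?e * exp (v / 2)) * t) has_vector_derivative ?e * exp (v / 2)) (at t)" for t
      unfolding has_real_derivative_iff_has_vector_derivative[symmetric] by (auto intro!: derivative_eq_intros)
    show "(f has_vector_derivative (\<phi>' t + of_real (t * v) * \<phi> t) * of_real (exp (v * t\<^sup>2 / 2))) (at t)" for t
      by (rule df)
  qed (use bound in \<open>auto intro!: continuous_intros\<close>)
  then have "cmod (\<phi> 1 * of_real (exp (v / 2)) - 1) \<le> ?e * exp (v / 2)"
    by (simp add: f_def \<phi>_def avg_const)
  then have "cmod (of_real (exp (- v / 2)) * (\<phi> 1 * of_real (exp (v / 2)) - 1)) \<le> exp (- v / 2) * (?e * exp (v / 2))"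
    unfolding norm_mult by (intro mult_mono) auto
  also have "of_real (exp (- v / 2)) * (\<phi> 1 * of_real (exp (v / 2)) - 1) = \<phi> 1 - of_real (exp (- v / 2))"
    by (simp add: right_diff_distrib mult.left_commute flip: exp_of_real exp_add)
  also have "exp (- v / 2) * (?e * exp (v / 2)) = ?e"
    by (simp add: mult.left_commute flip: exp_add)
  finally show ?thesis by (simp add: \<phi>_def v_def)
qed

end

section \<open>Factorisation of positive semidefinite forms\<close>

lemma psd_cauchy_schwarz:
  fixes B :: "'a::real_vector \<Rightarrow> 'a \<Rightarrow> real"
  assumes B: "bilinear B" and sym: "\<And>s t. B s t = B t s" and psd: "\<And>s. 0 \<le> B s s"
  shows "(B s t)\<^sup>2 \<le> B s s * B t t"
proof -
  have quad: "0 \<le> B s s + 2 * r * B s t + r\<^sup>2 * B t t" for r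
    using psd[of "s + r *\<^sub>R t"] sym[of t s]
    by (simp add: bilinear_ladd[OF B] bilinear_radd[OF B] bilinear_lmul[OF B] bilinear_rmul[OF B] power2_eq_square algebra_simps)
  show ?thesis
  proof (cases "B t t = 0")
    case True
    have "B s t = 0"
    proof (rule ccontr)
      assume "B s t \<noteq> 0"
      then show False using quad[of "- (B s s + 1) / (2 * B s t)"] True by (simp add: field_simps)
    qed
    then show ?thesis using True by simp
  next
    case False
    then have pos: "0 < B t t" using psd[of t] by simp
    show ?thesis using quad[of "- B s t / B t t"] pos by (simp add: field_simps power2_eq_square)
  qed
qed

lemma psd_factor_on:
  fixes B :: "'a::euclidean_space \<Rightarrow> 'a \<Rightarrow> real"
  assumes "finite S" "S \<subseteq> Basis"
    and "bilinear B" "\<And>s t. B s t = B t s" "\<And>s. 0 \<le> B s s"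
    and "\<And>b t. b \<in> Basis - S \<Longrightarrow> B b t = 0"
  shows "\<exists>L :: 'a \<Rightarrow> 'a. linear L \<and> (\<forall>s t. B s t = L s \<bullet> L t) \<and> (\<forall>s. \<forall>b\<in>Basis - S. L s \<bullet> b = 0)"
  using assms
proof (induction S arbitrary: B rule: finite_induct)
  case empty
  have "B s t = 0" for s t
  proof -
    have "B s t = B (\<Sum>b\<in>Basis. (s \<bullet> b) *\<^sub>R b) t" by (simp add: euclidean_representation)
    also have "\<dots> = (\<Sum>b\<in>Basis. (s \<bullet> b) *\<^sub>R B b t)"
    proof -
      have "linear (\<lambda>s. B s t)" using empty.prems(2) by (simp add: bilinear_def)
      then show ?thesis by (simp add: linear_sum[of "\<lambda>s. B s t"] linear_scale[of "\<lambda>s. B s t"])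
    qed
    finally show ?thesis using empty.prems(5) by simp
  qed
  then show ?case by (intro exI[of _ "\<lambda>_. 0"]) (simp add: linear_zero)
next
  case (insert e S)
  note B = insert.prems(2) and sym = insert.prems(3) and psd = insert.prems(4)
  have e: "e \<in> Basis" and S: "S \<subseteq> Basis" using insert.prems(1) by auto
  show ?case
  proof (cases "B e e = 0")
    case True
    have "B e t = 0" for t using psd_cauchy_schwarz[OF B sym psd, of e t] True by simp
    then have "\<exists>L :: 'a \<Rightarrow> 'a. linear L \<and> (\<forall>s t. B s t = L s \<bullet> L t) \<and> (\<forall>s. \<forall>b\<in>Basis - S. L s \<bullet> b = 0)"
      using insert.prems(5) by (intro insert.IH[OF S B sym psd]) auto
    then show ?thesis by blast
  next
    case False
    then have pos: "0 < B e e" using psd[of e] by simp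
    define B' where "B' s t = B s t - B s e * B t e / B e e" for s t
    have B': "bilinear B'"
      unfolding bilinear_def B'_def
      by (intro conjI allI linearI)
        (simp_all add: bilinear_ladd[OF B] bilinear_radd[OF B] bilinear_lmul[OF B] bilinear_rmul[OF B] algebra_simps add_divide_distrib)
    have "0 \<le> B' s s" for s
      using psd_cauchy_schwarz[OF B sym psd, of s e] pos by (simp add: B'_def field_simps power2_eq_square)
    moreover have "B' b t = 0" if "b \<in> Basis - S" for b t
      using insert.prems(5)[of b] that pos sym[of e t] by (cases "b = e") (auto simp: B'_def)
    moreover have "B' s t = B' t s" for s t using sym[of s t] by (simp add: B'_def)
    ultimately obtain L :: "'a \<Rightarrow> 'a" where L: "linear L" and BL: "\<And>s t. B' s t = L s \<bullet> L t"
      and Lb: "\<And>s b. b \<in> Basis - S \<Longrightarrow> L s \<bullet> b = 0"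
      using insert.IH[OF S B'] by blast
    define L' where "L' s = L s + (B s e / sqrt (B e e)) *\<^sub>R e" for s
    have "linear L'"
      unfolding L'_def
      by (rule linearI) (simp_all add: linear_add[OF L] linear_scale[OF L] bilinear_ladd[OF B] bilinear_lmul[OF B] algebra_simps add_divide_distrib)
    moreover have "B s t = L' s \<bullet> L' t" for s t
    proof -
      have "L s \<bullet> e = 0" "e \<bullet> L t = 0" using Lb[of e] e insert.hyps by (auto simp: inner_commute)
      then have "L' s \<bullet> L' t = B' s t + (B s e * B t e) / (sqrt (B e e) * sqrt (B e e))"
        using e by (simp add: L'_def inner_add_left inner_add_right BL)
      then show ?thesis using pos by (simp add: B'_def)
    qed
    moreover have "L' s \<bullet> b = 0" if "b \<in> Basis - insert e S" for s b
      using Lb[of b s] that e by (auto simp: L'_def inner_add_left inner_Basis)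
    ultimately show ?thesis by blast
  qed
qed

lemma psd_factor:
  fixes B :: "'a::euclidean_space \<Rightarrow> 'a \<Rightarrow> real"
  assumes "bilinear B" "\<And>s t. B s t = B t s" "\<And>s. 0 \<le> B s s"
  obtains L :: "'a \<Rightarrow> 'a" where "linear L" "\<And>s t. B s t = L s \<bullet> L t"
  using psd_factor_on[OF finite_Basis order_refl assms] that by fastforce

lemma psd_block_factor:
  fixes B :: "'u::euclidean_space \<times> 'w::euclidean_space \<Rightarrow> 'u \<times> 'w \<Rightarrow> real"
  assumes B: "bilinear B" and sym: "\<And>s t. B s t = B t s" and psd: "\<And>s. 0 \<le> B s s"
    and pd: "\<And>w. B (0, w) (0, w) = 0 \<Longrightarrow> w = 0"
  obtains N :: "'u \<Rightarrow> 'u" and P :: "'u \<Rightarrow> 'w" and L :: "'w \<Rightarrow> 'w"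
  where "linear N" "linear P" "linear L" "surj L"
    "\<And>w w'. B (0, w) (0, w') = L w \<bullet> L w'"
    "\<And>s w. B (s, w) (s, w) = (norm (N s))\<^sup>2 + (norm (P s + L w))\<^sup>2"
proof -
  have add: "B (x + y) z = B x z + B y z" "B z (x + y) = B z x + B z y"
    and scale: "B (r *\<^sub>R x) z = r * B x z" "B z (r *\<^sub>R x) = r * B z x" for x y z r
    by (simp_all add: bilinear_ladd[OF B] bilinear_radd[OF B] bilinear_lmul[OF B] bilinear_rmul[OF B])
  have pair: "(s + s', 0) = (s, 0) + (s', 0::'w)" "(0::'u, w + w') = (0, w) + (0, w')"
    "(r *\<^sub>R s, 0) = r *\<^sub>R (s, 0::'w)" "(0::'u, r *\<^sub>R w) = r *\<^sub>R (0, w)" for s s' w w' r by auto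
  have "bilinear (\<lambda>w w'. B (0, w) (0, w'))"
    unfolding bilinear_def by (intro conjI allI linearI) (simp_all only: pair add scale real_scaleR_def)
  then obtain L :: "'w \<Rightarrow> 'w" where L: "linear L" and BL: "\<And>w w'. B (0, w) (0, w') = L w \<bullet> L w'"
    using sym psd by (rule psd_factor[of "\<lambda>w w'. B (0, w) (0, w')"]) blast
  have "inj L"
    using pd BL by (simp add: linear_injective_0[OF L])
  then have surj: "surj L" using linear_injective_imp_surjective[of L] L by simp
  obtain K where K: "linear K" "L \<circ> K = id"
    using linear_surjective_right_inverse[OF L surj] by blast
  have LK: "L (K y) = y" for y using K(2) by (metis comp_apply id_apply)
  define P where "P s = (\<Sum>b\<in>Basis. B (s, 0) (0, K b) *\<^sub>R b)" for s
  have P: "linear P"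
    unfolding P_def by (rule linearI) (simp_all only: pair add scale scaleR_add_left sum.distrib scaleR_sum_right scaleR_scaleR)
  have cross: "B (s, 0) (0, w) = P s \<bullet> L w" for s w
  proof -
    have "B (s, 0) (0, K y) = P s \<bullet> y" for y
    proof -
      have "linear (\<lambda>y. B (s, 0) (0, K y))"
        by (rule linearI) (simp_all only: linear_add[OF K(1)] linear_scale[OF K(1)] pair add scale real_scaleR_def)
      then have "B (s, 0) (0, K (\<Sum>b\<in>Basis. (y \<bullet> b) *\<^sub>R b)) = (\<Sum>b\<in>Basis. (y \<bullet> b) *\<^sub>R B (s, 0) (0, K b))"
        by (simp add: linear_sum[of "\<lambda>y. B (s, 0) (0, K y)"] linear_scale[of "\<lambda>y. B (s, 0) (0, K y)"])
      then show ?thesis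
        unfolding euclidean_representation by (simp add: P_def inner_sum_left mult.commute inner_commute[of y])
    qed
    from this[of "L w"] show ?thesis
      using LK[of "L w"] \<open>inj L\<close> by (simp add: inj_eq)
  qed
  define R where "R s t = B (s, 0) (t, 0) - P s \<bullet> P t" for s t
  have "bilinear R"
    unfolding bilinear_def R_def
    by (intro conjI allI linearI)
      (simp_all only: pair add scale linear_add[OF P] linear_scale[OF P] inner_add_left inner_add_right inner_scaleR_left inner_scaleR_right real_scaleR_def algebra_simps)
  moreover have "R s t = R t s" for s t using sym[of "(s, 0)"] by (simp add: R_def inner_commute)
  moreover have expand: "B (s, w) (s, w) = R s s + (norm (P s + L w))\<^sup>2" for s w
  proof -
    have "(s, w) = (s, 0) + (0, w)" by simp
    then have "B (s, w) (s, w) = B (s, 0) (s, 0) + B (s, 0) (0, w) + B (0, w) (s, 0) + B (0, w) (0, w)"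
      by (simp only: add)
    also have "\<dots> = B (s, 0) (s, 0) + 2 * (P s \<bullet> L w) + L w \<bullet> L w"
      using sym[of "(0, w)"] by (simp add: cross BL)
    finally show ?thesis
      by (simp add: R_def power2_norm_eq_inner inner_add_left inner_add_right inner_commute)
  qed
  moreover have "0 \<le> R s s" for s
    using psd[of "(s, - K (P s))"] by (simp add: expand linear_neg[OF L] LK)
  ultimately obtain N :: "'u \<Rightarrow> 'u" where N: "linear N" "\<And>s t. R s t = N s \<bullet> N t" by (metis psd_factor)
  show thesis
    by (rule that[OF N(1) P L surj BL]) (simp add: expand N(2) power2_norm_eq_inner)
qed

section \<open>Limits under conditioning\<close>

definition ramp :: "real \<Rightarrow> real \<Rightarrow> real \<Rightarrow> real" where
  "ramp a d s = max 0 (min 1 (1 - (s - a) / d))"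

definition tent :: "real \<Rightarrow> real \<Rightarrow> real \<Rightarrow> real" where
  "tent a d s = max 0 (min 1 (2 - \<bar>s - a\<bar> / d))"

lemma ramp_approx:
  assumes "0 < d"
  shows "\<bar>of_bool (s' \<le> a) - ramp a d s\<bar> \<le> tent a d s + 2 * \<bar>s' - s\<bar> / d"
proof -
  have lip_r: "\<bar>ramp a d s' - ramp a d s\<bar> \<le> \<bar>s' - s\<bar> / d"
  proof -
    have "\<bar>max 0 (min 1 x) - max 0 (min 1 y)\<bar> \<le> \<bar>x - y\<bar>" for x y :: real by linarith
    from this[of "1 - (s' - a) / d" "1 - (s - a) / d"]
    have "\<bar>ramp a d s' - ramp a d s\<bar> \<le> \<bar>(s - s') / d\<bar>" by (simp add: ramp_def diff_divide_distrib)
    then show ?thesis using assms by (simp add: abs_minus_commute)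
  qed
  have lip_t: "\<bar>tent a d s' - tent a d s\<bar> \<le> \<bar>s' - s\<bar> / d"
  proof -
    have "\<bar>max 0 (min 1 x) - max 0 (min 1 y)\<bar> \<le> \<bar>x - y\<bar>" for x y :: real by linarith
    from this[of "2 - \<bar>s' - a\<bar> / d" "2 - \<bar>s - a\<bar> / d"]
    have "\<bar>tent a d s' - tent a d s\<bar> \<le> \<bar>(\<bar>s - a\<bar> - \<bar>s' - a\<bar>) / d\<bar>" by (simp add: tent_def diff_divide_distrib)
    also have "\<dots> \<le> \<bar>s' - s\<bar> / d" using assms by (simp add: divide_right_mono)
    finally show ?thesis .
  qed
  have "\<bar>of_bool (s' \<le> a) - ramp a d s'\<bar> \<le> tent a d s'"
  proof (cases "s' \<le> a")
    case True
    then have "(s' - a) / d \<le> 0" using assms by (simp add: divide_nonpos_pos)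
    then show ?thesis using True by (simp add: ramp_def tent_def)
  next
    case False
    show ?thesis
    proof (cases "s' - a < d")
      case True
      then have "\<bar>s' - a\<bar> / d < 1" using False assms by simp
      then show ?thesis using False by (simp add: ramp_def tent_def)
    next
      case 2: False
      then have "1 \<le> (s' - a) / d" using assms by simp
      then show ?thesis using False by (simp add: ramp_def tent_def)
    qed
  qed
  then show ?thesis using lip_r lip_t by (simp add: add_divide_distrib)
qed

lemma tent_le_indicator: "0 < d \<Longrightarrow> tent a d s \<le> indicator {s. \<bar>s - a\<bar> \<le> 2 * d} s"
  by (auto simp: tent_def divide_simps split: split_indicator)

lemma conditional_limit:
  fixes \<Omega> :: "nat \<Rightarrow> 'z set" and U :: "nat \<Rightarrow> 'z \<Rightarrow> 'u::euclidean_space" and W :: "nat \<Rightarrow> 'z \<Rightarrow> 'w::euclidean_space"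
    and \<Lambda> :: "('u \<times> 'w) measure" and qm :: "nat \<Rightarrow> 'w \<Rightarrow> real" and h :: "'u \<Rightarrow> real"
  assumes \<Omega>: "\<And>m. finite (\<Omega> m)" "\<And>m. \<Omega> m \<noteq> {}"
    and wc: "weak_conv_to (\<lambda>m. distr (measure_pmf (pmf_of_set (\<Omega> m))) borel (\<lambda>Z. (U m Z, W m Z))) \<Lambda>"
    and mom: "\<And>m. (\<integral>Z. (norm (W m Z))\<^sup>2 \<partial>measure_pmf (pmf_of_set (\<Omega> m))) \<le> C"
    and q: "continuous_on UNIV q" and qm: "\<And>m w. \<bar>qm m w - q w\<bar> \<le> \<kappa> m * (norm w)\<^sup>2" and \<kappa>: "\<kappa> \<longlonglongrightarrow> 0"
    and null: "\<And>e. 0 < e \<Longrightarrow> \<exists>d>0. measure \<Lambda> {z. \<bar>q (snd z) - a\<bar> \<le> 2 * d} \<le> e"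
    and h: "continuous_on UNIV h" "bounded (range h)"
  shows "(\<lambda>m. \<integral>Z. h (U m Z) * of_bool (qm m (W m Z) \<le> a) \<partial>measure_pmf (pmf_of_set (\<Omega> m)))
    \<longlonglongrightarrow> (\<integral>z. h (fst z) * of_bool (q (snd z) \<le> a) \<partial>\<Lambda>)"
proof -
  interpret prob_space \<Lambda> using wc by (simp add: weak_conv_to_def)
  have sets[measurable_cong]: "sets \<Lambda> = sets borel" using wc by (simp add: weak_conv_to_def)
  obtain B where B: "\<And>x. \<bar>h x\<bar> \<le> B" using h(2) by (auto simp: bounded_iff)
  have B0: "0 \<le> B" using B[of 0] by linarith
  have C0: "0 \<le> C" using mom[of 0] by (meson Bochner_Integration.integral_nonneg order_trans zero_le_power2)
  have \<kappa>0: "0 \<le> \<kappa> m" for m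
  proof -
    have "0 \<le> \<bar>qm m One - q One\<bar>" by simp
    also have "\<dots> \<le> \<kappa> m * (norm (One :: 'w))\<^sup>2" by (rule qm)
    finally show ?thesis by (simp add: zero_le_mult_iff)
  qed
  let ?P = "\<lambda>m. measure_pmf (pmf_of_set (\<Omega> m))"
  have int: "integrable (?P m) f" for m and f :: "'z \<Rightarrow> real"
    using \<Omega> by (intro integrable_measure_pmf_finite) (simp add: set_pmf_of_set)
  have [measurable]: "h \<in> borel_measurable borel" "q \<in> borel_measurable borel"
    using h(1) q by (auto intro: borel_measurable_continuous_onI)
  have conv: "(\<lambda>m. \<integral>Z. f (U m Z, W m Z) \<partial>?P m) \<longlonglongrightarrow> (\<integral>z. f z \<partial>\<Lambda>)"
    if f: "continuous_on UNIV f" "bounded (range f)" for f :: "'u \<times> 'w \<Rightarrow> real"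
  proof -
    have [measurable]: "f \<in> borel_measurable borel" using f(1) by (rule borel_measurable_continuous_onI)
    have "(\<lambda>m. \<integral>z. f z \<partial>distr (?P m) borel (\<lambda>Z. (U m Z, W m Z))) \<longlonglongrightarrow> (\<integral>z. f z \<partial>\<Lambda>)"
      using wc f by (simp add: weak_conv_to_def)
    then show ?thesis by (simp add: integral_distr)
  qed
  have cq: "continuous_on UNIV (\<lambda>z::'u \<times> 'w. q (snd z))"
    by (rule continuous_on_compose2[OF q]) (auto intro!: continuous_intros)
  have ch: "continuous_on UNIV (\<lambda>z::'u \<times> 'w. h (fst z))"
    by (rule continuous_on_compose2[OF h(1)]) (auto intro!: continuous_intros)
  show ?thesis
  proof (rule LIMSEQ_I)
    fix \<epsilon> :: real assume \<epsilon>: "0 < \<epsilon>"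
    define e where "e = \<epsilon> / (4 * B + 4)"
    have e: "0 < e" using \<epsilon> B0 by (simp add: e_def)
    have e_eq: "(4 * B + 4) * e = \<epsilon>" using B0 by (simp add: e_def)
    obtain d where d: "0 < d" and nd: "measure \<Lambda> {z. \<bar>q (snd z) - a\<bar> \<le> 2 * d} \<le> e" using null[OF e] by blast
    have ct: "continuous_on UNIV (tent a d)" and cr: "continuous_on UNIV (ramp a d)"
      unfolding tent_def ramp_def using d by (auto intro!: continuous_intros)
    have tent01: "0 \<le> tent a d s" "tent a d s \<le> 1" and ramp01: "0 \<le> ramp a d s" "ramp a d s \<le> 1" for s
      by (auto simp: tent_def ramp_def)
    have [measurable]: "tent a d \<in> borel_measurable borel" "ramp a d \<in> borel_measurable borel"
      using ct cr by (auto intro: borel_measurable_continuous_onI)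
    define F where "F z = h (fst z) * ramp a d (q (snd z))" for z :: "'u \<times> 'w"
    define G where "G z = tent a d (q (snd z))" for z :: "'u \<times> 'w"
    have [measurable]: "F \<in> borel_measurable borel" "G \<in> borel_measurable borel"
      unfolding F_def[abs_def] G_def[abs_def] by (auto simp: borel_prod[symmetric])
    have cF: "continuous_on UNIV F" and cG: "continuous_on UNIV G"
      unfolding F_def G_def by (intro continuous_intros ch continuous_on_compose2[OF cr cq] continuous_on_compose2[OF ct cq]; simp)+
    have FB: "\<bar>F z\<bar> \<le> B" for z
      unfolding F_def abs_mult using mult_mono[OF B, of "\<bar>ramp a d (q (snd z))\<bar>" 1 "fst z"] ramp01[of "q (snd z)"] B0 by simp
    have GB: "\<bar>G z\<bar> \<le> 1" for z using tent01[of "q (snd z)"] by (simp add: G_def)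
    have lF: "(\<lambda>m. \<integral>Z. F (U m Z, W m Z) \<partial>?P m) \<longlonglongrightarrow> (\<integral>z. F z \<partial>\<Lambda>)"
      using FB by (intro conv cF) (auto simp: bounded_iff)
    have lG: "(\<lambda>m. \<integral>Z. G (U m Z, W m Z) \<partial>?P m) \<longlonglongrightarrow> (\<integral>z. G z \<partial>\<Lambda>)"
      using GB by (intro conv cG) (auto simp: bounded_iff)
    have [measurable]: "(\<lambda>z::'u \<times> 'w. h (fst z) * of_bool (q (snd z) \<le> a)) \<in> borel_measurable borel"
      unfolding borel_prod[symmetric] by measurable
    have [measurable]: "{z::'u \<times> 'w. \<bar>q (snd z) - a\<bar> \<le> 2 * d} \<in> sets borel"
      by (intro borel_closed closed_Collect_le continuous_intros cq)
    have iG: "integrable \<Lambda> G" "integrable \<Lambda> F" "integrable \<Lambda> (\<lambda>z. h (fst z) * of_bool (q (snd z) \<le> a))"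
      "integrable \<Lambda> (\<lambda>z. indicator {z. \<bar>q (snd z) - a\<bar> \<le> 2 * d} z :: real)"
    proof -
      show "integrable \<Lambda> G" by (rule integrable_const_bound[where B=1]) (use GB in auto)
      show "integrable \<Lambda> F" by (rule integrable_const_bound[where B=B]) (use FB in auto)
      show "integrable \<Lambda> (\<lambda>z. h (fst z) * of_bool (q (snd z) \<le> a))"
        by (rule integrable_const_bound[where B=B]) (use B B0 in \<open>auto simp: abs_mult\<close>)
      show "integrable \<Lambda> (\<lambda>z. indicator {z. \<bar>q (snd z) - a\<bar> \<le> 2 * d} z :: real)"
        by (rule integrable_const_bound[where B=1]) (auto split: split_indicator)
    qed
    have Ge: "(\<integral>z. G z \<partial>\<Lambda>) \<le> e"
    proof -
      have "(\<integral>z. G z \<partial>\<Lambda>) \<le> (\<integral>z. indicator {z. \<bar>q (snd z) - a\<bar> \<le> 2 * d} z \<partial>\<Lambda>)"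
        by (rule integral_mono[OF iG(1,4)]) (use tent_le_indicator[OF d] in \<open>simp add: G_def indicator_def\<close>)
      also have "\<dots> = measure \<Lambda> {z. \<bar>q (snd z) - a\<bar> \<le> 2 * d}" by (simp add: sets_eq_imp_space_eq[OF sets])
      finally show ?thesis using nd by simp
    qed
    have lim: "\<bar>(\<integral>z. h (fst z) * of_bool (q (snd z) \<le> a) \<partial>\<Lambda>) - (\<integral>z. F z \<partial>\<Lambda>)\<bar> \<le> B * e"
    proof -
      have "\<bar>(\<integral>z. h (fst z) * of_bool (q (snd z) \<le> a) \<partial>\<Lambda>) - (\<integral>z. F z \<partial>\<Lambda>)\<bar>
        = \<bar>\<integral>z. h (fst z) * of_bool (q (snd z) \<le> a) - F z \<partial>\<Lambda>\<bar>" using iG by simp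
      also have "\<dots> \<le> (\<integral>z. \<bar>h (fst z) * of_bool (q (snd z) \<le> a) - F z\<bar> \<partial>\<Lambda>)" by (rule integral_abs_bound)
      also have "\<dots> \<le> (\<integral>z. B * G z \<partial>\<Lambda>)"
      proof (rule integral_mono)
        fix z
        have "\<bar>h (fst z) * of_bool (q (snd z) \<le> a) - F z\<bar> = \<bar>h (fst z)\<bar> * \<bar>of_bool (q (snd z) \<le> a) - ramp a d (q (snd z))\<bar>"
          unfolding F_def by (simp add: right_diff_distrib flip: abs_mult)
        also have "\<dots> \<le> B * G z"
          using ramp_approx[OF d, of "q (snd z)" a "q (snd z)"] B B0 by (intro mult_mono) (auto simp: G_def)
        finally show "\<bar>h (fst z) * of_bool (q (snd z) \<le> a) - F z\<bar> \<le> B * G z" .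
      qed (use iG in auto)
      also have "\<dots> \<le> B * e" using Ge B0 by (simp add: mult_left_mono)
      finally show ?thesis .
    qed
    have fin: "\<bar>(\<integral>Z. h (U m Z) * of_bool (qm m (W m Z) \<le> a) \<partial>?P m) - (\<integral>Z. F (U m Z, W m Z) \<partial>?P m)\<bar>
      \<le> B * ((\<integral>Z. G (U m Z, W m Z) \<partial>?P m) + (2 / d) * (\<kappa> m * C))" for m
    proof -
      have "\<bar>(\<integral>Z. h (U m Z) * of_bool (qm m (W m Z) \<le> a) \<partial>?P m) - (\<integral>Z. F (U m Z, W m Z) \<partial>?P m)\<bar>
        = \<bar>\<integral>Z. h (U m Z) * of_bool (qm m (W m Z) \<le> a) - F (U m Z, W m Z) \<partial>?P m\<bar>" using int by simp
      also have "\<dots> \<le> (\<integral>Z. \<bar>h (U m Z) * of_bool (qm m (W m Z) \<le> a) - F (U m Z, W m Z)\<bar> \<partial>?P m)" by (rule integral_abs_bound)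
      also have "\<dots> \<le> (\<integral>Z. B * (G (U m Z, W m Z) + (2 / d) * (\<kappa> m * (norm (W m Z))\<^sup>2)) \<partial>?P m)"
      proof (rule integral_mono)
        fix Z
        have "\<bar>h (U m Z) * of_bool (qm m (W m Z) \<le> a) - F (U m Z, W m Z)\<bar>
          = \<bar>h (U m Z)\<bar> * \<bar>of_bool (qm m (W m Z) \<le> a) - ramp a d (q (W m Z))\<bar>"
          unfolding F_def by (simp add: right_diff_distrib flip: abs_mult)
        also have "\<dots> \<le> B * (G (U m Z, W m Z) + (2 / d) * (\<kappa> m * (norm (W m Z))\<^sup>2))"
        proof (rule mult_mono[OF B])
          have "\<bar>of_bool (qm m (W m Z) \<le> a) - ramp a d (q (W m Z))\<bar> \<le> tent a d (q (W m Z)) + (2 / d) * \<bar>qm m (W m Z) - q (W m Z)\<bar>"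
            using ramp_approx[OF d, of "qm m (W m Z)" a "q (W m Z)"] by simp
          also have "\<dots> \<le> tent a d (q (W m Z)) + (2 / d) * (\<kappa> m * (norm (W m Z))\<^sup>2)"
            using qm d by (intro add_left_mono mult_left_mono) auto
          finally show "\<bar>of_bool (qm m (W m Z) \<le> a) - ramp a d (q (W m Z))\<bar> \<le> G (U m Z, W m Z) + (2 / d) * (\<kappa> m * (norm (W m Z))\<^sup>2)"
            by (simp add: G_def)
        qed (use B0 in auto)
        finally show "\<bar>h (U m Z) * of_bool (qm m (W m Z) \<le> a) - F (U m Z, W m Z)\<bar>
          \<le> B * (G (U m Z, W m Z) + (2 / d) * (\<kappa> m * (norm (W m Z))\<^sup>2))" .
      qed (rule int)+
      also have "\<dots> = B * ((\<integral>Z. G (U m Z, W m Z) \<partial>?P m) + (2 / d) * (\<kappa> m * (\<integral>Z. (norm (W m Z))\<^sup>2 \<partial>?P m)))"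
        using int by (simp del: times_divide_eq_left)
      also have "\<dots> \<le> B * ((\<integral>Z. G (U m Z, W m Z) \<partial>?P m) + (2 / d) * (\<kappa> m * C))"
        using mom[of m] \<kappa>0[of m] d B0 by (intro mult_left_mono add_left_mono) auto
      finally show ?thesis .
    qed
    have "(\<lambda>m. B * ((\<integral>Z. G (U m Z, W m Z) \<partial>?P m) + (2 / d) * (\<kappa> m * C))) \<longlonglongrightarrow> B * ((\<integral>z. G z \<partial>\<Lambda>) + (2 / d) * (0 * C))"
      by (intro tendsto_intros lG \<kappa>)
    moreover have "B * ((\<integral>z. G z \<partial>\<Lambda>) + (2 / d) * (0 * C)) < B * e + e"
      using mult_left_mono[OF Ge B0] e by simp
    ultimately have ev1: "\<forall>\<^sub>F m in sequentially. B * ((\<integral>Z. G (U m Z, W m Z) \<partial>?P m) + (2 / d) * (\<kappa> m * C)) < B * e + e"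
      by (rule order_tendstoD)
    have ev2: "\<forall>\<^sub>F m in sequentially. dist (\<integral>Z. F (U m Z, W m Z) \<partial>?P m) (\<integral>z. F z \<partial>\<Lambda>) < e"
      using lF e by (rule tendstoD)
    have "\<forall>\<^sub>F m in sequentially. norm ((\<integral>Z. h (U m Z) * of_bool (qm m (W m Z) \<le> a) \<partial>?P m) - (\<integral>z. h (fst z) * of_bool (q (snd z) \<le> a) \<partial>\<Lambda>)) < \<epsilon>"
      using ev1 ev2
    proof eventually_elim
      case (elim m)
      have "B * e + e + e + B * e < (4 * B + 4) * e" using e B0 by (simp add: algebra_simps add_pos_nonneg)
      then have "B * e + e + e + B * e < \<epsilon>" by (simp only: e_eq)
      then show ?case using elim fin[of m] lim unfolding dist_real_def real_norm_def by linarith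
    qed
    then show "\<exists>no. \<forall>m\<ge>no. norm ((\<integral>Z. h (U m Z) * of_bool (qm m (W m Z) \<le> a) \<partial>?P m) - (\<integral>z. h (fst z) * of_bool (q (snd z) \<le> a) \<partial>\<Lambda>)) < \<epsilon>"
      by (simp add: eventually_sequentially)
  qed
qed

lemma gauss_null_level:
  assumes "0 < e" "0 < a"
  shows "\<exists>d>0. measure gauss {y::'a::euclidean_space. \<bar>(norm y)\<^sup>2 - a\<bar> \<le> 2 * d} \<le> e"
proof -
  interpret G: prob_space "gauss :: 'a measure" by (rule gauss_prob)
  define S where "S n = {y::'a. \<bar>(norm y)\<^sup>2 - a\<bar> \<le> 1 / real (Suc n)}" for n
  have S[measurable]: "S n \<in> sets borel" for n unfolding S_def by measurable
  have "(\<lambda>n. measure gauss (S n)) \<longlonglongrightarrow> measure gauss (\<Inter>n. S n)"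
  proof (rule G.finite_Lim_measure_decseq)
    show "decseq S"
      unfolding decseq_Suc_iff S_def
    proof (intro allI subsetI)
      fix n and y :: 'a assume "y \<in> {y. \<bar>(norm y)\<^sup>2 - a\<bar> \<le> 1 / real (Suc (Suc n))}"
      moreover have "1 / real (Suc (Suc n)) \<le> 1 / real (Suc n)" by (intro divide_left_mono) auto
      ultimately show "y \<in> {y. \<bar>(norm y)\<^sup>2 - a\<bar> \<le> 1 / real (Suc n)}" by simp
    qed
  qed (use S in auto)
  also have "measure gauss (\<Inter>n. S n) = 0"
  proof -
    have "(\<Inter>n. S n) \<subseteq> sphere (0::'a) (sqrt a)"
    proof
      fix y assume y: "y \<in> (\<Inter>n. S n)"
      have "\<bar>(norm y)\<^sup>2 - a\<bar> \<le> 0"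
      proof (rule LIMSEQ_le_const)
        show "(\<lambda>n. 1 / real (Suc n)) \<longlonglongrightarrow> 0" by (rule LIMSEQ_Suc[OF lim_1_over_n])
      qed (use y in \<open>auto simp: S_def\<close>)
      then have "(norm y)\<^sup>2 = a" by simp
      then show "y \<in> sphere 0 (sqrt a)" by (auto simp: dist_norm intro: real_sqrt_unique[symmetric])
    qed
    moreover have "sphere (0::'a) (sqrt a) \<in> null_sets gauss"
    proof -
      have [measurable]: "sphere (0::'a) (sqrt a) \<in> sets borel" by (simp add: borel_closed)
      have "sphere (0::'a) (sqrt a) \<in> null_sets lborel"
        using negligible_sphere[of "0::'a" "sqrt a"] by (auto simp: null_sets_completion_iff negligible_iff_null_sets)
      then have "AE x in lborel. x \<notin> sphere (0::'a) (sqrt a)" by (rule AE_not_in)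
      then have "AE x in lborel. x \<in> sphere (0::'a) (sqrt a) \<longrightarrow> ennreal (gauss_const TYPE('a) * exp (- (norm x)\<^sup>2 / 2)) = 0"
        by (rule eventually_mono) blast
      then show ?thesis unfolding gauss_density
        by (subst null_sets_density_iff) simp_all
    qed
    moreover have "(\<Inter>n. S n) \<in> sets gauss" by (simp add: sets.countable_INT'' S)
    ultimately have "(\<Inter>n. S n) \<in> null_sets gauss" using null_sets_subset by blast
    then show ?thesis by (simp add: measure_eq_0_null_sets)
  qed
  finally have "\<forall>\<^sub>F n in sequentially. measure gauss (S n) < e" using assms(1) by (rule order_tendstoD)
  then obtain n where "measure gauss (S n) < e" by (auto simp: eventually_sequentially)
  moreover have "2 * (1 / (2 * real (Suc n))) = 1 / real (Suc n)" by (simp add: field_simps)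
  ultimately have "measure gauss {y::'a. \<bar>(norm y)\<^sup>2 - a\<bar> \<le> 2 * (1 / (2 * real (Suc n)))} \<le> e"
    unfolding S_def by (simp only: less_imp_le)
  then show ?thesis by (intro exI[of _ "1 / (2 * real (Suc n))"]) simp
qed

lemma gauss_cball_pos:
  assumes "0 < r"
  shows "0 < measure gauss (cball (0::'a::euclidean_space) r)"
proof -
  interpret G: prob_space "gauss :: 'a measure" by (rule gauss_prob)
  have "cball (0::'a) r \<notin> null_sets gauss"
  proof
    assume "cball (0::'a) r \<in> null_sets gauss"
    then have "AE x in lborel. x \<in> cball (0::'a) r \<longrightarrow> gauss_const TYPE('a) * exp (- (norm x)\<^sup>2 / 2) \<le> 0"
      unfolding gauss_density by (subst (asm) null_sets_density_iff) (auto simp: ennreal_eq_0_iff)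
    then have "AE x in lborel. x \<notin> cball (0::'a) r"
      using gauss_const_pos[where 'a='a] by (auto simp: mult_le_0_iff)
    then have "emeasure lborel (cball (0::'a) r) = 0" by (subst (asm) AE_iff_measurable[of "cball 0 r"]) auto
    then show False using content_cball_pos[OF assms, of "0::'a"] by (simp add: measure_def)
  qed
  then have "measure gauss (cball (0::'a) r) \<noteq> 0"
    by (simp add: null_sets_def G.emeasure_eq_measure)
  then show ?thesis by (simp add: less_le)
qed

lemma integral_gauss_pair_iexp:
  fixes s :: "'u::euclidean_space" and t :: "'w::euclidean_space"
  shows "(\<integral>z. iexp (s \<bullet> fst z + t \<bullet> snd z) \<partial>(gauss \<Otimes>\<^sub>M gauss)) = of_real (exp (- ((norm s)\<^sup>2 + (norm t)\<^sup>2) / 2))"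
proof -
  interpret A: prob_space "gauss :: 'u measure" by (rule gauss_prob)
  interpret B: prob_space "gauss :: 'w measure" by (rule gauss_prob)
  interpret AB: pair_prob_space "gauss :: 'u measure" "gauss :: 'w measure" ..
  have "integrable (gauss \<Otimes>\<^sub>M gauss) (\<lambda>z. iexp (s \<bullet> fst z + t \<bullet> snd z))"
    by (rule AB.integrable_const_bound[where B=1]) auto
  then have "(\<integral>z. iexp (s \<bullet> fst z + t \<bullet> snd z) \<partial>(gauss \<Otimes>\<^sub>M gauss)) = (\<integral>x. \<integral>y. iexp (s \<bullet> x + t \<bullet> y) \<partial>gauss \<partial>gauss)"
    by (subst AB.integral_fst'[symmetric]) auto
  also have "\<dots> = (\<integral>x. \<integral>y. iexp (s \<bullet> x) * iexp (t \<bullet> y) \<partial>gauss \<partial>gauss)"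
    by (simp add: distrib_left exp_add)
  also have "\<dots> = of_real (exp (- (norm s)\<^sup>2 / 2)) * of_real (exp (- (norm t)\<^sup>2 / 2))"
    using gauss_char[of s] gauss_char[of t] by simp
  finally show ?thesis by (simp add: add_divide_distrib flip: of_real_mult exp_add)
qed

lemma gauss_pair_peaked:
  fixes N :: "'u::euclidean_space \<Rightarrow> 'v::euclidean_space" and P :: "'w::euclidean_space \<Rightarrow> 'v"
  assumes N: "linear N" and P: "linear P" and [measurable]: "C \<in> sets borel" and C: "convex C" "uminus ` C = C" and "0 < \<rho>"
  shows "measure gauss (cball (0::'w) \<rho>) * measure (gauss \<Otimes>\<^sub>M gauss) {z. N (fst z) + P (snd z) \<in> C}
    \<le> measure (gauss \<Otimes>\<^sub>M gauss) {z. N (fst z) + P (snd z) \<in> C \<and> snd z \<in> cball 0 \<rho>}"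
proof -
  interpret A: prob_space "gauss :: 'u measure" by (rule gauss_prob)
  interpret B: prob_space "gauss :: 'w measure" by (rule gauss_prob)
  interpret AB: pair_prob_space "gauss :: 'u measure" "gauss :: 'w measure" ..
  note [measurable] = borel_measurable_linear[OF N] borel_measurable_linear[OF P]
  define H where "H y = measure gauss {x. N x + P y \<in> C}" for y
  have H_int: "H y = (\<integral>x. indicator C (N x + P y) \<partial>gauss)" for y
  proof -
    have "H y = (\<integral>x. indicator {x. N x + P y \<in> C} x \<partial>gauss)" unfolding H_def by simp
    then show ?thesis by (simp add: indicator_def)
  qed
  have mH[measurable]: "H \<in> borel_measurable borel"
  proof -
    have "(\<lambda>y. \<integral>x. (indicator C (N x + P y) :: real) \<partial>(gauss :: 'u measure)) \<in> borel_measurable (gauss :: 'w measure)"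
      by (rule A.borel_measurable_lebesgue_integral) measurable
    then show ?thesis by (simp add: H_int[abs_def] cong: measurable_cong_sets)
  qed
  have sp: "space (gauss \<Otimes>\<^sub>M gauss) = (UNIV :: ('u \<times> 'w) set)" by (simp add: space_pair_measure)
  have fub: "measure (gauss \<Otimes>\<^sub>M gauss) {z. N (fst z) + P (snd z) \<in> C \<and> snd z \<in> D} = (\<integral>y. H y * indicator D y \<partial>gauss)"
    if [measurable]: "D \<in> sets borel" for D :: "'w set"
  proof -
    let ?f = "\<lambda>x y. indicator C (N x + P y) * indicator D y :: real"
    have i: "integrable (gauss \<Otimes>\<^sub>M gauss) (case_prod ?f)"
      by (rule AB.integrable_const_bound[where B=1]) (auto split: split_indicator)
    have "measure (gauss \<Otimes>\<^sub>M gauss) {z. N (fst z) + P (snd z) \<in> C \<and> snd z \<in> D}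
      = (\<integral>z. indicator {z. N (fst z) + P (snd z) \<in> C \<and> snd z \<in> D} z \<partial>(gauss \<Otimes>\<^sub>M gauss))"
      by (simp add: sp)
    also have "\<dots> = integral\<^sup>L (gauss \<Otimes>\<^sub>M gauss) (case_prod ?f)"
      by (rule Bochner_Integration.integral_cong) (auto simp: indicator_def)
    also have "\<dots> = (\<integral>y. \<integral>x. ?f x y \<partial>gauss \<partial>gauss)" by (rule AB.integral_snd[OF i, symmetric])
    also have "\<dots> = (\<integral>y. H y * indicator D y \<partial>gauss)" by (simp add: H_int)
    finally show ?thesis .
  qed
  have "measure gauss (cball (0::'w) \<rho>) * (\<integral>y. H y \<partial>gauss) \<le> (\<integral>y. H y * indicator (cball 0 \<rho>) y \<partial>gauss)"
  proof (rule gauss_ball_le_radial)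
    show "H y \<le> H (r *\<^sub>R y)" if "0 \<le> r" "r \<le> 1" for y r
      unfolding H_def linear_scale[OF P] by (rule anderson_gauss[OF N _ C that]) simp
  qed (use \<open>0 < \<rho>\<close> in \<open>auto simp: H_def\<close>)
  then show ?thesis using fub[of UNIV] fub[of "cball 0 \<rho>"] by simp
qed

theorem peaked_conditional_limit:
  fixes \<Omega> :: "nat \<Rightarrow> 'z set" and U :: "nat \<Rightarrow> 'z \<Rightarrow> 'u::euclidean_space" and W :: "nat \<Rightarrow> 'z \<Rightarrow> 'w::euclidean_space"
    and B :: "'u \<times> 'w \<Rightarrow> 'u \<times> 'w \<Rightarrow> real" and qm :: "nat \<Rightarrow> 'w \<Rightarrow> real"
  assumes \<Omega>: "\<And>m. finite (\<Omega> m)" "\<And>m. \<Omega> m \<noteq> {}"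
    and B: "bilinear B" "\<And>s t. B s t = B t s" "\<And>s. 0 \<le> B s s" and pd: "\<And>w. B (0, w) (0, w) = 0 \<Longrightarrow> w = 0"
    and char: "\<And>t. (\<lambda>m. \<integral>Z. iexp (t \<bullet> (U m Z, W m Z)) \<partial>measure_pmf (pmf_of_set (\<Omega> m))) \<longlonglongrightarrow> of_real (exp (- B t t / 2))"
    and mom: "\<And>m. (\<integral>Z. (norm (U m Z, W m Z))\<^sup>2 \<partial>measure_pmf (pmf_of_set (\<Omega> m))) \<le> C"
    and q: "continuous_on UNIV q" and qm: "\<And>m w. \<bar>qm m w - q w\<bar> \<le> \<kappa> m * (norm w)\<^sup>2" and \<kappa>: "\<kappa> \<longlonglongrightarrow> 0"
    and q_dual: "\<And>u w. (\<And>u'. B (0, u) (0, u') = w \<bullet> u') \<Longrightarrow> q w = B (0, u) (0, u)"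
    and a: "0 < a"
  shows "\<exists>\<phi> \<psi>.
      weak_conv_to (\<lambda>m. distr (measure_pmf (pmf_of_set {Z \<in> \<Omega> m. qm m (W m Z) \<le> a})) borel (U m)) \<phi>
    \<and> weak_conv_to (\<lambda>m. distr (measure_pmf (pmf_of_set (\<Omega> m))) borel (U m)) \<psi>
    \<and> (\<forall>D. D \<in> sets borel \<and> convex D \<and> uminus ` D = D \<longrightarrow> measure \<phi> D \<ge> measure \<psi> D)"
proof -
  obtain N :: "'u \<Rightarrow> 'u" and P :: "'u \<Rightarrow> 'w" and L :: "'w \<Rightarrow> 'w"
    where lin: "linear N" "linear P" "linear L" and "surj L"
      and BL: "\<And>w w'. B (0, w) (0, w') = L w \<bullet> L w'"
      and BN: "\<And>s w. B (s, w) (s, w) = (norm (N s))\<^sup>2 + (norm (P s + L w))\<^sup>2"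
    using psd_block_factor[OF B pd] by blast
  interpret A: prob_space "gauss :: 'u measure" by (rule gauss_prob)
  interpret A': prob_space "gauss :: 'w measure" by (rule gauss_prob)
  interpret AB: pair_prob_space "gauss :: 'u measure" "gauss :: 'w measure" ..
  define \<mu> where "\<mu> = (gauss \<Otimes>\<^sub>M gauss :: ('u \<times> 'w) measure)"
  interpret \<mu>: prob_space \<mu> unfolding \<mu>_def by unfold_locales
  have sets_\<mu>[measurable_cong]: "sets \<mu> = sets (borel \<Otimes>\<^sub>M borel)" unfolding \<mu>_def by (rule sets_pair_measure_cong) auto
  have sp_\<mu>: "space \<mu> = UNIV" by (simp add: \<mu>_def space_pair_measure)
  note [measurable] = borel_measurable_linear[OF adjoint_linear[OF lin(1)]]
    borel_measurable_linear[OF adjoint_linear[OF lin(2)]] borel_measurable_linear[OF adjoint_linear[OF lin(3)]]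
  define u where "u z = adjoint N (fst z) + adjoint P (snd z)" for z
  define w where "w z = adjoint L (snd z)" for z :: "'u \<times> 'w"
  have [measurable]: "u \<in> borel_measurable \<mu>" "w \<in> borel_measurable \<mu>"
    unfolding u_def[abs_def] w_def[abs_def] by measurable
  have [measurable]: "(\<lambda>z. (u z, w z)) \<in> borel_measurable \<mu>" unfolding borel_prod[symmetric] by measurable
  have [measurable]: "q \<in> borel_measurable borel" using q by (rule borel_measurable_continuous_onI)
  have qw: "q (w z) = (norm (snd z))\<^sup>2" for z
  proof -
    obtain x where x: "L x = snd z" using \<open>surj L\<close> by (metis surjD)
    have "B (0, x) (0, x') = w z \<bullet> x'" for x'
      using adjoint_works[OF lin(3), of x' "snd z"] by (simp add: BL x w_def inner_commute)
    from q_dual[OF this] show ?thesis by (simp add: BL x power2_norm_eq_inner)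
  qed
  define \<Lambda> where "\<Lambda> = distr \<mu> borel (\<lambda>z. (u z, w z))"
  have \<Lambda>: "prob_space \<Lambda>" "sets \<Lambda> = sets borel" unfolding \<Lambda>_def by (auto intro!: \<mu>.prob_space_distr)
  have char_\<Lambda>: "(\<integral>z. iexp (t \<bullet> z) \<partial>\<Lambda>) = of_real (exp (- B t t / 2))" for t
  proof -
    obtain s v where t: "t = (s, v)" by fastforce
    have "(\<integral>z. iexp (t \<bullet> z) \<partial>\<Lambda>) = (\<integral>z. iexp (t \<bullet> (u z, w z)) \<partial>\<mu>)"
      unfolding \<Lambda>_def by (rule integral_distr) auto
    also have "\<dots> = (\<integral>z. iexp (N s \<bullet> fst z + (P s + L v) \<bullet> snd z) \<partial>\<mu>)"
      by (simp add: t u_def w_def inner_add_right adjoint_works[OF lin(1)] adjoint_works[OF lin(2)] adjoint_works[OF lin(3)]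
          inner_add_left add.assoc)
    also have "\<dots> = of_real (exp (- B t t / 2))"
      unfolding \<mu>_def integral_gauss_pair_iexp t BN ..
    finally show ?thesis .
  qed
  let ?P = "\<lambda>m. measure_pmf (pmf_of_set (\<Omega> m))"
  let ?M = "\<lambda>m. distr (?P m) borel (\<lambda>Z. (U m Z, W m Z))"
  have int: "integrable (?P m) f" for m and f :: "'z \<Rightarrow> real"
    using \<Omega> by (intro integrable_measure_pmf_finite) (simp add: set_pmf_of_set)
  have wc: "weak_conv_to ?M \<Lambda>"
  proof (rule char_tendsto_imp_weak_conv[OF _ _ \<Lambda>])
    show "prob_space (?M m)" for m by (rule prob_space.prob_space_distr) (auto intro: prob_space_measure_pmf)
    show "(\<lambda>m. \<integral>x. iexp (t \<bullet> x) \<partial>?M m) \<longlonglongrightarrow> (\<integral>x. iexp (t \<bullet> x) \<partial>\<Lambda>)" for t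
      unfolding char_\<Lambda> using char[of t] by (simp add: integral_distr)
    fix e :: real assume e: "0 < e"
    have C0: "0 \<le> C" using mom[of 0] by (meson Bochner_Integration.integral_nonneg order_trans zero_le_power2)
    define R where "R = sqrt ((C + 1) / e)"
    have R: "0 < R" "R\<^sup>2 = (C + 1) / e" using C0 e by (auto simp: R_def)
    have "measure (?M m) (- cball 0 R) \<le> e" for m
    proof -
      have "measure (?M m) (- cball 0 R) = measure (?P m) {Z. R < norm (U m Z, W m Z)}"
        by (subst measure_distr) (auto simp: vimage_def not_le)
      also have "\<dots> \<le> measure (?P m) {Z \<in> space (?P m). R\<^sup>2 \<le> (norm (U m Z, W m Z))\<^sup>2}"
        using R(1) by (intro measure_pmf.finite_measure_mono) (auto intro!: power_mono)
      also have "\<dots> \<le> (\<integral>Z. (norm (U m Z, W m Z))\<^sup>2 \<partial>?P m) / R\<^sup>2"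
        using R(1) by (intro integral_Markov_inequality_measure[where A="{}"] int) auto
      also have "\<dots> \<le> C / R\<^sup>2" using mom[of m] by (intro divide_right_mono) auto
      also have "\<dots> = C / (C + 1) * e" using C0 by (simp add: R(2))
      also have "\<dots> \<le> e" using C0 e by (intro mult_left_le_one_le) auto
      finally show ?thesis .
    qed
    then show "\<exists>R. \<forall>m. measure (?M m) (- cball 0 R) \<le> e" by blast
  qed auto
  define \<psi> where "\<psi> = distr \<mu> borel u"
  define S where "S = {z::'u \<times> 'w. snd z \<in> cball 0 (sqrt a)}"
  have S: "S \<in> sets \<mu>"
  proof -
    have "S = UNIV \<times> cball 0 (sqrt a)" by (auto simp: S_def)
    then show ?thesis unfolding sets_\<mu> by simp
  qed
  have S_iff: "z \<in> S \<longleftrightarrow> (norm (snd z))\<^sup>2 \<le> a" for z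
    using a by (simp add: S_def real_le_rsqrt real_sqrt_le_iff sqrt_le_D real_sqrt_abs flip: real_sqrt_le_iff[of "(norm (snd z))\<^sup>2"])
  define p where "p = measure \<mu> S"
  have p_eq: "p = measure gauss (cball (0::'w) (sqrt a))"
  proof -
    have "S = UNIV \<times> cball 0 (sqrt a)" by (auto simp: S_def)
    then have "emeasure \<mu> S = emeasure gauss (UNIV :: 'u set) * emeasure gauss (cball (0::'w) (sqrt a))"
      unfolding \<mu>_def by (simp add: A'.emeasure_pair_measure_Times)
    also have "emeasure gauss (UNIV :: 'u set) = 1" using A.emeasure_space_1 by simp
    finally show ?thesis by (simp add: p_def measure_def)
  qed
  have p: "0 < p" unfolding p_eq using a by (intro gauss_cball_pos) simp
  have eS: "emeasure \<mu> S \<noteq> 0" "emeasure \<mu> S \<noteq> \<infinity>" using p by (auto simp: p_def measure_def)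
  define \<nu> where "\<nu> = uniform_measure \<mu> S"
  interpret \<nu>: prob_space \<nu> unfolding \<nu>_def by (rule prob_space_uniform_measure[OF eS])
  have sets_\<nu>: "sets \<nu> = sets \<mu>" by (simp add: \<nu>_def)
  have [measurable]: "u \<in> borel_measurable \<nu>" using sets_\<nu> by (simp cong: measurable_cong_sets)
  define \<phi> where "\<phi> = distr \<nu> borel u"
  have int_\<nu>: "(\<integral>z. f z \<partial>\<nu>) = (\<integral>z. f z * of_bool ((norm (snd z))\<^sup>2 \<le> a) \<partial>\<mu>) / p"
    if [measurable]: "f \<in> borel_measurable \<mu>" for f :: "_ \<Rightarrow> real"
  proof -
    have "\<nu> = density \<mu> (\<lambda>z. ennreal (indicator S z / p))"
      unfolding \<nu>_def uniform_measure_def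
      by (rule density_cong) (use S p in \<open>auto simp: \<mu>.emeasure_eq_measure p_def divide_ennreal ennreal_1[symmetric] split: split_indicator simp del: ennreal_1\<close>)
    then have "(\<integral>z. f z \<partial>\<nu>) = (\<integral>z. indicator S z / p * f z \<partial>\<mu>)"
      using S p by (simp add: integral_density)
    also have "\<dots> = (\<integral>z. (f z * of_bool ((norm (snd z))\<^sup>2 \<le> a)) / p \<partial>\<mu>)"
      by (rule Bochner_Integration.integral_cong) (auto simp: indicator_def S_iff)
    finally show ?thesis by simp
  qed
  have null: "\<exists>d>0. measure \<Lambda> {z. \<bar>q (snd z) - a\<bar> \<le> 2 * d} \<le> e" if e: "0 < e" for e
  proof -
    obtain d where d: "0 < d" "measure gauss {y::'w. \<bar>(norm y)\<^sup>2 - a\<bar> \<le> 2 * d} \<le> e"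
      using gauss_null_level[OF e a] by blast
    have c: "continuous_on UNIV (\<lambda>z::'u \<times> 'w. q (snd z))"
      by (rule continuous_on_compose2[OF q]) (auto intro!: continuous_intros)
    have [measurable]: "{z::'u \<times> 'w. \<bar>q (snd z) - a\<bar> \<le> 2 * d} \<in> sets borel"
      by (intro borel_closed closed_Collect_le continuous_intros c)
    have "measure \<Lambda> {z. \<bar>q (snd z) - a\<bar> \<le> 2 * d} = measure \<mu> (UNIV \<times> {y. \<bar>(norm y)\<^sup>2 - a\<bar> \<le> 2 * d})"
      unfolding \<Lambda>_def by (subst measure_distr) (auto simp: qw sp_\<mu> intro!: arg_cong[where f="measure \<mu>"])
    also have "\<dots> = measure gauss {y::'w. \<bar>(norm y)\<^sup>2 - a\<bar> \<le> 2 * d}"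
      using A.emeasure_space_1 unfolding \<mu>_def measure_def
      by (subst A'.emeasure_pair_measure_Times) auto
    finally show ?thesis using d by auto
  qed
  have momW: "(\<integral>Z. (norm (W m Z))\<^sup>2 \<partial>?P m) \<le> C" for m
  proof (rule order_trans[OF integral_mono[OF int int] mom])
    show "(norm (W m Z))\<^sup>2 \<le> (norm (U m Z, W m Z))\<^sup>2" for Z
      using norm_snd_le[of "W m Z" "U m Z"] by (intro power_mono) auto
  qed
  have cond: "(\<lambda>m. \<integral>Z. h (U m Z) * of_bool (qm m (W m Z) \<le> a) \<partial>?P m) \<longlonglongrightarrow> (\<integral>z. h (u z) * of_bool ((norm (snd z))\<^sup>2 \<le> a) \<partial>\<mu>)"
    if h: "continuous_on UNIV h" "bounded (range h)" for h :: "'u \<Rightarrow> real"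
  proof -
    have [measurable]: "h \<in> borel_measurable borel" using h(1) by (rule borel_measurable_continuous_onI)
    have m: "(\<lambda>z::'u \<times> 'w. h (fst z) * of_bool (q (snd z) \<le> a)) \<in> borel_measurable borel"
      unfolding borel_prod[symmetric] by measurable
    have "(\<integral>z. h (fst z) * of_bool (q (snd z) \<le> a) \<partial>\<Lambda>) = (\<integral>z. h (u z) * of_bool ((norm (snd z))\<^sup>2 \<le> a) \<partial>\<mu>)"
      unfolding \<Lambda>_def by (subst integral_distr) (use m in \<open>auto simp: qw\<close>)
    then show ?thesis
      using conditional_limit[OF \<Omega> wc momW q qm \<kappa> null h] by simp
  qed
  have "weak_conv_to (\<lambda>m. distr (measure_pmf (pmf_of_set {Z \<in> \<Omega> m. qm m (W m Z) \<le> a})) borel (U m)) \<phi>"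
    unfolding weak_conv_to_def
  proof (intro conjI allI impI)
    show "prob_space \<phi>" unfolding \<phi>_def by (rule \<nu>.prob_space_distr) simp
    show "sets \<phi> = sets borel" by (simp add: \<phi>_def)
    fix h :: "'u \<Rightarrow> real" assume h: "continuous_on UNIV h \<and> bounded (range h)"
    then have [measurable]: "h \<in> borel_measurable borel" by (auto intro: borel_measurable_continuous_onI)
    define Num where "Num m = (\<integral>Z. h (U m Z) * of_bool (qm m (W m Z) \<le> a) \<partial>?P m)" for m
    define Den where "Den m = (\<integral>Z. (1::real) * of_bool (qm m (W m Z) \<le> a) \<partial>?P m)" for m
    have Num: "Num \<longlonglongrightarrow> (\<integral>z. h (u z) * of_bool ((norm (snd z))\<^sup>2 \<le> a) \<partial>\<mu>)"
      unfolding Num_def using h by (intro cond) auto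
    have "(\<integral>z. (1::real) * of_bool ((norm (snd z))\<^sup>2 \<le> a) \<partial>\<mu>) = (\<integral>z. indicator S z \<partial>\<mu>)"
      by (rule Bochner_Integration.integral_cong) (auto simp: indicator_def S_iff)
    also have "\<dots> = p" using S by (simp add: p_def sp_\<mu>)
    finally have Den: "Den \<longlonglongrightarrow> p"
      unfolding Den_def using cond[of "\<lambda>_. 1"] by simp
    have "(\<lambda>m. Num m / Den m) \<longlonglongrightarrow> (\<integral>z. h (u z) * of_bool ((norm (snd z))\<^sup>2 \<le> a) \<partial>\<mu>) / p"
      using p by (intro tendsto_divide Num Den) simp
    also have "(\<integral>z. h (u z) * of_bool ((norm (snd z))\<^sup>2 \<le> a) \<partial>\<mu>) / p = (\<integral>x. h x \<partial>\<phi>)"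
      unfolding \<phi>_def by (subst integral_distr) (auto simp: int_\<nu>)
    finally have lim: "(\<lambda>m. Num m / Den m) \<longlonglongrightarrow> (\<integral>x. h x \<partial>\<phi>)" .
    have "\<forall>\<^sub>F m in sequentially. 0 < Den m" using Den p by (rule order_tendstoD)
    then have "\<forall>\<^sub>F m in sequentially. Num m / Den m
        = (\<integral>x. h x \<partial>distr (measure_pmf (pmf_of_set {Z \<in> \<Omega> m. qm m (W m Z) \<le> a})) borel (U m))"
    proof eventually_elim
      case (elim m)
      define E where "E = {Z \<in> \<Omega> m. qm m (W m Z) \<le> a}"
      have fE: "finite E" using \<Omega>(1) by (simp add: E_def)
      have sum_E: "(\<integral>Z. f Z * of_bool (qm m (W m Z) \<le> a) \<partial>?P m) = (\<Sum>Z\<in>E. f Z) / real (card (\<Omega> m))" for f :: "'z \<Rightarrow> real"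
      proof -
        have "(\<integral>Z. f Z * of_bool (qm m (W m Z) \<le> a) \<partial>?P m) = (\<Sum>Z\<in>\<Omega> m. f Z * of_bool (qm m (W m Z) \<le> a)) / real (card (\<Omega> m))"
          using \<Omega> by (simp add: integral_pmf_of_set)
        also have "(\<Sum>Z\<in>\<Omega> m. f Z * of_bool (qm m (W m Z) \<le> a)) = (\<Sum>Z\<in>E. f Z)"
          unfolding E_def using \<Omega>(1) by (intro sum.mono_neutral_cong_right) auto
        finally show ?thesis .
      qed
      have card\<Omega>: "0 < card (\<Omega> m)" using \<Omega> by (simp add: card_gt_0_iff)
      have "Den m = real (card E) / real (card (\<Omega> m))" unfolding Den_def sum_E by simp
      then have neE: "E \<noteq> {}" using elim by auto
      have "Num m / Den m = (\<Sum>Z\<in>E. h (U m Z)) / real (card E)"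
        unfolding Num_def Den_def sum_E using card\<Omega> by simp
      also have "\<dots> = (\<integral>Z. h (U m Z) \<partial>measure_pmf (pmf_of_set E))"
        using fE neE by (simp add: integral_pmf_of_set)
      finally show ?case unfolding E_def by (simp add: integral_distr)
    qed
    with lim show "(\<lambda>m. \<integral>x. h x \<partial>distr (measure_pmf (pmf_of_set {Z \<in> \<Omega> m. qm m (W m Z) \<le> a})) borel (U m)) \<longlonglongrightarrow> (\<integral>x. h x \<partial>\<phi>)"
      by (rule Lim_transform_eventually)
  qed
  moreover have "weak_conv_to (\<lambda>m. distr (?P m) borel (U m)) \<psi>"
    unfolding weak_conv_to_def
  proof (intro conjI allI impI)
    show "prob_space \<psi>" unfolding \<psi>_def by (rule \<mu>.prob_space_distr) simp
    show "sets \<psi> = sets borel" by (simp add: \<psi>_def)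
    fix h :: "'u \<Rightarrow> real" assume h: "continuous_on UNIV h \<and> bounded (range h)"
    then have [measurable]: "h \<in> borel_measurable borel" by (auto intro: borel_measurable_continuous_onI)
    have c: "continuous_on UNIV (\<lambda>z::'u \<times> 'w. h (fst z))"
      by (rule continuous_on_compose2[of UNIV h]) (use h in \<open>auto intro!: continuous_intros\<close>)
    have [measurable]: "(\<lambda>z::'u \<times> 'w. h (fst z)) \<in> borel_measurable borel" using c by (rule borel_measurable_continuous_onI)
    have "bounded (range (\<lambda>z::'u \<times> 'w. h (fst z)))" using h by (auto simp: bounded_iff)
    with c have "(\<lambda>m. \<integral>z. h (fst z) \<partial>?M m) \<longlonglongrightarrow> (\<integral>z. h (fst z) \<partial>\<Lambda>)"
      using wc by (simp add: weak_conv_to_def)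
    then show "(\<lambda>m. \<integral>x. h x \<partial>distr (?P m) borel (U m)) \<longlonglongrightarrow> (\<integral>x. h x \<partial>\<psi>)"
      by (simp add: integral_distr \<psi>_def \<Lambda>_def)
  qed
  moreover have "measure \<psi> D \<le> measure \<phi> D" if D: "D \<in> sets borel" "convex D" "uminus ` D = D" for D
  proof -
    have [measurable]: "D \<in> sets borel" by fact
    have \<psi>D: "measure \<psi> D = measure \<mu> {z. u z \<in> D}"
      unfolding \<psi>_def by (subst measure_distr) (auto simp: vimage_def sp_\<mu>)
    have uD: "{z. u z \<in> D} \<in> sets \<mu>"
      using measurable_sets[of u \<mu> borel D] D by (simp add: vimage_def sp_\<mu>)
    have "measure \<phi> D = measure \<nu> {z. u z \<in> D}"
      unfolding \<phi>_def by (subst measure_distr) (auto simp: vimage_def \<nu>_def sp_\<mu>)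
    also have "\<dots> = measure \<mu> (S \<inter> {z. u z \<in> D}) / p"
      unfolding \<nu>_def p_def using eS S uD by (intro measure_uniform_measure) auto
    finally have \<phi>D: "measure \<phi> D = measure \<mu> {z. u z \<in> D \<and> snd z \<in> cball 0 (sqrt a)} / p"
      by (simp add: S_def Int_def conj_commute)
    have "p * measure \<mu> {z. u z \<in> D} \<le> measure \<mu> {z. u z \<in> D \<and> snd z \<in> cball 0 (sqrt a)}"
      unfolding p_eq \<mu>_def u_def using a
      by (intro gauss_pair_peaked adjoint_linear lin D) simp
    then show ?thesis unfolding \<psi>D \<phi>D using p by (simp add: pos_le_divide_eq mult.commute)
  qed
  ultimately show ?thesis by blast
qed

section \<open>Matrices, sign patterns and finite-population covariances\<close>

lemma tendsto_det:
  fixes M :: "nat \<Rightarrow> real^'n^'n"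
  assumes "M \<longlonglongrightarrow> M'"
  shows "(\<lambda>m. det (M m)) \<longlonglongrightarrow> det M'"
  unfolding det_def by (intro tendsto_sum tendsto_mult tendsto_const tendsto_prod tendsto_vec_nth assms)

lemma matrix_inv_works:
  fixes M :: "real^'n^'n"
  assumes "invertible M"
  shows matrix_inv_left: "matrix_inv M ** M = mat 1" and matrix_inv_right: "M ** matrix_inv M = mat 1"
  using someI_ex[of "\<lambda>B. M ** B = mat 1 \<and> B ** M = mat 1"] assms
  by (auto simp: matrix_inv_def invertible_def)

lemma matrix_inv_vector_mult:
  fixes M :: "real^'n^'n"
  assumes "invertible M"
  shows "matrix_inv M *v (M *v x) = x" "M *v (matrix_inv M *v x) = x"
  using matrix_inv_left[OF assms] matrix_inv_right[OF assms] by (simp_all add: matrix_vector_mul_assoc)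

lemma matrix_inv_cramer:
  fixes M :: "real^'n^'n"
  assumes "invertible M"
  shows "matrix_inv M $ i $ j = det (\<chi> k l. if l = i then axis j 1 $ k else M $ k $ l) / det M"
proof -
  have d: "det M \<noteq> 0" using assms by (simp add: invertible_det_nz)
  have "M *v (matrix_inv M *v axis j 1) = axis j 1" by (rule matrix_inv_vector_mult[OF assms])
  then have "matrix_inv M *v axis j 1 = (\<chi> k. det (\<chi> i l. if l = k then axis j 1 $ i else M $ i $ l) / det M)"
    using cramer[OF d] by blast
  moreover have "(matrix_inv M *v axis j 1) $ i = matrix_inv M $ i $ j"
    by (simp add: matrix_vector_mult_basis column_def)
  ultimately show ?thesis by simp
qed

lemma tendsto_matrix_inv:
  fixes M :: "nat \<Rightarrow> real^'n^'n"
  assumes M: "M \<longlonglongrightarrow> M'" and inv: "invertible M'"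
  shows "(\<lambda>m. matrix_inv (M m)) \<longlonglongrightarrow> matrix_inv M'"
proof (rule vec_tendstoI, rule vec_tendstoI)
  fix i j
  have d: "det M' \<noteq> 0" using inv by (simp add: invertible_det_nz)
  have "(\<lambda>m. (\<chi> k l. if l = i then axis j 1 $ k else M m $ k $ l) :: real^'n^'n)
    \<longlonglongrightarrow> (\<chi> k l. if l = i then axis j 1 $ k else M' $ k $ l)"
    by (intro vec_tendstoI) (auto intro!: tendsto_vec_nth M)
  then have lim: "(\<lambda>m. det (\<chi> k l. if l = i then axis j 1 $ k else M m $ k $ l) / det (M m))
    \<longlonglongrightarrow> matrix_inv M' $ i $ j"
    unfolding matrix_inv_cramer[OF inv] by (intro tendsto_divide tendsto_det M d)
  have "\<forall>\<^sub>F m in sequentially. det (M m) \<noteq> 0"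
    using tendsto_det[OF M] d by (rule tendsto_imp_eventually_ne)
  then have "\<forall>\<^sub>F m in sequentially. det (\<chi> k l. if l = i then axis j 1 $ k else M m $ k $ l) / det (M m) = matrix_inv (M m) $ i $ j"
    by eventually_elim (simp add: matrix_inv_cramer invertible_det_nz)
  with lim show "(\<lambda>m. matrix_inv (M m) $ i $ j) \<longlonglongrightarrow> matrix_inv M' $ i $ j"
    by (rule Lim_transform_eventually)
qed

lemma matrix_inv_scaleR:
  fixes M :: "real^'n^'n"
  assumes "invertible M" "c \<noteq> 0"
  shows "matrix_inv (c *\<^sub>R M) = (1 / c) *\<^sub>R matrix_inv M"
proof -
  have left: "((1 / c) *\<^sub>R matrix_inv M) ** (c *\<^sub>R M) = mat 1"
  proof -
    have "((1 / c) *\<^sub>R matrix_inv M) ** (c *\<^sub>R M) = matrix_inv M ** M"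
      using assms(2) by (simp add: matrix_matrix_mult_def vec_eq_iff)
    then show ?thesis by (simp add: matrix_inv_left[OF assms(1)])
  qed
  then have inv: "invertible (c *\<^sub>R M)" unfolding invertible_left_inverse by blast
  have "((1 / c) *\<^sub>R matrix_inv M) ** ((c *\<^sub>R M) ** matrix_inv (c *\<^sub>R M)) = matrix_inv (c *\<^sub>R M)"
    by (simp add: matrix_mul_assoc left)
  then show ?thesis by (simp add: matrix_inv_right[OF inv])
qed

lemma quadratic_form_diff_bound:
  fixes R R' :: "real^'n^'n"
  shows "\<bar>w \<bullet> (R *v w) - w \<bullet> (R' *v w)\<bar> \<le> (\<Sum>i\<in>UNIV. \<Sum>j\<in>UNIV. \<bar>R $ i $ j - R' $ i $ j\<bar>) * (norm w)\<^sup>2"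
proof -
  have "w \<bullet> (R *v w) - w \<bullet> (R' *v w) = (\<Sum>i\<in>UNIV. \<Sum>j\<in>UNIV. (R $ i $ j - R' $ i $ j) * (w $ i * w $ j))"
    by (simp add: inner_vec_def matrix_vector_mult_def sum_distrib_left algebra_simps sum_subtractf)
  also have "\<bar>\<dots>\<bar> \<le> (\<Sum>i\<in>UNIV. \<Sum>j\<in>UNIV. \<bar>(R $ i $ j - R' $ i $ j) * (w $ i * w $ j)\<bar>)"
    by (rule order_trans[OF sum_abs]) (intro sum_mono sum_abs)
  also have "\<dots> \<le> (\<Sum>i\<in>UNIV. \<Sum>j\<in>UNIV. \<bar>R $ i $ j - R' $ i $ j\<bar> * (norm w)\<^sup>2)"
  proof (intro sum_mono)
    fix i j
    have "\<bar>w $ i * w $ j\<bar> \<le> norm w * norm w"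
      unfolding abs_mult by (intro mult_mono component_le_norm_cart) auto
    then show "\<bar>(R $ i $ j - R' $ i $ j) * (w $ i * w $ j)\<bar> \<le> \<bar>R $ i $ j - R' $ i $ j\<bar> * (norm w)\<^sup>2"
      by (simp add: abs_mult[of "R $ i $ j - R' $ i $ j"] power2_eq_square mult_left_mono)
  qed
  finally show ?thesis by (simp add: sum_distrib_right)
qed

lemma signs_orthogonal:
  fixes \<iota> :: "'q::finite \<Rightarrow> nat \<Rightarrow> real"
  assumes bij: "bij_betw (\<lambda>q. restrict (\<iota> q) {..<K}) UNIV ({..<K} \<rightarrow>\<^sub>E {-1, 1})"
    and S: "S \<subseteq> {..<K}" "S' \<subseteq> {..<K}" "S \<noteq> S'"
  shows "(\<Sum>q\<in>UNIV. (\<Prod>k\<in>S. \<iota> q k) * (\<Prod>k\<in>S'. \<iota> q k)) = 0"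
proof -
  define w where "w k v = (if k \<in> S then v else 1) * (if k \<in> S' then v else 1 :: real)" for k v
  have "(\<Prod>k\<in>S. x k) * (\<Prod>k\<in>S'. x k) = (\<Prod>k<K. w k (x k))" for x :: "nat \<Rightarrow> real"
  proof -
    have "(\<Prod>k\<in>T. x k) = (\<Prod>k<K. if k \<in> T then x k else 1)" if "T \<subseteq> {..<K}" for T
      using that by (simp add: prod.If_cases Int_absorb1)
    then show ?thesis using S by (simp add: w_def prod.distrib)
  qed
  then have "(\<Sum>q\<in>UNIV. (\<Prod>k\<in>S. \<iota> q k) * (\<Prod>k\<in>S'. \<iota> q k)) = (\<Sum>q\<in>UNIV. \<Prod>k<K. w k (restrict (\<iota> q) {..<K} k))"
    by (auto intro!: sum.cong prod.cong)
  also have "\<dots> = (\<Sum>x\<in>{..<K} \<rightarrow>\<^sub>E {-1, 1}. \<Prod>k<K. w k (x k))"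
    by (rule sum.reindex_bij_betw[OF bij])
  also have "\<dots> = (\<Prod>k<K. \<Sum>v\<in>{-1, 1}. w k v)" by (rule prod_sum_PiE[symmetric]) auto
  also have "\<dots> = 0"
  proof -
    obtain k where k: "k < K" "(k \<in> S) \<noteq> (k \<in> S')" using S by blast
    then have "(\<Sum>v\<in>{-1, 1}. w k v) = 0" by (auto simp: w_def)
    then show ?thesis using k(1) by (intro prod_zero) auto
  qed
  finally show ?thesis .
qed

lemma pmean_add: "pmean n (\<lambda>i. y i + z i) = pmean n y + pmean n z"
  by (simp add: pmean_def sum.distrib add_divide_distrib)

lemma pmean_cmult: "pmean n (\<lambda>i. c * y i) = c * pmean n y"
  by (simp add: pmean_def sum_distrib_left)

lemma pmean_sum: "pmean n (\<lambda>i. \<Sum>l\<in>I. y l i) = (\<Sum>l\<in>I. pmean n (y l))"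
  unfolding pmean_def by (subst sum.swap) (simp add: sum_divide_distrib)

lemma pcov_commute: "pcov n y z = pcov n z y"
  by (simp add: pcov_def mult.commute)

lemma pcov_add_left: "pcov n (\<lambda>i. y i + y' i) z = pcov n y z + pcov n y' z"
  by (simp add: pcov_def pmean_add add_diff_add distrib_right sum.distrib add_divide_distrib)

lemma pcov_cmult_left: "pcov n (\<lambda>i. c * y i) z = c * pcov n y z"
  by (simp add: pcov_def pmean_cmult sum_distrib_left mult.assoc flip: right_diff_distrib)

lemma pcov_sum_left: "finite I \<Longrightarrow> pcov n (\<lambda>i. \<Sum>l\<in>I. y l i) z = (\<Sum>l\<in>I. pcov n (y l) z)"
proof (induction I rule: finite_induct)
  case empty
  then show ?case by (simp add: pcov_def pmean_def)
next
  case (insert l I)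
  then show ?case by (simp add: pcov_add_left)
qed

lemma pcov_self_nonneg: "0 \<le> pcov n y y" if "1 < n"
  using that unfolding pcov_def by (intro divide_nonneg_nonneg sum_nonneg) auto

lemma sum_centred_prod: "1 < n \<Longrightarrow> (\<Sum>i<n. (y i - pmean n y) * (z i - pmean n z)) = (real n - 1) * pcov n y z"
  by (simp add: pcov_def)

lemma Sxx_quadratic:
  "z \<bullet> (Sxx n X *v z') = pcov n (\<lambda>i. \<Sum>l\<in>UNIV. z $ l * X i $ l) (\<lambda>i. \<Sum>l\<in>UNIV. z' $ l * X i $ l)"
proof -
  have left: "pcov n (\<lambda>i. \<Sum>l\<in>UNIV. z $ l * X i $ l) w = (\<Sum>l\<in>UNIV. z $ l * pcov n (\<lambda>i. X i $ l) w)" for z w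
    by (simp add: pcov_sum_left pcov_cmult_left)
  have right: "pcov n w (\<lambda>i. \<Sum>l\<in>UNIV. z $ l * X i $ l) = (\<Sum>l\<in>UNIV. z $ l * pcov n w (\<lambda>i. X i $ l))" for z w
    using left[of z w] by (simp only: pcov_commute[of n w])
  show ?thesis unfolding left right
    by (simp add: inner_vec_def matrix_vector_mult_def Sxx_def mult.commute)
qed

lemma tendsto_quadratic_form:
  fixes M :: "nat \<Rightarrow> real^'n^'n"
  assumes "M \<longlonglongrightarrow> M'"
  shows "(\<lambda>m. u \<bullet> (M m *v v)) \<longlonglongrightarrow> u \<bullet> (M' *v v)"
  unfolding inner_vec_def matrix_vector_mult_def vec_lambda_beta inner_real_def
  by (intro tendsto_sum tendsto_mult tendsto_const tendsto_vec_nth assms)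

lemma psd_invertible_definite:
  fixes M :: "real^'n^'n"
  assumes sym: "\<And>z z'. z \<bullet> (M *v z') = z' \<bullet> (M *v z)" and psd: "\<And>z. 0 \<le> z \<bullet> (M *v z)"
    and inv: "invertible M" and z: "z \<bullet> (M *v z) = 0"
  shows "z = 0"
proof -
  have "bilinear (\<lambda>z z'. z \<bullet> (M *v z'))"
    unfolding bilinear_def
    by (intro conjI allI linearI) (simp_all add: inner_add_left inner_add_right matrix_vector_right_distrib matrix_vector_mult_scaleR)
  then have "(x \<bullet> (M *v z))\<^sup>2 \<le> (x \<bullet> (M *v x)) * (z \<bullet> (M *v z))" for x
    by (rule psd_cauchy_schwarz) (use sym psd in auto)
  then have "x \<bullet> (M *v z) = 0" for x by (simp add: z)
  from this[of "M *v z"] have "M *v z = 0" by simp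
  then show ?thesis using matrix_inv_vector_mult(1)[OF inv, of z] by simp
qed

section \<open>Factorial experiments\<close>

locale factorial_population =
  fixes K :: nat and A :: "'f::finite \<Rightarrow> nat set" and \<iota> :: "'q::finite \<Rightarrow> nat \<Rightarrow> real"
    and n :: nat and nq :: "'q \<Rightarrow> nat" and Y :: "nat \<Rightarrow> 'q \<Rightarrow> real" and X :: "nat \<Rightarrow> real^'l::finite"
  assumes n_gt_1: "1 < n" and nq_sum': "(\<Sum>q\<in>UNIV. nq q) = n" and nq_pos: "\<And>q. 1 \<le> nq q"
    and gcoef_sum: "\<And>f. (\<Sum>q\<in>UNIV. gcoef A \<iota> f q) = 0"
begin

sublocale assignment_design n nq
  using n_gt_1 nq_sum' by unfold_locales auto

abbreviation g :: "'f \<Rightarrow> 'q \<Rightarrow> real" where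
  "g \<equiv> gcoef A \<iota>"

definition scal :: real where
  "scal = 1 / 2 ^ (K - 1)"

definition coefY :: "real^'f \<Rightarrow> 'q \<Rightarrow> real" where
  "coefY s q = (\<Sum>f\<in>UNIV. s $ f * g f q)"

definition coefX :: "real^('f \<times> 'l) \<Rightarrow> 'q \<Rightarrow> 'l \<Rightarrow> real" where
  "coefX u q l = (\<Sum>f\<in>UNIV. u $ (f, l) * g f q)"

definition lin :: "(real^'f) \<times> (real^('f \<times> 'l)) \<Rightarrow> 'q \<Rightarrow> nat \<Rightarrow> real" where
  "lin t q i = coefY (fst t) q * Y i q + (\<Sum>l\<in>UNIV. coefX (snd t) q l * X i $ l)"

definition score :: "(real^'f) \<times> (real^('f \<times> 'l)) \<Rightarrow> nat \<Rightarrow> 'q \<Rightarrow> real" where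
  "score t i q = sqrt (real n) * scal / real (nq q) * (lin t q i - pmean n (lin t q))"

definition U :: "(nat \<Rightarrow> 'q) \<Rightarrow> real^'f" where
  "U Z = sqrt (real n) *\<^sub>R (tauhat K A \<iota> n nq Y Z - tau K A \<iota> n Y)"

definition W :: "(nat \<Rightarrow> 'q) \<Rightarrow> real^('f \<times> 'l)" where
  "W Z = sqrt (real n) *\<^sub>R tauhat_x K A \<iota> n nq X Z"

lemma nq_pos': "0 < real (nq q)"
  using nq_pos[of q] by simp

lemma coefY_linear: "coefY (s + s') q = coefY s q + coefY s' q" "coefY (r *\<^sub>R s) q = r * coefY s q"
  by (simp_all add: coefY_def distrib_right sum.distrib sum_distrib_left mult.assoc)

lemma coefX_linear: "coefX (s + s') q l = coefX s q l + coefX s' q l" "coefX (r *\<^sub>R s) q l = r * coefX s q l"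
  by (simp_all add: coefX_def distrib_right sum.distrib sum_distrib_left mult.assoc)

lemma coefX_sum: "(\<Sum>q\<in>UNIV. coefX u q l) = 0"
  unfolding coefX_def by (subst sum.swap) (simp add: gcoef_sum flip: sum_distrib_left)

lemma lin_linear: "lin (s + t) q i = lin s q i + lin t q i" "lin (r *\<^sub>R t) q i = r * lin t q i"
  by (simp_all add: lin_def coefY_linear coefX_linear distrib_right distrib_left sum.distrib sum_distrib_left mult.assoc)

lemma pmean_lin: "pmean n (lin t q) = coefY (fst t) q * pmean n (\<lambda>i. Y i q) + (\<Sum>l\<in>UNIV. coefX (snd t) q l * pmean n (\<lambda>i. X i $ l))"
  unfolding lin_def[abs_def] by (simp add: pmean_add pmean_cmult pmean_sum)

lemma score_linear: "score (s + t) i q = score s i q + score t i q" "score (r *\<^sub>R t) i q = r * score t i q"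
proof -
  have "pmean n (lin (s + t) q) = pmean n (lin s q) + pmean n (lin t q)"
    using pmean_add[of n "lin s q" "lin t q"] by (simp add: lin_linear[abs_def])
  then show "score (s + t) i q = score s i q + score t i q"
    by (simp add: score_def lin_linear add_diff_add distrib_left add_divide_distrib)
  have "pmean n (lin (r *\<^sub>R t) q) = r * pmean n (lin t q)"
    using pmean_cmult[of n r "lin t q"] by (simp add: lin_linear[abs_def])
  then show "score (r *\<^sub>R t) i q = r * score t i q"
    by (simp add: score_def lin_linear flip: right_diff_distrib)
qed

lemma score_centred: "centred (score t)"
proof -
  have "(\<Sum>i<n. lin t q i - pmean n (lin t q)) = 0" for q
    using n_gt_1 by (simp add: sum_subtractf pmean_def)
  then show ?thesis unfolding centred_def score_def sum_distrib_left[symmetric] by simp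
qed

lemma stat_group:
  "(\<Sum>i<n. F i (Z i)) = (\<Sum>q\<in>UNIV. \<Sum>i | i < n \<and> Z i = q. F i q)" for F :: "nat \<Rightarrow> 'q \<Rightarrow> real"
proof -
  have "(\<Sum>i<n. F i (Z i)) = (\<Sum>q\<in>UNIV. \<Sum>i | i \<in> {..<n} \<and> Z i = q. F i (Z i))"
    by (rule sum.group[symmetric]) auto
  also have "\<dots> = (\<Sum>q\<in>UNIV. \<Sum>i | i < n \<and> Z i = q. F i q)"
    by (intro sum.cong) auto
  finally show ?thesis .
qed

lemma stat_score:
  assumes "Z \<in> \<Omega>"
  shows "t \<bullet> (U Z, W Z) = stat (score t) Z"
proof -
  obtain s u where t: "t = (s, u)" by fastforce
  let ?G = "\<lambda>q. {i. i < n \<and> Z i = q}"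
  let ?y = "grpmean n nq Z (\<lambda>i. Y i (Z i))" and ?x = "grpmean n nq Z X"
  let ?c = "sqrt (real n) * scal"
  have card: "card (?G q) = nq q" for q using assms by (simp add: \<Omega>_def assignments_def)
  have grp: "(\<Sum>i\<in>?G q. score t i q) = ?c * (coefY s q * (?y q - pmean n (\<lambda>i. Y i q))
      + (\<Sum>l\<in>UNIV. coefX u q l * ?x q $ l) - (\<Sum>l\<in>UNIV. coefX u q l * pmean n (\<lambda>i. X i $ l)))" for q
  proof -
    have y: "(\<Sum>i\<in>?G q. Y i q) = real (nq q) * ?y q"
    proof -
      have "(\<Sum>i\<in>?G q. Y i q) = (\<Sum>i\<in>?G q. Y i (Z i))" by (rule sum.cong) auto
      then show ?thesis using nq_pos'[of q] by (simp add: grpmean_def)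
    qed
    have x: "(\<Sum>i\<in>?G q. X i $ l) = real (nq q) * ?x q $ l" for l
      using nq_pos'[of q] by (simp add: grpmean_def)
    have "(\<Sum>i\<in>?G q. lin t q i) = coefY s q * (\<Sum>i\<in>?G q. Y i q) + (\<Sum>l\<in>UNIV. coefX u q l * (\<Sum>i\<in>?G q. X i $ l))"
      by (simp add: lin_def t sum.distrib sum_distrib_left sum.swap[of _ UNIV])
    also have "\<dots> = real (nq q) * (coefY s q * ?y q + (\<Sum>l\<in>UNIV. coefX u q l * ?x q $ l))"
      unfolding y x by (simp add: distrib_left sum_distrib_left mult_ac)
    finally have l: "(\<Sum>i\<in>?G q. lin t q i) = real (nq q) * (coefY s q * ?y q + (\<Sum>l\<in>UNIV. coefX u q l * ?x q $ l))" .
    have "(\<Sum>i\<in>?G q. score t i q) = ?c / real (nq q) * ((\<Sum>i\<in>?G q. lin t q i) - real (nq q) * pmean n (lin t q))"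
      unfolding score_def sum_distrib_left[symmetric] by (simp add: sum_subtractf card)
    also have "\<dots> = ?c * ((coefY s q * ?y q + (\<Sum>l\<in>UNIV. coefX u q l * ?x q $ l)) - pmean n (lin t q))"
      unfolding l right_diff_distrib[symmetric] using nq_pos'[of q] by simp
    finally show ?thesis by (simp add: pmean_lin t algebra_simps)
  qed
  have zero: "(\<Sum>q\<in>UNIV. \<Sum>l\<in>UNIV. coefX u q l * pmean n (\<lambda>i. X i $ l)) = 0"
    by (subst sum.swap) (simp add: coefX_sum flip: sum_distrib_right)
  have "stat (score t) Z = (\<Sum>q\<in>UNIV. \<Sum>i\<in>?G q. score t i q)"
    unfolding stat_def by (rule stat_group)
  also have "\<dots> = ?c * ((\<Sum>q\<in>UNIV. coefY s q * (?y q - pmean n (\<lambda>i. Y i q))) + (\<Sum>q\<in>UNIV. \<Sum>l\<in>UNIV. coefX u q l * ?x q $ l))"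
    unfolding grp by (simp add: sum.distrib sum_subtractf zero flip: sum_distrib_left)
  also have "(\<Sum>q\<in>UNIV. coefY s q * (?y q - pmean n (\<lambda>i. Y i q))) = (\<Sum>f\<in>UNIV. s $ f * (\<Sum>q\<in>UNIV. g f q * (?y q - pmean n (\<lambda>i. Y i q))))"
    unfolding coefY_def sum_distrib_left sum_distrib_right by (subst sum.swap) (simp only: mult.assoc)
  also have "(\<Sum>q\<in>UNIV. \<Sum>l\<in>UNIV. coefX u q l * ?x q $ l) = (\<Sum>f\<in>UNIV. \<Sum>l\<in>UNIV. u $ (f, l) * (\<Sum>q\<in>UNIV. g f q * ?x q $ l))"
  proof -
    have "(\<Sum>q\<in>UNIV. \<Sum>l\<in>UNIV. coefX u q l * ?x q $ l) = (\<Sum>q\<in>UNIV. \<Sum>l\<in>UNIV. \<Sum>f\<in>UNIV. u $ (f, l) * (g f q * ?x q $ l))"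
      by (simp add: coefX_def sum_distrib_right mult.assoc)
    also have "\<dots> = (\<Sum>q\<in>UNIV. \<Sum>f\<in>UNIV. \<Sum>l\<in>UNIV. u $ (f, l) * (g f q * ?x q $ l))"
      by (intro sum.cong refl sum.swap)
    also have "\<dots> = (\<Sum>f\<in>UNIV. \<Sum>q\<in>UNIV. \<Sum>l\<in>UNIV. u $ (f, l) * (g f q * ?x q $ l))" by (rule sum.swap)
    also have "\<dots> = (\<Sum>f\<in>UNIV. \<Sum>l\<in>UNIV. \<Sum>q\<in>UNIV. u $ (f, l) * (g f q * ?x q $ l))"
      by (intro sum.cong refl sum.swap)
    finally show ?thesis by (simp add: sum_distrib_left)
  qed
  finally have R: "stat (score t) Z = ?c * ((\<Sum>f\<in>UNIV. s $ f * (\<Sum>q\<in>UNIV. g f q * (?y q - pmean n (\<lambda>i. Y i q))))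
    + (\<Sum>f\<in>UNIV. \<Sum>l\<in>UNIV. u $ (f, l) * (\<Sum>q\<in>UNIV. g f q * ?x q $ l)))" .
  have "s \<bullet> U Z = ?c * (\<Sum>f\<in>UNIV. s $ f * (\<Sum>q\<in>UNIV. g f q * (?y q - pmean n (\<lambda>i. Y i q))))"
    by (simp add: U_def tauhat_def tau_def inner_vec_def scal_def sum_distrib_left right_diff_distrib sum_subtractf mult_ac
        flip: sum_divide_distrib)
  moreover have "u \<bullet> W Z = ?c * (\<Sum>f\<in>UNIV. \<Sum>l\<in>UNIV. u $ (f, l) * (\<Sum>q\<in>UNIV. g f q * ?x q $ l))"
  proof -
    have "u \<bullet> W Z = (\<Sum>p\<in>UNIV. u $ p * (?c * (\<Sum>q\<in>UNIV. g (fst p) q * ?x q $ snd p)))"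
      by (simp add: W_def tauhat_x_def inner_vec_def scal_def mult_ac)
    also have "\<dots> = (\<Sum>f\<in>UNIV. \<Sum>l\<in>UNIV. u $ (f, l) * (?c * (\<Sum>q\<in>UNIV. g f q * ?x q $ l)))"
      unfolding UNIV_Times_UNIV[symmetric] sum.cartesian_product' by simp
    finally show ?thesis by (simp add: sum_distrib_left mult_ac)
  qed
  ultimately show ?thesis unfolding R by (simp add: t distrib_left)
qed

definition cross :: "(real^'f) \<times> (real^('f \<times> 'l)) \<Rightarrow> (real^'f) \<times> (real^('f \<times> 'l)) \<Rightarrow> 'q \<Rightarrow> 'q \<Rightarrow> real" where
  "cross s t q r = (\<Sum>i<n. score s i q * score t i r)"

definition Bn :: "(real^'f) \<times> (real^('f \<times> 'l)) \<Rightarrow> (real^'f) \<times> (real^('f \<times> 'l)) \<Rightarrow> real" where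
  "Bn s t = (\<Sum>q\<in>UNIV. share q * cross s t q q) - (\<Sum>q\<in>UNIV. \<Sum>r\<in>UNIV. share q * share r * cross s t q r)"

lemma cross_eq: "cross s t q r = (scal\<^sup>2 * (real n * (real n - 1))) / (real (nq q) * real (nq r)) * pcov n (lin s q) (lin t r)"
proof -
  have "cross s t q r = (sqrt (real n) * scal / real (nq q)) * (sqrt (real n) * scal / real (nq r))
      * (\<Sum>i<n. (lin s q i - pmean n (lin s q)) * (lin t r i - pmean n (lin t r)))"
    unfolding cross_def score_def sum_distrib_left by (intro sum.cong refl) (simp only: ac_simps)
  also have "(sqrt (real n) * scal / real (nq q)) * (sqrt (real n) * scal / real (nq r)) = (sqrt (real n) * sqrt (real n)) * scal\<^sup>2 / (real (nq q) * real (nq r))"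
    by (simp add: power2_eq_square mult_ac)
  also have "sqrt (real n) * sqrt (real n) = real n" by simp
  finally show ?thesis by (simp add: sum_centred_prod[OF n_gt_1] mult_ac)
qed

lemma pcov_lin: "pcov n (lin s q) (lin t r) =
    coefY (fst s) q * coefY (fst t) r * pcov n (\<lambda>i. Y i q) (\<lambda>i. Y i r)
  + coefY (fst s) q * (\<Sum>l\<in>UNIV. coefX (snd t) r l * Sqx n Y X q $ l)
  + coefY (fst t) r * (\<Sum>l\<in>UNIV. coefX (snd s) q l * Sqx n Y X r $ l)
  + (\<Sum>l\<in>UNIV. \<Sum>l'\<in>UNIV. coefX (snd s) q l * coefX (snd t) r l' * Sxx n X $ l $ l')"
proof -
  have left: "pcov n (lin s q) z = coefY (fst s) q * pcov n (\<lambda>i. Y i q) z + (\<Sum>l\<in>UNIV. coefX (snd s) q l * pcov n (\<lambda>i. X i $ l) z)" for z s q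
    unfolding lin_def[abs_def] by (simp add: pcov_add_left pcov_cmult_left pcov_sum_left)
  have right: "pcov n z (lin t r) = coefY (fst t) r * pcov n z (\<lambda>i. Y i r) + (\<Sum>l\<in>UNIV. coefX (snd t) r l * pcov n z (\<lambda>i. X i $ l))" for z
    using left[of t r z] by (simp add: pcov_commute[of n z])
  have xy: "pcov n (\<lambda>i. X i $ l) (\<lambda>i. Y i r) = Sqx n Y X r $ l" for l r
    by (subst pcov_commute) (simp add: Sqx_def)
  have yx: "pcov n (\<lambda>i. Y i q) (\<lambda>i. X i $ l) = Sqx n Y X q $ l" for l q
    by (simp add: Sqx_def)
  have xx: "pcov n (\<lambda>i. X i $ l) (\<lambda>i. X i $ l') = Sxx n X $ l $ l'" for l l'
    by (simp add: Sxx_def)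
  show ?thesis unfolding left right xy yx xx
    by (simp add: distrib_left sum.distrib sum_distrib_left mult_ac) (rule sum.swap)
qed

lemma total_energy_score: "total_energy (score t) = (\<Sum>q\<in>UNIV. cross t t q q)"
  unfolding total_energy_def cross_def by (subst sum.swap) (simp add: power2_eq_square)

lemma limvar_score: "limvar (score t) = Bn t t"
proof -
  have "energy (score t) = (\<Sum>q\<in>UNIV. share q * cross t t q q)"
    unfolding energy_def cross_def sum_distrib_left by (subst sum.swap) (simp add: power2_eq_square)
  moreover have "(\<Sum>i<n. (unit_mean (score t) i)\<^sup>2) = (\<Sum>q\<in>UNIV. \<Sum>r\<in>UNIV. share q * share r * cross t t q r)"
  proof -
    have "(\<Sum>i<n. (unit_mean (score t) i)\<^sup>2) = (\<Sum>i<n. \<Sum>q\<in>UNIV. \<Sum>r\<in>UNIV. share q * share r * (score t i q * score t i r))"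
      by (simp add: unit_mean_def power2_eq_square sum_product mult_ac)
    also have "\<dots> = (\<Sum>q\<in>UNIV. \<Sum>i<n. \<Sum>r\<in>UNIV. share q * share r * (score t i q * score t i r))" by (rule sum.swap)
    also have "\<dots> = (\<Sum>q\<in>UNIV. \<Sum>r\<in>UNIV. \<Sum>i<n. share q * share r * (score t i q * score t i r))"
      by (intro sum.cong refl sum.swap)
    finally show ?thesis by (simp add: cross_def sum_distrib_left)
  qed
  ultimately show ?thesis by (simp add: limvar_def Bn_def)
qed

lemma cross_linear:
  "cross (s + s') t q r = cross s t q r + cross s' t q r" "cross (c *\<^sub>R s) t q r = c * cross s t q r"
  by (simp_all add: cross_def score_linear distrib_right sum.distrib sum_distrib_left mult.assoc)

lemma cross_commute: "cross s t q r = cross t s r q"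
  by (simp add: cross_def mult.commute)

lemma Bn_commute: "Bn s t = Bn t s"
  unfolding Bn_def by (subst (2) sum.swap) (simp add: cross_commute[of s t] mult_ac)

lemma Bn_linear: "Bn (s + s') t = Bn s t + Bn s' t" "Bn (c *\<^sub>R s) t = c * Bn s t"
  by (simp_all add: Bn_def cross_linear distrib_left sum.distrib right_diff_distrib sum_distrib_left mult_ac)

lemma Bn_nonneg: "0 \<le> Bn t t"
  using limvar_nonneg[of "score t"] by (simp add: limvar_score)

lemma Bn_covariate: "Bn (0, u) (0, u') = (real n - 1) * (u \<bullet> (Vxx K A \<iota> n nq X *v u'))"
proof -
  have [simp]: "coefY 0 q = 0" for q by (simp add: coefY_def)
  have mean0: "(\<Sum>q\<in>UNIV. share q * score (0, u) i q) = 0" for u i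
  proof -
    have "(\<Sum>q\<in>UNIV. share q * score (0, u) i q) = (\<Sum>q\<in>UNIV. sqrt (real n) * scal / real n * (lin (0, u) q i - pmean n (lin (0, u) q)))"
      using nq_pos' by (intro sum.cong refl) (simp add: share_def score_def less_imp_neq[symmetric])
    also have "\<dots> = sqrt (real n) * scal / real n * (\<Sum>q\<in>UNIV. \<Sum>l\<in>UNIV. coefX u q l * (X i $ l - pmean n (\<lambda>i. X i $ l)))"
      unfolding sum_distrib_left[symmetric] by (simp add: pmean_lin lin_def right_diff_distrib sum_subtractf)
    also have "(\<Sum>q\<in>UNIV. \<Sum>l\<in>UNIV. coefX u q l * (X i $ l - pmean n (\<lambda>i. X i $ l))) = 0"
      by (subst sum.swap) (simp add: coefX_sum flip: sum_distrib_right)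
    finally show ?thesis by simp
  qed
  have "(\<Sum>q\<in>UNIV. \<Sum>r\<in>UNIV. share q * share r * cross (0, u) (0, u') q r)
    = (\<Sum>q\<in>UNIV. \<Sum>r\<in>UNIV. \<Sum>i<n. (share q * score (0, u) i q) * (share r * score (0, u') i r))"
    by (simp add: cross_def sum_distrib_left mult_ac)
  also have "\<dots> = (\<Sum>q\<in>UNIV. \<Sum>i<n. \<Sum>r\<in>UNIV. (share q * score (0, u) i q) * (share r * score (0, u') i r))"
    by (intro sum.cong refl sum.swap)
  also have "\<dots> = 0" by (simp add: mean0 flip: sum_distrib_left)
  finally have "Bn (0, u) (0, u') = (\<Sum>q\<in>UNIV. share q * cross (0, u) (0, u') q q)" by (simp add: Bn_def)
  also have "\<dots> = (\<Sum>q\<in>UNIV. (real n - 1) * scal\<^sup>2 * (\<Sum>l\<in>UNIV. \<Sum>l'\<in>UNIV. coefX u q l * coefX u' q l' / real (nq q) * Sxx n X $ l $ l'))"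
  proof (intro sum.cong refl)
    fix q
    have "share q * cross (0, u) (0, u') q q = (real n - 1) * scal\<^sup>2 / real (nq q) * pcov n (lin (0, u) q) (lin (0, u') q)"
      using nq_pos'[of q] n_gt_1 by (simp add: share_def cross_eq field_simps)
    then show "share q * cross (0, u) (0, u') q q = (real n - 1) * scal\<^sup>2 * (\<Sum>l\<in>UNIV. \<Sum>l'\<in>UNIV. coefX u q l * coefX u' q l' / real (nq q) * Sxx n X $ l $ l')"
      by (simp add: pcov_lin sum_distrib_left mult_ac)
  qed
  also have "\<dots> = (real n - 1) * (scal\<^sup>2 * (\<Sum>l\<in>UNIV. \<Sum>l'\<in>UNIV. (\<Sum>q\<in>UNIV. coefX u q l * coefX u' q l' / real (nq q)) * Sxx n X $ l $ l'))"
  proof -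
    have "(\<Sum>q\<in>UNIV. \<Sum>l\<in>UNIV. \<Sum>l'\<in>UNIV. coefX u q l * coefX u' q l' / real (nq q) * Sxx n X $ l $ l')
      = (\<Sum>l\<in>UNIV. \<Sum>q\<in>UNIV. \<Sum>l'\<in>UNIV. coefX u q l * coefX u' q l' / real (nq q) * Sxx n X $ l $ l')" by (rule sum.swap)
    also have "\<dots> = (\<Sum>l\<in>UNIV. \<Sum>l'\<in>UNIV. \<Sum>q\<in>UNIV. coefX u q l * coefX u' q l' / real (nq q) * Sxx n X $ l $ l')"
      by (intro sum.cong refl sum.swap)
    finally show ?thesis by (simp only: sum_distrib_left[symmetric] sum_distrib_right[symmetric] mult.assoc)
  qed
  also have "scal\<^sup>2 * (\<Sum>l\<in>UNIV. \<Sum>l'\<in>UNIV. (\<Sum>q\<in>UNIV. coefX u q l * coefX u' q l' / real (nq q)) * Sxx n X $ l $ l')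
    = u \<bullet> (Vxx K A \<iota> n nq X *v u')"
  proof -
    define G where "G f f' = (\<Sum>q\<in>UNIV. g f q * g f' q / real (nq q))" for f f'
    have V: "Vxx K A \<iota> n nq X $ (f, l) $ (f', l') = scal\<^sup>2 * G f f' * Sxx n X $ l $ l'" for f l f' l'
      by (simp add: Vxx_def scal_def G_def power_mult[symmetric] power_one_over mult.commute)
    have "(\<Sum>q\<in>UNIV. coefX u q l * coefX u' q l' / real (nq q)) = (\<Sum>f\<in>UNIV. \<Sum>f'\<in>UNIV. u $ (f, l) * u' $ (f', l') * G f f')" for l l'
    proof -
      have "(\<Sum>q\<in>UNIV. coefX u q l * coefX u' q l' / real (nq q))
        = (\<Sum>q\<in>UNIV. \<Sum>f\<in>UNIV. \<Sum>f'\<in>UNIV. u $ (f, l) * u' $ (f', l') * (g f q * g f' q / real (nq q)))"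
        unfolding coefX_def sum_product sum_divide_distrib by (intro sum.cong refl) simp
      also have "\<dots> = (\<Sum>f\<in>UNIV. \<Sum>q\<in>UNIV. \<Sum>f'\<in>UNIV. u $ (f, l) * u' $ (f', l') * (g f q * g f' q / real (nq q)))" by (rule sum.swap)
      also have "\<dots> = (\<Sum>f\<in>UNIV. \<Sum>f'\<in>UNIV. \<Sum>q\<in>UNIV. u $ (f, l) * u' $ (f', l') * (g f q * g f' q / real (nq q)))"
        by (intro sum.cong refl sum.swap)
      finally show ?thesis by (simp only: G_def sum_distrib_left)
    qed
    then have "scal\<^sup>2 * (\<Sum>l\<in>UNIV. \<Sum>l'\<in>UNIV. (\<Sum>q\<in>UNIV. coefX u q l * coefX u' q l' / real (nq q)) * Sxx n X $ l $ l')
      = (\<Sum>l\<in>UNIV. \<Sum>l'\<in>UNIV. \<Sum>f\<in>UNIV. \<Sum>f'\<in>UNIV. u $ (f, l) * (scal\<^sup>2 * G f f' * Sxx n X $ l $ l' * u' $ (f', l')))"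
      by (simp add: sum_distrib_left sum_distrib_right mult_ac)
    also have "\<dots> = (\<Sum>l\<in>UNIV. \<Sum>f\<in>UNIV. \<Sum>l'\<in>UNIV. \<Sum>f'\<in>UNIV. u $ (f, l) * (scal\<^sup>2 * G f f' * Sxx n X $ l $ l' * u' $ (f', l')))"
      by (intro sum.cong refl sum.swap)
    also have "\<dots> = (\<Sum>f\<in>UNIV. \<Sum>l\<in>UNIV. \<Sum>l'\<in>UNIV. \<Sum>f'\<in>UNIV. u $ (f, l) * (scal\<^sup>2 * G f f' * Sxx n X $ l $ l' * u' $ (f', l')))"
      by (rule sum.swap)
    also have "\<dots> = (\<Sum>f\<in>UNIV. \<Sum>l\<in>UNIV. \<Sum>f'\<in>UNIV. \<Sum>l'\<in>UNIV. u $ (f, l) * (Vxx K A \<iota> n nq X $ (f, l) $ (f', l') * u' $ (f', l')))"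
      unfolding V by (intro sum.cong refl sum.swap)
    also have "\<dots> = u \<bullet> (Vxx K A \<iota> n nq X *v u')"
      unfolding inner_vec_def matrix_vector_mult_def UNIV_Times_UNIV[symmetric] sum.cartesian_product'
      by (simp add: sum_distrib_left)
    finally show ?thesis .
  qed
  finally show ?thesis by simp
qed

lemma score_bound:
  assumes "i < n"
  shows "\<bar>score t i q\<bar> \<le> scal / (real (nq q) / real n) *
     (\<bar>coefY (fst t) q\<bar> * sqrt (Max ((\<lambda>i. (Y i q - pmean n (\<lambda>j. Y j q))\<^sup>2) ` {..<n}) / real n)
    + (\<Sum>l\<in>UNIV. \<bar>coefX (snd t) q l\<bar>) * sqrt (Max ((\<lambda>i. (norm (X i - (\<chi> l. pmean n (\<lambda>j. X j $ l))))\<^sup>2) ` {..<n}) / real n))"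
proof -
  define MY where "MY = Max ((\<lambda>i. (Y i q - pmean n (\<lambda>j. Y j q))\<^sup>2) ` {..<n})"
  define MX where "MX = Max ((\<lambda>i. (norm (X i - (\<chi> l. pmean n (\<lambda>j. X j $ l))))\<^sup>2) ` {..<n})"
  have "(Y i q - pmean n (\<lambda>j. Y j q))\<^sup>2 \<le> MY" unfolding MY_def using assms by (intro Max_ge) auto
  then have y: "\<bar>Y i q - pmean n (\<lambda>j. Y j q)\<bar> \<le> sqrt MY" by (simp add: real_le_rsqrt)
  have "(norm (X i - (\<chi> l. pmean n (\<lambda>j. X j $ l))))\<^sup>2 \<le> MX" unfolding MX_def using assms by (intro Max_ge) auto
  then have nx: "norm (X i - (\<chi> l. pmean n (\<lambda>j. X j $ l))) \<le> sqrt MX" by (simp add: real_le_rsqrt)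
  have x: "\<bar>X i $ l - pmean n (\<lambda>j. X j $ l)\<bar> \<le> sqrt MX" for l
    using component_le_norm_cart[of "X i - (\<chi> l. pmean n (\<lambda>j. X j $ l))" l] nx by simp
  have "lin t q i - pmean n (lin t q) = coefY (fst t) q * (Y i q - pmean n (\<lambda>j. Y j q))
      + (\<Sum>l\<in>UNIV. coefX (snd t) q l * (X i $ l - pmean n (\<lambda>j. X j $ l)))"
    by (simp add: pmean_lin lin_def right_diff_distrib sum_subtractf)
  also have "\<bar>\<dots>\<bar> \<le> \<bar>coefY (fst t) q * (Y i q - pmean n (\<lambda>j. Y j q))\<bar>
      + (\<Sum>l\<in>UNIV. \<bar>coefX (snd t) q l * (X i $ l - pmean n (\<lambda>j. X j $ l))\<bar>)"
    by (intro order_trans[OF abs_triangle_ineq] add_mono order_refl sum_abs)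
  also have "\<dots> \<le> \<bar>coefY (fst t) q\<bar> * sqrt MY + (\<Sum>l\<in>UNIV. \<bar>coefX (snd t) q l\<bar> * sqrt MX)"
    unfolding abs_mult using x y by (intro add_mono sum_mono mult_left_mono) auto
  finally have b: "\<bar>lin t q i - pmean n (lin t q)\<bar> \<le> \<bar>coefY (fst t) q\<bar> * sqrt MY + (\<Sum>l\<in>UNIV. \<bar>coefX (snd t) q l\<bar>) * sqrt MX"
    by (simp add: sum_distrib_right)
  have s0: "0 \<le> sqrt (real n) * scal / real (nq q)" by (simp add: scal_def)
  have "\<bar>score t i q\<bar> = sqrt (real n) * scal / real (nq q) * \<bar>lin t q i - pmean n (lin t q)\<bar>"
    unfolding score_def abs_mult[of "sqrt (real n) * scal / real (nq q)"] by (simp only: abs_of_nonneg[OF s0])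
  also have "\<dots> \<le> sqrt (real n) * scal / real (nq q) * (\<bar>coefY (fst t) q\<bar> * sqrt MY + (\<Sum>l\<in>UNIV. \<bar>coefX (snd t) q l\<bar>) * sqrt MX)"
    using b s0 by (rule mult_left_mono)
  also have "sqrt (real n) * scal / real (nq q) = scal / (real (nq q) / real n) * (1 / sqrt (real n))"
  proof -
    have "real n / sqrt (real n) = sqrt (real n)" by (simp add: real_div_sqrt)
    moreover have "scal / (real (nq q) / real n) * (1 / sqrt (real n)) = scal / real (nq q) * (real n / sqrt (real n))" by simp
    ultimately show ?thesis by simp
  qed
  finally show ?thesis using n_gt_1
    by (simp add: MY_def[symmetric] MX_def[symmetric] real_sqrt_divide distrib_left add_divide_distrib)
qed

end

theorem theorem4:
  fixes K :: nat
    and \<iota> :: "'q::finite \<Rightarrow> nat \<Rightarrow> real"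
    and A :: "'f::finite \<Rightarrow> nat set"
    and n :: "nat \<Rightarrow> nat"
    and nq :: "nat \<Rightarrow> 'q \<Rightarrow> nat"
    and Y :: "nat \<Rightarrow> nat \<Rightarrow> 'q \<Rightarrow> real"
    and X :: "nat \<Rightarrow> nat \<Rightarrow> real^'l::finite"
    and a :: real
  assumes K: "K \<ge> 1"
    and iota_bij: "bij_betw (\<lambda>q. restrict (\<iota> q) {..<K}) UNIV ({..<K} \<rightarrow>\<^sub>E {-1, 1})"
    and A_bij: "bij_betw A UNIV {B. B \<subseteq> {..<K} \<and> B \<noteq> {}}"
    and a_pos: "a > 0"
    and nq_pos: "\<And>m q. nq m q \<ge> 1"
    and nq_sum: "\<And>m. (\<Sum>q\<in>UNIV. nq m q) = n m"
    and n_lim: "filterlim n at_top sequentially"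
    and reg_i: "\<And>q. \<exists>c>0. (\<lambda>m. real (nq m q) / real (n m)) \<longlonglongrightarrow> c"
    and reg_ii_Y: "\<And>q k. convergent (\<lambda>m. pcov (n m) (\<lambda>i. Y m i q) (\<lambda>i. Y m i k))"
    and reg_ii_xx: "\<exists>\<Sigma>. (\<lambda>m. Sxx (n m) (X m)) \<longlonglongrightarrow> \<Sigma> \<and> invertible \<Sigma>"
    and reg_ii_xx_ns: "\<And>m. invertible (Sxx (n m) (X m))"
    and reg_ii_qx: "\<And>q. convergent (\<lambda>m. Sqx (n m) (Y m) (X m) q)"
    and reg_iii_Y: "\<And>q. (\<lambda>m. Max ((\<lambda>i. (Y m i q - pmean (n m) (\<lambda>j. Y m j q))\<^sup>2) ` {..<n m})
                          / real (n m)) \<longlonglongrightarrow> 0"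
    and reg_iii_x: "(\<lambda>m. Max ((\<lambda>i. (norm (X m i - (\<chi> l. pmean (n m) (\<lambda>j. X m j $ l))))\<^sup>2) ` {..<n m})
                          / real (n m)) \<longlonglongrightarrow> 0"
  shows "\<exists>\<phi> \<psi>.
     weak_conv_to (\<lambda>m. samp_dist K A \<iota> (n m) (nq m) (Y m) (accepted K A \<iota> (n m) (nq m) (X m) a)) \<phi>
   \<and> weak_conv_to (\<lambda>m. samp_dist K A \<iota> (n m) (nq m) (Y m) (assignments (n m) (nq m))) \<psi>
   \<and> (\<forall>C :: (real^'f) set. C \<in> sets borel \<and> convex C \<and> uminus ` C = C \<longrightarrow>
        measure \<phi> C \<ge> measure \<psi> C)"
proof -
  have A_sub: "A f \<subseteq> {..<K}" "A f \<noteq> {}" for f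
    using bij_betw_apply[OF A_bij, of f] by auto
  have g_orth: "(\<Sum>q\<in>UNIV. gcoef A \<iota> f q * gcoef A \<iota> f' q) = 0" if "f \<noteq> f'" for f f'
    unfolding gcoef_def using that A_bij A_sub
    by (intro signs_orthogonal[OF iota_bij]) (auto simp: bij_betw_def inj_eq)
  have g_sum: "(\<Sum>q\<in>UNIV. gcoef A \<iota> f q) = 0" for f
    using signs_orthogonal[OF iota_bij A_sub(1)[of f] empty_subsetI A_sub(2)[of f]] by (simp add: gcoef_def)
  have g_sq: "(gcoef A \<iota> f q)\<^sup>2 = 1" for f q
  proof -
    have "restrict (\<iota> q) {..<K} \<in> {..<K} \<rightarrow>\<^sub>E {-1, 1}" using bij_betw_apply[OF iota_bij] by auto
    then have "(\<iota> q k)\<^sup>2 = 1" if "k < K" for k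
      using PiE_mem[of "restrict (\<iota> q) {..<K}" "{..<K}" "\<lambda>_. {-1, 1}" k] that by auto
    then show ?thesis unfolding gcoef_def using A_sub(1)[of f] by (subst prod_power_distrib) (auto intro!: prod.neutral)
  qed
  have n_gt_1: "1 < n m" for m
  proof -
    have "CARD('q) = 2 ^ K" using bij_betw_same_card[OF iota_bij] by (simp add: card_PiE numeral_2_eq_2)
    moreover have "(2::nat) ^ 1 \<le> 2 ^ K" using K by (intro power_increasing) auto
    moreover have "CARD('q) \<le> (\<Sum>q\<in>UNIV. nq m q)" using sum_mono[of UNIV "\<lambda>_. 1" "nq m"] nq_pos by simp
    ultimately show ?thesis by (simp add: nq_sum)
  qed
  have P: "factorial_population A \<iota> (n m) (nq m)" for m
    using n_gt_1 nq_sum nq_pos g_sum by unfold_locales auto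
  have D: "assignment_design (n m) (nq m)" for m
    using n_gt_1[of m] nq_sum by unfold_locales auto
  obtain c where c: "\<And>q. 0 < c q" and c_lim: "\<And>q. (\<lambda>m. real (nq m q) / real (n m)) \<longlonglongrightarrow> c q"
    using reg_i by metis
  obtain SY where SY: "\<And>q r. (\<lambda>m. pcov (n m) (\<lambda>i. Y m i q) (\<lambda>i. Y m i r)) \<longlonglongrightarrow> SY q r"
    using reg_ii_Y unfolding convergent_def by metis
  obtain SX where SX: "\<And>q. (\<lambda>m. Sqx (n m) (Y m) (X m) q) \<longlonglongrightarrow> SX q"
    using reg_ii_qx unfolding convergent_def by metis
  obtain \<Sigma> where \<Sigma>: "(\<lambda>m. Sxx (n m) (X m)) \<longlonglongrightarrow> \<Sigma>" and inv\<Sigma>: "invertible \<Sigma>"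
    using reg_ii_xx by blast
  have n_inf: "filterlim (\<lambda>m. real (n m)) at_top sequentially"
    using filterlim_compose[OF filterlim_real_sequentially n_lim] .
  have inv_n: "(\<lambda>m. 1 / real (n m)) \<longlonglongrightarrow> 0"
    using tendsto_divide_0[OF tendsto_const filterlim_at_top_imp_at_infinity[OF n_inf]] .
  have n_ratio: "(\<lambda>m. (real (n m) - 1) / real (n m)) \<longlonglongrightarrow> 1"
  proof -
    have "(\<lambda>m. 1 - 1 / real (n m)) \<longlonglongrightarrow> 1 - 0" by (intro tendsto_intros inv_n)
    moreover have "1 - 1 / real (n m) = (real (n m) - 1) / real (n m)" for m
      using n_gt_1[of m] by (simp add: field_simps)
    ultimately show ?thesis by simp
  qed
  let ?score = "\<lambda>m. factorial_population.score K A \<iota> (n m) (nq m) (Y m) (X m)"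
  let ?cross = "\<lambda>m. factorial_population.cross K A \<iota> (n m) (nq m) (Y m) (X m)"
  let ?Bn = "\<lambda>m. factorial_population.Bn K A \<iota> (n m) (nq m) (Y m) (X m)"
  let ?U = "\<lambda>m. factorial_population.U K A \<iota> (n m) (nq m) (Y m)"
  let ?W = "\<lambda>m. factorial_population.W K A \<iota> (n m) (nq m) (X m)"
  define sc where "sc = factorial_population.scal K"
  define cY where "cY = factorial_population.coefY A \<iota>"
  define cX where "cX = (factorial_population.coefX A \<iota> :: real^('f \<times> 'l) \<Rightarrow> 'q \<Rightarrow> 'l \<Rightarrow> real)"
  have sc: "0 < sc" by (simp add: sc_def factorial_population.scal_def[OF P])
  define \<Gamma> where "\<Gamma> s t q r = cY (fst s) q * cY (fst t) r * SY q r
    + cY (fst s) q * (\<Sum>l\<in>UNIV. cX (snd t) r l * SX q $ l)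
    + cY (fst t) r * (\<Sum>l\<in>UNIV. cX (snd s) q l * SX r $ l)
    + (\<Sum>l\<in>UNIV. \<Sum>l'\<in>UNIV. cX (snd s) q l * cX (snd t) r l' * \<Sigma> $ l $ l')" for s t q r
  have cross_lim: "(\<lambda>m. ?cross m s t q r) \<longlonglongrightarrow> sc\<^sup>2 / (c q * c r) * \<Gamma> s t q r" for s t q r
  proof -
    have "(\<lambda>m. pcov (n m) (factorial_population.lin A \<iota> (Y m) (X m) s q) (factorial_population.lin A \<iota> (Y m) (X m) t r)) \<longlonglongrightarrow> \<Gamma> s t q r"
      unfolding factorial_population.pcov_lin[OF P] \<Gamma>_def cY_def[symmetric] cX_def[symmetric]
      by (intro tendsto_add tendsto_mult tendsto_sum tendsto_const SY tendsto_vec_nth SX \<Sigma>)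
    moreover have "(\<lambda>m. sc\<^sup>2 * ((real (n m) - 1) / real (n m)) / ((real (nq m q) / real (n m)) * (real (nq m r) / real (n m)))) \<longlonglongrightarrow> sc\<^sup>2 * 1 / (c q * c r)"
      using c[of q] c[of r] by (intro tendsto_intros n_ratio c_lim) auto
    ultimately have "(\<lambda>m. sc\<^sup>2 * ((real (n m) - 1) / real (n m)) / ((real (nq m q) / real (n m)) * (real (nq m r) / real (n m)))
        * pcov (n m) (factorial_population.lin A \<iota> (Y m) (X m) s q) (factorial_population.lin A \<iota> (Y m) (X m) t r))
      \<longlonglongrightarrow> sc\<^sup>2 * 1 / (c q * c r) * \<Gamma> s t q r" by (intro tendsto_mult)
    moreover have "sc\<^sup>2 * ((real (n m) - 1) / real (n m)) / ((real (nq m q) / real (n m)) * (real (nq m r) / real (n m)))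
      = sc\<^sup>2 * (real (n m) * (real (n m) - 1)) / (real (nq m q) * real (nq m r))" for m
      using n_gt_1[of m] nq_pos[of m q] nq_pos[of m r] by (simp add: field_simps)
    ultimately show ?thesis unfolding factorial_population.cross_eq[OF P] sc_def[symmetric] by (simp only: mult_1_right)
  qed
  define B where "B s t = (\<Sum>q\<in>UNIV. c q * (sc\<^sup>2 / (c q * c q) * \<Gamma> s t q q))
    - (\<Sum>q\<in>UNIV. \<Sum>r\<in>UNIV. c q * c r * (sc\<^sup>2 / (c q * c r) * \<Gamma> s t q r))" for s t
  have Bn_lim: "(\<lambda>m. ?Bn m s t) \<longlonglongrightarrow> B s t" for s t
    unfolding factorial_population.Bn_def[OF P] B_def assignment_design.share_def[OF D]
    by (intro tendsto_diff tendsto_sum tendsto_mult c_lim cross_lim)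
  have B_sym: "B s t = B t s" for s t
  proof (rule LIMSEQ_unique[OF Bn_lim])
    have "?Bn m s t = ?Bn m t s" for m by (rule factorial_population.Bn_commute[OF P])
    then show "(\<lambda>m. ?Bn m s t) \<longlonglongrightarrow> B t s" using Bn_lim[of t s] by simp
  qed
  have B_add: "B (s + s') t = B s t + B s' t" for s s' t
    by (rule LIMSEQ_unique[OF Bn_lim]) (simp only: factorial_population.Bn_linear[OF P], intro tendsto_add Bn_lim)
  have B_scale: "B (r *\<^sub>R s) t = r * B s t" for r s t
    by (rule LIMSEQ_unique[OF Bn_lim]) (simp only: factorial_population.Bn_linear[OF P], intro tendsto_mult tendsto_const Bn_lim)
  have B_bil: "bilinear B"
    unfolding bilinear_def
    using B_add B_scale B_sym by (intro conjI allI linearI) (metis B_add B_sym, metis B_scale B_sym real_scaleR_def, auto)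
  have B_nonneg: "0 \<le> B s s" for s
    by (rule LIMSEQ_le_const[OF Bn_lim]) (use factorial_population.Bn_nonneg[OF P] in blast)

  have \<Sigma>_sym: "z \<bullet> (\<Sigma> *v z') = z' \<bullet> (\<Sigma> *v z)" for z z'
  proof (rule LIMSEQ_unique[OF tendsto_quadratic_form[OF \<Sigma>]])
    show "(\<lambda>m. z \<bullet> (Sxx (n m) (X m) *v z')) \<longlonglongrightarrow> z' \<bullet> (\<Sigma> *v z)"
      using tendsto_quadratic_form[OF \<Sigma>, of z' z] by (simp add: Sxx_quadratic pcov_commute)
  qed
  have \<Sigma>_psd: "0 \<le> z \<bullet> (\<Sigma> *v z)" for z
    by (rule LIMSEQ_le_const[OF tendsto_quadratic_form[OF \<Sigma>]])
      (auto simp: Sxx_quadratic intro!: pcov_self_nonneg n_gt_1)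
  have cX_sum: "(\<Sum>q\<in>UNIV. cX u q l) = 0" for u l
    unfolding cX_def by (rule factorial_population.coefX_sum[OF P])
  have cY0: "cY 0 q = 0" for q by (simp add: cY_def factorial_population.coefY_def[OF P])
  have \<Gamma>_x: "\<Gamma> (0, u) (0, u') q r = (\<chi> l. cX u q l) \<bullet> (\<Sigma> *v (\<chi> l. cX u' r l))" for u u' q r
    by (simp add: \<Gamma>_def cY0 inner_vec_def matrix_vector_mult_def sum_distrib_left mult_ac)
  have B_x: "B (0, u) (0, u) = (\<Sum>q\<in>UNIV. sc\<^sup>2 / c q * \<Gamma> (0, u) (0, u) q q)" for u
  proof -
    have "(\<Sum>q\<in>UNIV. \<Sum>r\<in>UNIV. c q * c r * (sc\<^sup>2 / (c q * c r) * \<Gamma> (0, u) (0, u) q r)) = (\<Sum>q\<in>UNIV. \<Sum>r\<in>UNIV. sc\<^sup>2 * \<Gamma> (0, u) (0, u) q r)"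
      using c by (intro sum.cong refl) (simp add: less_imp_neq[symmetric])
    also have "\<dots> = sc\<^sup>2 * ((\<Sum>q\<in>UNIV. (\<chi> l. cX u q l)) \<bullet> (\<Sigma> *v (\<Sum>r\<in>UNIV. (\<chi> l. cX u r l))))"
      by (simp add: \<Gamma>_x inner_sum_left inner_sum_right sum_distrib_left linear_sum[OF matrix_vector_mul_linear]) (rule sum.swap)
    also have "(\<Sum>q\<in>UNIV. (\<chi> l. cX u q l)) = 0" by (simp add: vec_eq_iff cX_sum)
    finally show ?thesis unfolding B_def using c by (simp add: power2_eq_square less_imp_neq[symmetric])
  qed
  have B_pd: "u = 0" if "B (0, u) (0, u) = 0" for u
  proof -
    have nn: "0 \<le> sc\<^sup>2 / c q * \<Gamma> (0, u) (0, u) q q" for q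
      unfolding \<Gamma>_x using c[of q] \<Sigma>_psd by (intro mult_nonneg_nonneg) auto
    have "sc\<^sup>2 / c q * \<Gamma> (0, u) (0, u) q q = 0" for q
      using that nn unfolding B_x by (auto simp: sum_nonneg_eq_0_iff)
    then have "\<Gamma> (0, u) (0, u) q q = 0" for q using sc c[of q] by (metis divide_eq_0_iff less_irrefl mult_eq_0_iff power_eq_0_iff)
    then have "(\<chi> l. cX u q l) = 0" for q
      unfolding \<Gamma>_x by (rule psd_invertible_definite[OF \<Sigma>_sym \<Sigma>_psd inv\<Sigma>])
    then have z: "cX u q l = 0" for q l by (simp add: vec_eq_iff)
    have "u $ (f, l) = 0" for f l
    proof -
      have "0 = (\<Sum>q\<in>UNIV. cX u q l * gcoef A \<iota> f q)" by (simp add: z)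
      also have "\<dots> = (\<Sum>f'\<in>UNIV. u $ (f', l) * (\<Sum>q\<in>UNIV. gcoef A \<iota> f' q * gcoef A \<iota> f q))"
        unfolding cX_def factorial_population.coefX_def[OF P] sum_distrib_left sum_distrib_right
        by (subst sum.swap) (simp only: mult.assoc)
      also have "\<dots> = (\<Sum>f'\<in>UNIV. if f' = f then u $ (f, l) * real CARD('q) else 0)"
        using g_orth g_sq by (intro sum.cong refl) (auto simp: power2_eq_square)
      finally show ?thesis by simp
    qed
    then show ?thesis by (simp add: vec_eq_iff)
  qed

  define V where "V = ((\<chi> p p'. (1 / 2 ^ (2 * (K - 1))) * (\<Sum>q\<in>UNIV. gcoef A \<iota> (fst p) q * gcoef A \<iota> (fst p') q / c q) * \<Sigma> $ snd p $ snd p')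
    :: real^('f \<times> 'l)^('f \<times> 'l))"
  let ?V = "\<lambda>m. Vxx K A \<iota> (n m) (nq m) (X m)"
  have V_lim: "(\<lambda>m. real (n m) *\<^sub>R ?V m) \<longlonglongrightarrow> V"
  proof (rule vec_tendstoI, rule vec_tendstoI)
    fix p p' :: "'f \<times> 'l"
    have "(real (n m) *\<^sub>R ?V m) $ p $ p' = (1 / 2 ^ (2 * (K - 1))) *
        (\<Sum>q\<in>UNIV. gcoef A \<iota> (fst p) q * gcoef A \<iota> (fst p') q / (real (nq m q) / real (n m))) * Sxx (n m) (X m) $ snd p $ snd p'" for m
      using n_gt_1[of m] by (simp add: Vxx_def sum_distrib_left mult_ac)
    moreover have "(\<lambda>m. (1 / 2 ^ (2 * (K - 1))) *
        (\<Sum>q\<in>UNIV. gcoef A \<iota> (fst p) q * gcoef A \<iota> (fst p') q / (real (nq m q) / real (n m))) * Sxx (n m) (X m) $ snd p $ snd p')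
      \<longlonglongrightarrow> V $ p $ p'"
      unfolding V_def vec_lambda_beta using c
      by (intro tendsto_mult tendsto_sum tendsto_divide tendsto_const c_lim tendsto_vec_nth \<Sigma>) (auto simp: less_imp_neq[symmetric])
    ultimately show "(\<lambda>m. (real (n m) *\<^sub>R ?V m) $ p $ p') \<longlonglongrightarrow> V $ p $ p'" by simp
  qed
  have B_V: "B (0, u) (0, u') = u \<bullet> (V *v u')" for u u'
  proof (rule LIMSEQ_unique[OF Bn_lim])
    have "(\<lambda>m. (real (n m) - 1) / real (n m) * (u \<bullet> ((real (n m) *\<^sub>R ?V m) *v u'))) \<longlonglongrightarrow> 1 * (u \<bullet> (V *v u'))"
      by (intro tendsto_mult n_ratio tendsto_quadratic_form V_lim)
    moreover have "(real (n m) - 1) / real (n m) * (u \<bullet> ((real (n m) *\<^sub>R ?V m) *v u')) = ?Bn m (0, u) (0, u')" for m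
      using n_gt_1[of m] by (simp add: factorial_population.Bn_covariate[OF P] scaleR_matrix_vector_assoc[symmetric])
    ultimately show "(\<lambda>m. ?Bn m (0, u) (0, u')) \<longlonglongrightarrow> u \<bullet> (V *v u')" by simp
  qed
  have V_inv: "invertible V"
  proof -
    have "inj ((*v) V)"
      unfolding linear_injective_0[OF matrix_vector_mul_linear] using B_V B_pd by (metis inner_zero_right)
    then show ?thesis unfolding invertible_left_inverse matrix_left_invertible_injective .
  qed
  define q where "q w = w \<bullet> (matrix_inv V *v w)" for w
  define qm where "qm m w = w \<bullet> (((1 / real (n m)) *\<^sub>R matrix_inv (?V m)) *v w)" for m w
  define \<kappa> where "\<kappa> m = (\<Sum>p\<in>UNIV. \<Sum>p'\<in>UNIV. \<bar>((1 / real (n m)) *\<^sub>R matrix_inv (?V m)) $ p $ p' - matrix_inv V $ p $ p'\<bar>)" for m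
  have "(\<lambda>m. matrix_inv (real (n m) *\<^sub>R ?V m)) \<longlonglongrightarrow> matrix_inv V"
    by (rule tendsto_matrix_inv[OF V_lim V_inv])
  moreover have "\<forall>\<^sub>F m in sequentially. matrix_inv (real (n m) *\<^sub>R ?V m) = (1 / real (n m)) *\<^sub>R matrix_inv (?V m)"
  proof -
    have "\<forall>\<^sub>F m in sequentially. det (real (n m) *\<^sub>R ?V m) \<noteq> 0"
      using tendsto_det[OF V_lim] V_inv by (intro tendsto_imp_eventually_ne) (auto simp: invertible_det_nz)
    then show ?thesis
    proof eventually_elim
      case (elim m)
      have n0: "real (n m) \<noteq> 0" using n_gt_1[of m] by simp
      have "matrix_inv (?V m) = matrix_inv ((1 / real (n m)) *\<^sub>R (real (n m) *\<^sub>R ?V m))" using n0 by simp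
      also have "\<dots> = real (n m) *\<^sub>R matrix_inv (real (n m) *\<^sub>R ?V m)"
        using elim n0 by (subst matrix_inv_scaleR) (auto simp: invertible_det_nz)
      finally show ?case using n0 by simp
    qed
  qed
  ultimately have R_lim: "(\<lambda>m. (1 / real (n m)) *\<^sub>R matrix_inv (?V m)) \<longlonglongrightarrow> matrix_inv V"
    by (rule Lim_transform_eventually)
  have "\<kappa> \<longlonglongrightarrow> (\<Sum>p\<in>UNIV. \<Sum>p'\<in>UNIV. \<bar>matrix_inv V $ p $ p' - matrix_inv V $ p $ p'\<bar>)"
    unfolding \<kappa>_def[abs_def] by (intro tendsto_sum tendsto_rabs tendsto_diff tendsto_const tendsto_vec_nth R_lim)
  then have \<kappa>_lim: "\<kappa> \<longlonglongrightarrow> 0" by simp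

  have TE_lim: "(\<lambda>m. assignment_design.total_energy (n m) (?score m t)) \<longlonglongrightarrow> (\<Sum>q\<in>UNIV. sc\<^sup>2 / (c q * c q) * \<Gamma> t t q q)" for t
    unfolding factorial_population.total_energy_score[OF P] by (intro tendsto_sum cross_lim)
  define \<eta> where "\<eta> m t q = sc / (real (nq m q) / real (n m)) *
     (\<bar>cY (fst t) q\<bar> * sqrt (Max ((\<lambda>i. (Y m i q - pmean (n m) (\<lambda>j. Y m j q))\<^sup>2) ` {..<n m}) / real (n m))
    + (\<Sum>l\<in>UNIV. \<bar>cX (snd t) q l\<bar>) * sqrt (Max ((\<lambda>i. (norm (X m i - (\<chi> l. pmean (n m) (\<lambda>j. X m j $ l))))\<^sup>2) ` {..<n m}) / real (n m)))" for m t q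
  define \<delta> where "\<delta> m t = (\<Sum>q\<in>UNIV. \<eta> m t q)" for m t
  have \<delta>_lim: "(\<lambda>m. \<delta> m t) \<longlonglongrightarrow> 0" for t
  proof -
    have "(\<lambda>m. \<delta> m t) \<longlonglongrightarrow> (\<Sum>q\<in>UNIV. sc / c q * (\<bar>cY (fst t) q\<bar> * sqrt 0 + (\<Sum>l\<in>UNIV. \<bar>cX (snd t) q l\<bar>) * sqrt 0))"
      unfolding \<delta>_def \<eta>_def using c
      by (intro tendsto_sum tendsto_mult tendsto_divide tendsto_add tendsto_const tendsto_real_sqrt c_lim reg_iii_Y reg_iii_x)
        (auto simp: less_imp_neq[symmetric])
    then show ?thesis by simp
  qed
  have \<delta>: "\<bar>?score m t i q\<bar> \<le> \<delta> m t" if "i < n m" for m t i q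
  proof -
    have le: "\<bar>?score m t i q\<bar> \<le> \<eta> m t q" for q
      unfolding \<eta>_def sc_def cY_def cX_def by (rule factorial_population.score_bound[OF P that])
    then have "0 \<le> \<eta> m t q" for q using abs_ge_zero order_trans by blast
    then have "\<eta> m t q \<le> \<delta> m t" unfolding \<delta>_def by (intro member_le_sum) auto
    with le show ?thesis by (rule order_trans)
  qed
  let ?P = "\<lambda>m. measure_pmf (pmf_of_set (assignments (n m) (nq m)))"
  have \<Omega>_eq: "assignment_design.\<Omega> (n m) (nq m) = assignments (n m) (nq m)" for m
    by (rule assignment_design.\<Omega>_def[OF D])
  have stat: "t \<bullet> (?U m Z, ?W m Z) = assignment_design.stat (n m) (?score m t) Z" if "Z \<in> assignments (n m) (nq m)" for m t Z
    by (rule factorial_population.stat_score[OF P]) (simp add: \<Omega>_eq that)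
  have char: "(\<lambda>m. \<integral>Z. iexp (t \<bullet> (?U m Z, ?W m Z)) \<partial>?P m) \<longlonglongrightarrow> of_real (exp (- B t t / 2))" for t
  proof -
    define TE where "TE m = assignment_design.total_energy (n m) (?score m t)" for m
    have eq: "(\<integral>Z. iexp (t \<bullet> (?U m Z, ?W m Z)) \<partial>?P m) = assignment_design.avg (n m) (nq m) (\<lambda>Z. iexp (assignment_design.stat (n m) (?score m t) Z))" for m
      unfolding assignment_design.integral_assignments_eq_avg[OF D]
      by (rule assignment_design.avg_cong[OF D]) (simp add: \<Omega>_eq stat)
    have bound: "cmod ((\<integral>Z. iexp (t \<bullet> (?U m Z, ?W m Z)) \<partial>?P m) - of_real (exp (- ?Bn m t t / 2)))
      \<le> 3 * \<delta> m t * sqrt (TE m) + 4 * TE m * (1 / real (n m)) + 8 * \<delta> m t * TE m" for m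
    proof -
      have "cmod (assignment_design.avg (n m) (nq m) (\<lambda>Z. iexp (assignment_design.stat (n m) (?score m t) Z))
          - of_real (exp (- assignment_design.limvar (n m) (nq m) (?score m t) / 2)))
        \<le> 3 * \<delta> m t * sqrt (TE m) + 4 * TE m / real (n m) + 8 * \<delta> m t * TE m"
        unfolding TE_def
        by (rule assignment_design.finite_population_clt[OF D factorial_population.score_centred[OF P] \<delta>])
      then show ?thesis unfolding eq factorial_population.limvar_score[OF P] by simp
    qed
    have "(\<lambda>m. 3 * \<delta> m t * sqrt (TE m) + 4 * TE m * (1 / real (n m)) + 8 * \<delta> m t * TE m) \<longlonglongrightarrow>
       3 * 0 * sqrt (\<Sum>q\<in>UNIV. sc\<^sup>2 / (c q * c q) * \<Gamma> t t q q) + 4 * (\<Sum>q\<in>UNIV. sc\<^sup>2 / (c q * c q) * \<Gamma> t t q q) * 0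
       + 8 * 0 * (\<Sum>q\<in>UNIV. sc\<^sup>2 / (c q * c q) * \<Gamma> t t q q)"
      unfolding TE_def by (intro tendsto_intros \<delta>_lim TE_lim inv_n)
    then have "(\<lambda>m. 3 * \<delta> m t * sqrt (TE m) + 4 * TE m * (1 / real (n m)) + 8 * \<delta> m t * TE m) \<longlonglongrightarrow> 0" by simp
    then have "(\<lambda>m. (\<integral>Z. iexp (t \<bullet> (?U m Z, ?W m Z)) \<partial>?P m) - of_real (exp (- ?Bn m t t / 2))) \<longlonglongrightarrow> 0"
      by (rule Lim_null_comparison[rotated]) (use bound in \<open>auto intro: always_eventually\<close>)
    moreover have "(\<lambda>m. complex_of_real (exp (- ?Bn m t t / 2))) \<longlonglongrightarrow> of_real (exp (- B t t / 2))"
      by (intro tendsto_intros Bn_lim) simp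
    ultimately show ?thesis using tendsto_add by fastforce
  qed
  obtain TB where TB: "\<And>t m. assignment_design.total_energy (n m) (?score m t) \<le> TB t"
  proof -
    have "\<exists>b. \<forall>m. assignment_design.total_energy (n m) (?score m t) \<le> b" for t
    proof -
      have "Bseq (\<lambda>m. assignment_design.total_energy (n m) (?score m t))"
        using TE_lim[of t] by (intro convergent_imp_Bseq convergentI)
      then obtain b where "\<And>m. norm (assignment_design.total_energy (n m) (?score m t)) \<le> b"
        by (auto simp: Bseq_def)
      then have "assignment_design.total_energy (n m) (?score m t) \<le> b" for m
        by (metis abs_le_D1 real_norm_def)
      then show ?thesis by blast
    qed
    then show thesis using that by metis
  qed
  have mom: "(\<integral>Z. (norm (?U m Z, ?W m Z))\<^sup>2 \<partial>?P m) \<le> (\<Sum>b\<in>Basis. 4 * TB b)" for m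
  proof -
    have "(\<integral>Z. (norm (?U m Z, ?W m Z))\<^sup>2 \<partial>?P m)
      = assignment_design.avg (n m) (nq m) (\<lambda>Z. \<Sum>b\<in>Basis. (assignment_design.stat (n m) (?score m b) Z)\<^sup>2)"
      unfolding assignment_design.integral_assignments_eq_avg[OF D]
    proof (rule assignment_design.avg_cong[OF D])
      fix Z assume "Z \<in> assignment_design.\<Omega> (n m) (nq m)"
      then have s: "(?U m Z, ?W m Z) \<bullet> b = assignment_design.stat (n m) (?score m b) Z" for b
        using stat[of Z m b] by (simp add: \<Omega>_eq inner_commute)
      have norm_sq: "(norm x)\<^sup>2 = (\<Sum>b\<in>Basis. (x \<bullet> b)\<^sup>2)" for x :: "(real^'f) \<times> (real^('f \<times> 'l))"
        unfolding power2_norm_eq_inner euclidean_inner[of x x] by (simp add: power2_eq_square)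
      show "(norm (?U m Z, ?W m Z))\<^sup>2 = (\<Sum>b\<in>Basis. (assignment_design.stat (n m) (?score m b) Z)\<^sup>2)"
        unfolding norm_sq s ..
    qed
    also have "\<dots> = (\<Sum>b\<in>Basis. assignment_design.avg (n m) (nq m) (\<lambda>Z. (assignment_design.stat (n m) (?score m b) Z)\<^sup>2))"
      by (rule assignment_design.avg_sum[OF D])
    also have "\<dots> \<le> (\<Sum>b\<in>Basis. 4 * TB b)"
    proof (rule sum_mono)
      fix b :: "(real^'f) \<times> (real^('f \<times> 'l))"
      show "assignment_design.avg (n m) (nq m) (\<lambda>Z. (assignment_design.stat (n m) (?score m b) Z)\<^sup>2) \<le> 4 * TB b"
      proof -
        have "assignment_design.avg (n m) (nq m) (\<lambda>Z. (assignment_design.stat (n m) (?score m b) Z)\<^sup>2)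
          \<le> 4 * assignment_design.energy (n m) (nq m) (?score m b)"
          by (rule assignment_design.avg_stat_sq_le[OF D factorial_population.score_centred[OF P]])
        moreover have "assignment_design.energy (n m) (nq m) (?score m b) \<le> assignment_design.total_energy (n m) (?score m b)"
          by (rule assignment_design.energy_le_total[OF D])
        ultimately show ?thesis using TB[of m b] by linarith
      qed
    qed
    finally show ?thesis .
  qed

  have "\<exists>\<phi> \<psi>.
      weak_conv_to (\<lambda>m. distr (measure_pmf (pmf_of_set {Z \<in> assignments (n m) (nq m). qm m (?W m Z) \<le> a})) borel (?U m)) \<phi>
    \<and> weak_conv_to (\<lambda>m. distr (?P m) borel (?U m)) \<psi>
    \<and> (\<forall>C. C \<in> sets borel \<and> convex C \<and> uminus ` C = C \<longrightarrow> measure \<phi> C \<ge> measure \<psi> C)"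
  proof (rule peaked_conditional_limit[OF assignments_finite assignments_nonempty[OF nq_sum] B_bil B_sym B_nonneg B_pd char mom _ _ \<kappa>_lim _ a_pos])
    show "continuous_on UNIV q"
      unfolding q_def by (intro continuous_intros linear_continuous_on linear_linear[THEN iffD2] matrix_vector_mul_linear)
    show "\<bar>qm m w - q w\<bar> \<le> \<kappa> m * (norm w)\<^sup>2" for m w
      unfolding qm_def q_def \<kappa>_def by (rule quadratic_form_diff_bound)
    show "q w = B (0, u) (0, u)" if "\<And>u'. B (0, u) (0, u') = w \<bullet> u'" for u w
    proof -
      have "(V *v u) \<bullet> u' = w \<bullet> u'" for u'
        using that[of u'] B_sym[of "(0, u)" "(0, u')"] by (simp add: B_V inner_commute)
      then have "w = V *v u" by (metis vector_eq_rdot)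
      then show ?thesis by (simp add: q_def B_V matrix_inv_vector_mult(1)[OF V_inv] inner_commute)
    qed
  qed
  moreover have "{Z \<in> assignments (n m) (nq m). qm m (?W m Z) \<le> a} = accepted K A \<iota> (n m) (nq m) (X m) a" for m
  proof -
    have "qm m (?W m Z) = tauhat_x K A \<iota> (n m) (nq m) (X m) Z \<bullet> (matrix_inv (?V m) *v tauhat_x K A \<iota> (n m) (nq m) (X m) Z)" for Z
      using n_gt_1[of m] unfolding qm_def factorial_population.W_def[OF P]
      by (simp add: matrix_vector_mult_scaleR scaleR_matrix_vector_assoc[symmetric] flip: mult.assoc)
    then show ?thesis by (simp add: accepted_def)
  qed
  moreover have "distr M borel (?U m) = distr M borel (\<lambda>Z. sqrt (real (n m)) *\<^sub>R (tauhat K A \<iota> (n m) (nq m) (Y m) Z - tau K A \<iota> (n m) (Y m)))" for M m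
    by (simp add: factorial_population.U_def[OF P, abs_def])
  ultimately show ?thesis by (simp add: samp_dist_def)
qed

end
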